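(* The rank-nullity ring $R^*(U_{r,n})= A^*(U_{n,n})^{S_n}$ of the uniform matroid is isomorphic to the quotient of the polynomial ring $\mathbb{Z}[Z_1, \dots, Z_n]$ by the ideal $\mathcal I$ generated by the polynomials $$Z_a \cdot \left( \sum_{i = b}^n \binom{i-a-1}{b-a-1} (Z_i + Z_{i+1} + \dots + Z_n )^{b-a} \right) \qquad \text{for } 0\leq a < b \leq n$$ (with the convention $Z_0 = 1$), where the class $[Z_i]$ corresponds to $z_i \in R^*(U_{r,n})$. Furthermore, these polynomials are a Gröbner basis for $\mathcal I$ with respect to any monomial order with $Z_1 \succ Z_2 \succ \dots \succ Z_n$.
   Context: Let $A^*(U_{n,n})=\mathbb{Z}[x_S : \emptyset \neq S \subseteq [n]]/(\langle x_S x_T : S\not\subseteq T,\ T\not\subseteq S\rangle+\langle \sum_{S\ni e}x_S : e\in[n]\rangle)$, with $S_n$ acting by permuting the subsets. For a matroid $M$ on $[n]$ with rank function $\mathrm{rk}$ and nullity $\mathrm{null}(S)=|S|-\mathrm{rk}(S)$, let $y_{i,j}=\sum_{\emptyset\neq S,\ \mathrm{rk}(S)=i,\ \mathrm{null}(S)=j} x_S$ and $R^*(M)=\mathbb{Z}[y_{i,j}]\subseteq A^*(U_{n,n})$. For the uniform matroid $U_{r,n}$, $R^*(U_{r,n})=\mathbb{Z}[z_1,\dots,z_n]$ with $z_l=\sum_{|S|=l}x_S$, and it equals $A^*(U_{n,n})^{S_n}$. *)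

theory Defs
  imports
    "HOL-Library.Poly_Mapping"
    "HOL-Combinatorics.Permutations"
    "HOL-Algebra.QuotRing"
    "HOL-Algebra.Generated_Rings"
begin

text \<open>A monomial is its finitely supported exponent function; products of monomials are sums of
  exponent functions.\<close>

type_synonym 'v mon = "'v \<Rightarrow>\<^sub>0 nat"
type_synonym 'v mpoly = "'v mon \<Rightarrow>\<^sub>0 int"

definition monomials :: "'v set \<Rightarrow> 'v mon set" where
  "monomials V = {m. Poly_Mapping.keys m \<subseteq> V}"

definition var_mon :: "'v \<Rightarrow> 'v mon" where
  "var_mon v = Poly_Mapping.single v 1"

definition mvar :: "'v \<Rightarrow> 'v mpoly" where
  "mvar v = Poly_Mapping.single (var_mon v) 1"

definition mpoly_ring :: "'v set \<Rightarrow> 'v mpoly ring" where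
  "mpoly_ring V =
     \<lparr>carrier = {p. Poly_Mapping.keys p \<subseteq> monomials V}, mult = (*), one = 1, zero = 0, add = (+)\<rparr>"

definition mpoly_subst :: "('v \<Rightarrow> 'w mpoly) \<Rightarrow> 'v mpoly \<Rightarrow> 'w mpoly" where
  "mpoly_subst f p =
     (\<Sum>m\<in>Poly_Mapping.keys p. of_int (Poly_Mapping.lookup p m) *
        (\<Prod>v\<in>Poly_Mapping.keys m. f v ^ Poly_Mapping.lookup m v))"

lemma monomials_add: "a \<in> monomials V \<Longrightarrow> b \<in> monomials V \<Longrightarrow> a + b \<in> monomials V"
  unfolding monomials_def using Poly_Mapping.keys_add[of a b] by blast

lemma cring_mpoly_ring: "cring (mpoly_ring V)"
proof (rule cringI)
  show "abelian_group (mpoly_ring V)"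
  proof (rule abelian_groupI)
    fix x y assume "x \<in> carrier (mpoly_ring V)" "y \<in> carrier (mpoly_ring V)"
    then show "x \<oplus>\<^bsub>mpoly_ring V\<^esub> y \<in> carrier (mpoly_ring V)"
      using Poly_Mapping.keys_add[of x y] by (auto simp: mpoly_ring_def)
  next
    fix x assume "x \<in> carrier (mpoly_ring V)"
    then show "\<exists>y\<in>carrier (mpoly_ring V). y \<oplus>\<^bsub>mpoly_ring V\<^esub> x = \<zero>\<^bsub>mpoly_ring V\<^esub>"
      by (intro bexI[of _ "- x"]) (auto simp: mpoly_ring_def in_keys_iff)
  qed (auto simp: mpoly_ring_def algebra_simps)
next
  show "Group.comm_monoid (mpoly_ring V)"
  proof (rule Group.comm_monoidI)
    fix x y assume "x \<in> carrier (mpoly_ring V)" "y \<in> carrier (mpoly_ring V)"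
    then show "x \<otimes>\<^bsub>mpoly_ring V\<^esub> y \<in> carrier (mpoly_ring V)"
      using Poly_Mapping.keys_mult[of x y] by (fastforce simp: mpoly_ring_def intro: monomials_add)
  qed (auto simp: mpoly_ring_def algebra_simps monomials_def)
qed (auto simp: mpoly_ring_def algebra_simps)

text \<open>The pair (a, b) belongs to the relation iff a is less than or equal to b.\<close>

definition monomial_order :: "'v set \<Rightarrow> 'v mon rel \<Rightarrow> bool" where
  "monomial_order V r \<longleftrightarrow> well_order_on (monomials V) r \<and>
     (\<forall>a b. \<forall>c\<in>monomials V. (a, b) \<in> r \<longrightarrow> (a + c, b + c) \<in> r)"

definition lead_mon :: "'v mon rel \<Rightarrow> 'v mpoly \<Rightarrow> 'v mon" where
  "lead_mon r p = (THE m. m \<in> Poly_Mapping.keys p \<and> (\<forall>k\<in>Poly_Mapping.keys p. (k, m) \<in> r))"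

text \<open>The leading term includes its coefficient, as it must over a coefficient ring that is not a
  field. The leading term of 0 is 0.\<close>

definition lead_term :: "'v mon rel \<Rightarrow> 'v mpoly \<Rightarrow> 'v mpoly" where
  "lead_term r p = Poly_Mapping.single (lead_mon r p) (Poly_Mapping.lookup p (lead_mon r p))"

definition groebner_basis :: "'v set \<Rightarrow> 'v mon rel \<Rightarrow> 'v mpoly set \<Rightarrow> 'v mpoly set \<Rightarrow> bool" where
  "groebner_basis V r I G \<longleftrightarrow> finite G \<and> G \<subseteq> I \<and>
     Idl\<^bsub>mpoly_ring V\<^esub> (lead_term r ` G) = Idl\<^bsub>mpoly_ring V\<^esub> (lead_term r ` I)"

locale matroid =
  fixes E :: "'a set" and indep :: "'a set \<Rightarrow> bool"
  assumes finite_ground: "finite E"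
    and indep_subset_ground: "indep I \<Longrightarrow> I \<subseteq> E"
    and indep_empty: "indep {}"
    and indep_hereditary: "indep I \<Longrightarrow> J \<subseteq> I \<Longrightarrow> indep J"
    and indep_augment: "indep I \<Longrightarrow> indep J \<Longrightarrow> card I < card J \<Longrightarrow>
          \<exists>x\<in>J - I. indep (insert x I)"

definition matroid_rank :: "('a set \<Rightarrow> bool) \<Rightarrow> 'a set \<Rightarrow> nat" where
  "matroid_rank indep S = Max {card I | I. I \<subseteq> S \<and> indep I}"

text \<open>The rank never exceeds the cardinality of a finite set, so the subtraction is exact.\<close>

definition nullity :: "('a set \<Rightarrow> bool) \<Rightarrow> 'a set \<Rightarrow> nat" where
  "nullity indep S = card S - matroid_rank indep S"

definition uniform_indep :: "nat \<Rightarrow> nat \<Rightarrow> nat set \<Rightarrow> bool" where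
  "uniform_indep r n I \<longleftrightarrow> I \<subseteq> {1..n} \<and> card I \<le> r"

lemma matroid_uniform: "matroid {1..n} (uniform_indep r n)"
proof
  fix I J assume *: "uniform_indep r n I" "uniform_indep r n J" "card I < card J"
  then have fin: "finite I" "finite J"
    by (auto simp: uniform_indep_def intro: finite_subset)
  with * obtain x where "x \<in> J - I"
    by (metis Diff_eq_empty_iff card_mono ex_in_conv leD)
  with * fin show "\<exists>x\<in>J - I. uniform_indep r n (insert x I)"
    by (intro bexI[of _ x]) (auto simp: uniform_indep_def)
next
  fix I J assume "uniform_indep r n I" "J \<subseteq> I"
  then show "uniform_indep r n J"
    unfolding uniform_indep_def
    by (meson card_mono finite_atLeastAtMost finite_subset order_trans)
qed (auto simp: uniform_indep_def)

definition faces :: "nat \<Rightarrow> nat set set" where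
  "faces n = {S. S \<noteq> {} \<and> S \<subseteq> {1..n}}"

definition chow_ideal :: "nat \<Rightarrow> nat set mpoly set" where
  "chow_ideal n =
     Idl\<^bsub>mpoly_ring (faces n)\<^esub>
       {mvar S * mvar T | S T. S \<in> faces n \<and> T \<in> faces n \<and> \<not> S \<subseteq> T \<and> \<not> T \<subseteq> S}
     <+>\<^bsub>mpoly_ring (faces n)\<^esub>
     Idl\<^bsub>mpoly_ring (faces n)\<^esub>
       {(\<Sum>S | S \<in> faces n \<and> e \<in> S. mvar S) | e. e \<in> {1..n}}"

definition chow_ring :: "nat \<Rightarrow> nat set mpoly set ring" where
  "chow_ring n = mpoly_ring (faces n) Quot chow_ideal n"

definition chow_class :: "nat \<Rightarrow> nat set mpoly \<Rightarrow> nat set mpoly set" where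
  "chow_class n p = chow_ideal n +>\<^bsub>mpoly_ring (faces n)\<^esub> p"

definition perm_act :: "(nat \<Rightarrow> nat) \<Rightarrow> nat set mpoly \<Rightarrow> nat set mpoly" where
  "perm_act \<sigma> = mpoly_subst (\<lambda>S. mvar (\<sigma> ` S))"

text \<open>Permuting the variables preserves the Chow ideal, so the induced action on the quotient sends
  a coset to its image.\<close>

definition chow_invariants :: "nat \<Rightarrow> nat set mpoly set set" where
  "chow_invariants n =
     {c \<in> carrier (chow_ring n). \<forall>\<sigma>. \<sigma> permutes {1..n} \<longrightarrow> perm_act \<sigma> ` c = c}"

definition rank_nullity_class ::
    "nat \<Rightarrow> (nat set \<Rightarrow> bool) \<Rightarrow> nat \<Rightarrow> nat \<Rightarrow> nat set mpoly set" where
  "rank_nullity_class n indep i j =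
     chow_class n (\<Sum>S | S \<in> faces n \<and> matroid_rank indep S = i \<and> nullity indep S = j. mvar S)"

definition rank_nullity_ring :: "nat \<Rightarrow> (nat set \<Rightarrow> bool) \<Rightarrow> nat set mpoly set ring" where
  "rank_nullity_ring n indep =
     (chow_ring n)\<lparr>carrier :=
        generate_ring (chow_ring n) {rank_nullity_class n indep i j | i j. True}\<rparr>"

definition level_class :: "nat \<Rightarrow> nat \<Rightarrow> nat set mpoly set" where
  "level_class n l = chow_class n (\<Sum>S | S \<in> faces n \<and> card S = l. mvar S)"

text \<open>The first factor encodes the convention that the variable with index 0 stands for 1.
  For a < b and i at least b, the subtractions are exact.\<close>

definition rel_poly :: "nat \<Rightarrow> nat \<Rightarrow> nat \<Rightarrow> nat mpoly" where
  "rel_poly n a b =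
     (if a = 0 then 1 else mvar a) *
     (\<Sum>i = b..n. of_nat ((i - a - 1) choose (b - a - 1)) * (\<Sum>k = i..n. mvar k) ^ (b - a))"

definition rel_polys :: "nat \<Rightarrow> nat mpoly set" where
  "rel_polys n = {rel_poly n a b | a b. a < b \<and> b \<le> n}"

definition rel_ideal :: "nat \<Rightarrow> nat mpoly set" where
  "rel_ideal n = Idl\<^bsub>mpoly_ring {1..n}\<^esub> (rel_polys n)"

end

(*
  The Chow ring is free with basis the Feichtner-Yuzvinsky monomials, which the symmetric group
  permutes. Their orbit sums are the monomials in the level sums z_l whose exponents satisfy
  d_b < b - a for consecutive levels a < b, because variables of distinct sets of equal size multiply
  to 0. So these standard monomials form a basis of the invariants, and they are exactly the monomials
  not divisible by a leading monomial Z_a Z_b^(b-a) of the given relations. Hence the relations, once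
  known to hold, generate all relations and form a Groebner basis for every admissible order.

  With h_G the sum of the x_S over S containing G, x_F h_G^(|G|-|F|) = 0 follows by induction on |G - F|
  from the linear relations. Summing over all G of size b above F, and over all F of size a, gives
  the relation for (a, b): modulo the products of incomparable variables a power of a sum of variables
  over an upward closed family splits according to the smallest set of a monomial, and the binomial
  coefficients count the G below that set. The same relations reduce every monomial to
  Feichtner-Yuzvinsky monomials.

  For linear independence, evaluate at the points of the permutations w of [n], where x_S is sent to
  w_j - w_(j+1) if S = {w_1, ..., w_j} and to 0 otherwise. The evaluations kill the products of
  incomparable variables and send the linear generators to constants. A homogeneous relation of degree d
  modulo the Chow ideal therefore has the same values as a polynomial of degree less than d, hence as
  a combination of Feichtner-Yuzvinsky monomials of degree less than d, and it suffices that these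
  monomials are linearly independent as functions on the permutations.
*)

theory Submission
  imports Defs "HOL-Computational_Algebra.Polynomial"
begin

section \<open>Polynomials and their ideals\<close>

text \<open>No point of a chamber except the origin kills all linear generators: along a flag their
  values are the partial sums, taken from the top, of the values of its sets. Useful evaluations
  therefore cannot factor through the Chow ring, and the argument is filtered by degree rather than
  graded. The points are chosen so that the linear generator of \<open>e\<close> has the same value
  e - (n + 1) at all permutations; a constant has smaller degree than the generator, and this drop
  is all that is used. The entries of a permutation are distinct, so w_i - w_(s+1) takes different
  values for different i, and a polynomial in one variable whose degree is below the number of these
  i must vanish. The exponent bound of the Feichtner-Yuzvinsky monomials is exactly this number. All
  reductions use relations with leading coefficient 1, hence work over the integers. Polynomials
  have all elements of a type as variables; foreign variables are absorbed into the ideals instead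
  of being excluded at each step.\<close>

abbreviation lookup where "lookup \<equiv> Poly_Mapping.lookup"
abbreviation keys where "keys \<equiv> Poly_Mapping.keys"
abbreviation single where "single \<equiv> Poly_Mapping.single"

lemma lookup_add_apply [simp]: "lookup (p + q) k = lookup p k + lookup q k"
  by (rule lookup_add)

lemma keys_add_nat: "keys (a + b) = keys a \<union> keys (b :: 'v mon)"
  by (auto simp: in_keys_iff)

lemma sum_singles: "(\<Sum>m\<in>keys p. single m (lookup p m)) = p"
  by (rule poly_mapping_eqI)
    (auto simp: lookup_sum lookup_single when_def in_keys_iff sum.delta' cong: if_cong)

lemma mpoly_induct [case_names single add]:
  assumes "\<And>m c. P (single m c)" "\<And>p q. P p \<Longrightarrow> P q \<Longrightarrow> P (p + q)"
  shows "P (p :: 'v mpoly)"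
proof -
  have "P (\<Sum>m\<in>A. single m (lookup p m))" if "finite A" for A
    using that
  proof induction
    case empty
    then show ?case using assms(1)[of 0 0] by simp
  qed (simp add: assms)
  from this[OF finite_keys[of p]] show ?thesis by (simp add: sum_singles)
qed

section \<open>Evaluation homomorphisms of integer polynomials\<close>

definition mon_eval :: "('v \<Rightarrow> 'r::comm_ring_1) \<Rightarrow> 'v mon \<Rightarrow> 'r" where
  "mon_eval f m = (\<Prod>v\<in>keys m. f v ^ lookup m v)"

definition meval :: "('v \<Rightarrow> 'r::comm_ring_1) \<Rightarrow> 'v mpoly \<Rightarrow> 'r" where
  "meval f p = (\<Sum>m\<in>keys p. of_int (lookup p m) * mon_eval f m)"

lemma mpoly_subst_eq_meval: "mpoly_subst f = meval f"
  by (simp add: fun_eq_iff mpoly_subst_def meval_def mon_eval_def)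

lemma mon_eval_superset:
  "finite A \<Longrightarrow> keys m \<subseteq> A \<Longrightarrow> mon_eval f m = (\<Prod>v\<in>A. f v ^ lookup m v)"
  unfolding mon_eval_def by (rule prod.mono_neutral_left) (auto simp: in_keys_iff)

lemma mon_eval_0 [simp]: "mon_eval f 0 = 1"
  by (simp add: mon_eval_def)

lemma mon_eval_single [simp]: "mon_eval f (single v k) = f v ^ k"
  by (cases "k = 0") (simp_all add: mon_eval_def)

lemma mon_eval_add [simp]: "mon_eval f (a + b) = mon_eval f a * mon_eval f b"
proof -
  have "mon_eval f m = (\<Prod>v\<in>keys a \<union> keys b. f v ^ lookup m v)" if "m \<in> {a, b, a + b}" for m
    using that by (intro mon_eval_superset) (auto simp: keys_add_nat)
  then show ?thesis
    by (simp add: power_add prod.distrib)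
qed

lemma mon_eval_sum: "mon_eval f (\<Sum>i\<in>A. g i) = (\<Prod>i\<in>A. mon_eval f (g i))"
  by (induction A rule: infinite_finite_induct) auto

lemma meval_superset:
  "finite A \<Longrightarrow> keys p \<subseteq> A \<Longrightarrow> meval f p = (\<Sum>m\<in>A. of_int (lookup p m) * mon_eval f m)"
  unfolding meval_def by (rule sum.mono_neutral_left) (auto simp: in_keys_iff)

lemma meval_0 [simp]: "meval f 0 = 0"
  by (simp add: meval_def)

lemma meval_single [simp]: "meval f (single m c) = of_int c * mon_eval f m"
  by (cases "c = 0") (simp_all add: meval_def)

lemma meval_1 [simp]: "meval f 1 = 1"
  using meval_single[of f 0 1] by simp

lemma meval_add [simp]: "meval f (p + q) = meval f p + meval f q"
proof -
  have "meval f r = (\<Sum>m\<in>keys p \<union> keys q. of_int (lookup r m) * mon_eval f m)"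
    if "r \<in> {p, q, p + q}" for r
    using that keys_add[of p q] by (intro meval_superset) auto
  then show ?thesis
    by (simp add: distrib_right sum.distrib)
qed

lemma meval_mult [simp]: "meval f (p * q) = meval f p * meval f q"
proof (induction p rule: mpoly_induct)
  case (single m c)
  show ?case
    by (induction q rule: mpoly_induct) (simp_all add: mult_single distrib_left distrib_right mult_ac)
qed (simp add: distrib_right)

lemma meval_uminus [simp]: "meval f (- p) = - meval f p"
  using meval_add[of f p "- p"] by (simp add: eq_neg_iff_add_eq_0 add.commute)

lemma meval_diff [simp]: "meval f (p - q) = meval f p - meval f q"
  using meval_add[of f p "- q"] by simp

lemma meval_sum [simp]: "meval f (\<Sum>i\<in>A. g i) = (\<Sum>i\<in>A. meval f (g i))"
  by (induction A rule: infinite_finite_induct) auto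

lemma meval_power [simp]: "meval f (p ^ k) = meval f p ^ k"
  by (induction k) auto

lemma meval_mvar [simp]: "meval f (mvar v) = f v"
  by (simp add: mvar_def var_mon_def)

lemma meval_of_nat [simp]: "meval f (of_nat k) = of_nat k"
  by (induction k) auto

lemma meval_of_int [simp]: "meval f (of_int k) = of_int k"
  by (cases k) (auto simp del: of_nat_Suc)

lemma mon_eval_mvar: "mon_eval mvar m = single m 1"
proof -
  have *: "mvar v ^ k = single (single v k) 1" for v :: 'a and k
    by (induction k) (simp_all add: mvar_def var_mon_def mult_single single_add[symmetric])
  have "mon_eval mvar m = (\<Prod>v\<in>A. single (single v (lookup m v)) 1)" if "A = keys m" for A
    unfolding mon_eval_def that by (simp add: *)
  moreover have "(\<Prod>v\<in>A. single (single v (lookup m v)) (1::int)) = single (\<Sum>v\<in>A. single v (lookup m v)) 1"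
    for A by (induction A rule: infinite_finite_induct) (auto simp: mult_single)
  ultimately show ?thesis
    by (simp add: sum_singles)
qed

lemma meval_mvar_id [simp]: "meval mvar p = p"
  by (induction p rule: mpoly_induct) (simp_all add: mon_eval_mvar mult_single flip: single_of_int)

lemma mvar_power: "mvar v ^ k = single (single v k) 1"
  using mon_eval_mvar[of "single v k"] by simp

lemma mon_eval_cong: "(\<And>v. v \<in> keys m \<Longrightarrow> f v = g v) \<Longrightarrow> mon_eval f m = mon_eval g m"
  by (simp add: mon_eval_def)

lemma meval_cong:
  "(\<And>m v. m \<in> keys p \<Longrightarrow> v \<in> keys m \<Longrightarrow> f v = g v) \<Longrightarrow> meval f p = meval g p"
  unfolding meval_def by (intro sum.cong arg_cong2[where f = "(*)"] mon_eval_cong) auto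

lemma mon_eval_compose: "meval f (mon_eval g m) = mon_eval (\<lambda>v. meval f (g v)) m"
proof -
  have "meval f (\<Prod>v\<in>A. g v ^ lookup m v) = (\<Prod>v\<in>A. meval f (g v) ^ lookup m v)" for A
    by (induction A rule: infinite_finite_induct) auto
  then show ?thesis by (simp add: mon_eval_def)
qed

lemma meval_compose: "meval f (meval g p) = meval (\<lambda>v. meval f (g v)) p"
  by (induction p rule: mpoly_induct) (simp_all add: mon_eval_compose)

section \<open>The polynomials in a given set of variables\<close>

definition mpolys :: "'v set \<Rightarrow> 'v mpoly set" where
  "mpolys V = {p. keys p \<subseteq> monomials V}"

lemma mpoly_ring_simps [simp]:
  "carrier (mpoly_ring V) = mpolys V" "mult (mpoly_ring V) = (*)" "one (mpoly_ring V) = 1"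
  "zero (mpoly_ring V) = 0" "add (mpoly_ring V) = (+)"
  by (simp_all add: mpoly_ring_def mpolys_def)

lemma mpolys_mult: "p \<in> mpolys V \<Longrightarrow> q \<in> mpolys V \<Longrightarrow> p * q \<in> mpolys V"
  using cring.cring_simprules(5)[OF cring_mpoly_ring, of p V q] by simp

lemma mpolys_add: "p \<in> mpolys V \<Longrightarrow> q \<in> mpolys V \<Longrightarrow> p + q \<in> mpolys V"
  using cring.cring_simprules(1)[OF cring_mpoly_ring, of p V q] by simp

lemma mpolys_single: "m \<in> monomials V \<Longrightarrow> single m c \<in> mpolys V"
  by (auto simp: mpolys_def)

lemma mpolys_0: "0 \<in> mpolys V" and mpolys_1: "1 \<in> mpolys V"
  by (auto simp: mpolys_def monomials_def)

lemma mpolys_uminus: "p \<in> mpolys V \<Longrightarrow> - p \<in> mpolys V"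
  by (auto simp: mpolys_def)

lemma mpolys_diff: "p \<in> mpolys V \<Longrightarrow> q \<in> mpolys V \<Longrightarrow> p - q \<in> mpolys V"
  using mpolys_add[of p V "- q"] mpolys_uminus[of q V] by simp

lemma mpolys_mvar: "v \<in> V \<Longrightarrow> mvar v \<in> mpolys V"
  by (auto simp: mvar_def var_mon_def mpolys_def monomials_def)

lemma mpolys_sum: "(\<And>i. i \<in> A \<Longrightarrow> g i \<in> mpolys V) \<Longrightarrow> (\<Sum>i\<in>A. g i) \<in> mpolys V"
  by (induction A rule: infinite_finite_induct) (auto intro: mpolys_0 mpolys_add)

lemma mpolys_prod: "(\<And>i. i \<in> A \<Longrightarrow> g i \<in> mpolys V) \<Longrightarrow> (\<Prod>i\<in>A. g i) \<in> mpolys V"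
  by (induction A rule: infinite_finite_induct) (auto intro: mpolys_1 mpolys_mult)

lemma mpolys_power: "p \<in> mpolys V \<Longrightarrow> p ^ k \<in> mpolys V"
  by (induction k) (auto intro: mpolys_1 mpolys_mult)

lemma mpolys_of_int: "of_int k \<in> mpolys V"
  using mpolys_single[of 0 V k] by (simp add: monomials_def flip: single_of_int)

lemma mpolys_of_nat: "of_nat k \<in> mpolys V"
  using mpolys_of_int[of "int k"] by simp

lemmas mpolys_intros = mpolys_0 mpolys_1 mpolys_add mpolys_mult mpolys_uminus mpolys_diff
  mpolys_mvar mpolys_sum mpolys_prod mpolys_power mpolys_of_int mpolys_of_nat

lemma mpolys_meval:
  assumes "p \<in> mpolys V" "\<And>v. v \<in> V \<Longrightarrow> f v \<in> mpolys W"
  shows "meval f p \<in> mpolys W"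
proof -
  have "f v \<in> mpolys W" if "m \<in> keys p" "v \<in> keys m" for m v
  proof -
    from assms(1) that have "v \<in> V" by (auto simp: mpolys_def monomials_def)
    then show ?thesis by (rule assms(2))
  qed
  then show ?thesis
    unfolding meval_def mon_eval_def by (intro mpolys_intros)
qed

lemma mpoly_ring_minus: "p \<in> mpolys V \<Longrightarrow> q \<in> mpolys V \<Longrightarrow> p \<ominus>\<^bsub>mpoly_ring V\<^esub> q = p - q"
proof -
  interpret cring "mpoly_ring V" by (rule cring_mpoly_ring)
  assume *: "p \<in> mpolys V" "q \<in> mpolys V"
  then have "\<ominus>\<^bsub>mpoly_ring V\<^esub> q = - q"
    by (intro minus_equality) (auto intro: mpolys_uminus)
  then show ?thesis by (simp add: a_minus_def)
qed

text \<open>The ideal generated by \<open>G\<close> and all variables outside \<open>V\<close>,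
  among the polynomials over the whole type. With the foreign variables absorbed, closure under
  multiplication needs no carrier condition; for \<open>G \<subseteq> mpolys V\<close> the
  intersection with \<open>mpolys V\<close> is the ideal generated in the actual ring.\<close>

inductive_set ideal_ext :: "'v set \<Rightarrow> 'v mpoly set \<Rightarrow> 'v mpoly set" for V G where
  zero: "0 \<in> ideal_ext V G"
| gen: "g \<in> G \<Longrightarrow> g \<in> ideal_ext V G"
| out: "v \<notin> V \<Longrightarrow> mvar v \<in> ideal_ext V G"
| add: "p \<in> ideal_ext V G \<Longrightarrow> q \<in> ideal_ext V G \<Longrightarrow> p + q \<in> ideal_ext V G"
| mult: "p \<in> ideal_ext V G \<Longrightarrow> q * p \<in> ideal_ext V G"

lemma ideal_ext_mult': "p \<in> ideal_ext V G \<Longrightarrow> p * q \<in> ideal_ext V G"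
  using ideal_ext.mult[of p V G q] by (simp add: mult.commute)

lemma ideal_ext_uminus: "p \<in> ideal_ext V G \<Longrightarrow> - p \<in> ideal_ext V G"
  using ideal_ext.mult[of p V G "-1"] by simp

lemma ideal_ext_diff: "p \<in> ideal_ext V G \<Longrightarrow> q \<in> ideal_ext V G \<Longrightarrow> p - q \<in> ideal_ext V G"
  using ideal_ext.add[of p V G "- q"] ideal_ext_uminus[of q V G] by simp

lemma ideal_ext_sum: "(\<And>i. i \<in> A \<Longrightarrow> g i \<in> ideal_ext V G) \<Longrightarrow> (\<Sum>i\<in>A. g i) \<in> ideal_ext V G"
  by (induction A rule: infinite_finite_induct) (auto intro: ideal_ext.zero ideal_ext.add)

text \<open>Substituting 0 for the variables outside of the index set retracts the extended ideal
  onto the ideal of the polynomial ring.\<close>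

lemma ideal_ext_subset:
  assumes I: "ideal I (mpoly_ring V)" and G: "G \<subseteq> I"
    and p: "p \<in> ideal_ext V G" "p \<in> mpolys V"
  shows "p \<in> I"
proof -
  interpret I: ideal I "mpoly_ring V" by (rule I)
  define f where "f v = (if v \<in> V then mvar v else 0 :: 'a mpoly)" for v
  have f_out: "f v = 0" if "v \<notin> V" for v
    using that by (simp add: f_def)
  have f: "meval f q \<in> mpolys V" for q
    unfolding meval_def mon_eval_def by (intro mpolys_intros) (auto simp: f_def intro: mpolys_intros)
  have f_id: "meval f q = q" if "q \<in> mpolys V" for q
  proof -
    have "meval f q = meval mvar q"
      using that by (intro meval_cong) (auto simp: f_def mpolys_def monomials_def)
    then show ?thesis by simp
  qed
  have I0: "0 \<in> I"
    using additive_subgroup.zero_closed[OF I.additive_subgroup_axioms] by simp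
  have I_add: "x + y \<in> I" if "x \<in> I" "y \<in> I" for x y
    using additive_subgroup.a_closed[OF I.additive_subgroup_axioms that] by simp
  have I_mult: "x * y \<in> I" if "x \<in> mpolys V" "y \<in> I" for x y
    using I.I_l_closed[of y x] that by simp
  have "meval f p \<in> I"
    using p(1)
  proof induction
    case (gen g)
    with G have "g \<in> I" by auto
    moreover have "g \<in> mpolys V" using I.Icarr[OF \<open>g \<in> I\<close>] by simp
    ultimately show ?case by (simp add: f_id)
  qed (auto simp: f_out intro: I0 I_add I_mult f)
  with f_id[OF p(2)] show ?thesis by simp
qed

lemma ideal_ideal_ext: "ideal (ideal_ext V G \<inter> mpolys V) (mpoly_ring V)"
proof -
  interpret cring "mpoly_ring V" by (rule cring_mpoly_ring)
  show ?thesis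
  proof (rule idealI)
    show "subgroup (ideal_ext V G \<inter> mpolys V) (add_monoid (mpoly_ring V))"
    proof (rule group.subgroupI)
      show "Group.group (add_monoid (mpoly_ring V))" by (rule a_group)
      show "inv\<^bsub>add_monoid (mpoly_ring V)\<^esub> a \<in> ideal_ext V G \<inter> mpolys V"
        if "a \<in> ideal_ext V G \<inter> mpolys V" for a
      proof -
        from that have "\<ominus>\<^bsub>mpoly_ring V\<^esub> a = - a"
          by (intro minus_equality) (auto intro: mpolys_uminus)
        with that show ?thesis
          unfolding a_inv_def by (simp del: mpoly_ring_simps add: ideal_ext_uminus mpolys_uminus)
      qed
    qed (auto intro: ideal_ext.add mpolys_add ideal_ext.zero mpolys_0)
  qed (auto intro: ideal_ext.mult ideal_ext_mult' mpolys_mult ring_axioms)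
qed

lemma genideal_mpoly_ring:
  assumes "G \<subseteq> mpolys V"
  shows "Idl\<^bsub>mpoly_ring V\<^esub> G = ideal_ext V G \<inter> mpolys V"
proof
  interpret cring "mpoly_ring V" by (rule cring_mpoly_ring)
  show "Idl\<^bsub>mpoly_ring V\<^esub> G \<subseteq> ideal_ext V G \<inter> mpolys V"
    using assms by (intro genideal_minimal ideal_ideal_ext) (auto intro: ideal_ext.gen)
  show "ideal_ext V G \<inter> mpolys V \<subseteq> Idl\<^bsub>mpoly_ring V\<^esub> G"
    using ideal_ext_subset[OF genideal_ideal genideal_self, of G] assms by auto
qed

section \<open>Generators of the Chow ideal\<close>

lemma finite_faces [simp]: "finite (faces n)"
  by (simp add: faces_def)

definition chow_gens :: "nat \<Rightarrow> nat set mpoly set" where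
  "chow_gens n = {mvar S * mvar T | S T. S \<in> faces n \<and> T \<in> faces n \<and> \<not> S \<subseteq> T \<and> \<not> T \<subseteq> S} \<union>
     {(\<Sum>S | S \<in> faces n \<and> e \<in> S. mvar S) | e. e \<in> {1..n}}"

abbreviation chow_ext :: "nat \<Rightarrow> nat set mpoly set" where
  "chow_ext n \<equiv> ideal_ext (faces n) (chow_gens n)"

text \<open>The sum of two generated ideals is generated by the union of the generators, so one set
  of generators serves for both kinds.\<close>

lemma chow_ideal_eq: "chow_ideal n = chow_ext n \<inter> mpolys (faces n)"
proof -
  interpret cring "mpoly_ring (faces n)" by (rule cring_mpoly_ring)
  define N where "N = {mvar S * mvar T | S T. S \<in> faces n \<and> T \<in> faces n \<and> \<not> S \<subseteq> T \<and> \<not> T \<subseteq> S}"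
  define L where "L = {(\<Sum>S | S \<in> faces n \<and> e \<in> S. mvar S :: nat set mpoly) | e. e \<in> {1..n}}"
  have N: "N \<subseteq> carrier (mpoly_ring (faces n))"
    unfolding N_def by (auto intro!: mpolys_intros)
  have L: "L \<subseteq> carrier (mpoly_ring (faces n))"
    unfolding L_def by (auto intro!: mpolys_intros)
  let ?I = "\<lambda>A. Idl\<^bsub>mpoly_ring (faces n)\<^esub> A"
  have Idl_mono: "?I A \<subseteq> ?I B" if "A \<subseteq> ?I B" "B \<subseteq> carrier (mpoly_ring (faces n))" for A B
    using that by (intro genideal_minimal genideal_ideal)
  have NL: "N \<union> L \<subseteq> carrier (mpoly_ring (faces n))"
    using N L by simp
  have IN: "?I N \<subseteq> carrier (mpoly_ring (faces n))" and IL: "?I L \<subseteq> carrier (mpoly_ring (faces n))"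
    using ideal.Icarr[OF genideal_ideal[OF N]] ideal.Icarr[OF genideal_ideal[OF L]] by blast+
  then have INL: "?I N \<union> ?I L \<subseteq> carrier (mpoly_ring (faces n))"
    by simp
  have "chow_ideal n = ?I (?I N \<union> ?I L)"
    unfolding chow_ideal_def N_def[symmetric] L_def[symmetric]
    by (intro union_genideal[symmetric] genideal_ideal N L)
  also have "\<dots> = ?I (N \<union> L)"
  proof (rule subset_antisym)
    have "N \<subseteq> ?I (N \<union> L)" "L \<subseteq> ?I (N \<union> L)"
      using genideal_self[OF NL] by auto
    then show "?I (?I N \<union> ?I L) \<subseteq> ?I (N \<union> L)"
      using Idl_mono[OF _ NL] by simp
    have "N \<subseteq> ?I (?I N \<union> ?I L)" "L \<subseteq> ?I (?I N \<union> ?I L)"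
      using genideal_self[OF INL] genideal_self[OF N] genideal_self[OF L] by auto
    then show "?I (N \<union> L) \<subseteq> ?I (?I N \<union> ?I L)"
      using Idl_mono[OF _ INL] by simp
  qed
  also have "\<dots> = chow_ext n \<inter> mpolys (faces n)"
    using genideal_mpoly_ring[of "N \<union> L" "faces n"] N L
    by (simp add: chow_gens_def N_def L_def)
  finally show ?thesis .
qed

section \<open>Relations in the Chow ring\<close>

definition upper_sum :: "nat \<Rightarrow> nat set \<Rightarrow> nat set mpoly" where
  "upper_sum n G = (\<Sum>S | S \<in> faces n \<and> G \<subseteq> S. mvar S)"

text \<open>The empty set stands for 1, as \<open>Z_0\<close> does in the relations, so that one
  power relation also covers chains that start at the empty set.\<close>

definition set_var :: "'v set \<Rightarrow> 'v set mpoly" where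
  "set_var F = (if F = {} then 1 else mvar F)"

lemma incomparable_in_chow:
  "S \<in> faces n \<Longrightarrow> T \<in> faces n \<Longrightarrow> \<not> S \<subseteq> T \<Longrightarrow> \<not> T \<subseteq> S \<Longrightarrow> mvar S * mvar T \<in> chow_ext n"
  by (rule ideal_ext.gen) (auto simp: chow_gens_def)

lemma upper_sum_singleton_in_chow: "e \<in> {1..n} \<Longrightarrow> upper_sum n {e} \<in> chow_ext n"
  by (rule ideal_ext.gen) (auto simp: chow_gens_def upper_sum_def)

lemma upper_sum_diff:
  "upper_sum n G - (\<Sum>S | S \<in> faces n \<and> G \<subseteq> S \<and> P S. mvar S)
     = (\<Sum>S | S \<in> faces n \<and> G \<subseteq> S \<and> \<not> P S. mvar S)"
proof -
  have "upper_sum n G = (\<Sum>S\<in>{S. S \<in> faces n \<and> G \<subseteq> S \<and> P S} \<union> {S. S \<in> faces n \<and> G \<subseteq> S \<and> \<not> P S}. mvar S)"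
    unfolding upper_sum_def by (rule sum.cong) auto
  also have "\<dots> = (\<Sum>S | S \<in> faces n \<and> G \<subseteq> S \<and> P S. mvar S) + (\<Sum>S | S \<in> faces n \<and> G \<subseteq> S \<and> \<not> P S. mvar S)"
    by (rule sum.union_disjoint) auto
  finally show ?thesis by simp
qed

lemma upper_sum_diff_upper_sum:
  assumes "G \<subseteq> H"
  shows "upper_sum n G - upper_sum n H = (\<Sum>S | S \<in> faces n \<and> G \<subseteq> S \<and> \<not> H \<subseteq> S. mvar S)"
proof -
  have "upper_sum n H = (\<Sum>S | S \<in> faces n \<and> G \<subseteq> S \<and> H \<subseteq> S. mvar S)"
    unfolding upper_sum_def using assms by (intro sum.cong) auto
  then show ?thesis by (simp add: upper_sum_diff)
qed

text \<open>For nonempty \<open>F\<close>, a set that contains \<open>e\<close> but not all of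
  \<open>insert e F\<close> is incomparable with \<open>F\<close>. Next to the variable of
  \<open>F\<close> the sum over the sets above \<open>insert e F\<close> therefore agrees with the
  linear generator of \<open>e\<close>.\<close>

lemma set_var_mult_upper_sum_insert:
  assumes "F \<subseteq> {1..n}" "e \<in> {1..n}" "e \<notin> F"
  shows "set_var F * upper_sum n (insert e F) \<in> chow_ext n"
proof (cases "F = {}")
  case True
  then show ?thesis
    using assms by (simp add: set_var_def upper_sum_singleton_in_chow)
next
  case False
  have "mvar F * (upper_sum n {e} - upper_sum n (insert e F)) \<in> chow_ext n"
  proof -
    have "upper_sum n {e} - upper_sum n (insert e F) = (\<Sum>S | S \<in> faces n \<and> {e} \<subseteq> S \<and> \<not> insert e F \<subseteq> S. mvar S)"
      by (rule upper_sum_diff_upper_sum) simp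
    moreover have "mvar F * mvar S \<in> chow_ext n" if "S \<in> faces n" "{e} \<subseteq> S" "\<not> insert e F \<subseteq> S" for S
      using that assms False by (intro incomparable_in_chow) (auto simp: faces_def)
    ultimately show ?thesis
      by (auto simp: sum_distrib_left intro: ideal_ext_sum)
  qed
  moreover have "mvar F * upper_sum n {e} \<in> chow_ext n"
    using assms by (intro ideal_ext.mult upper_sum_singleton_in_chow) auto
  ultimately have "mvar F * upper_sum n {e} - mvar F * (upper_sum n {e} - upper_sum n (insert e F)) \<in> chow_ext n"
    by (rule ideal_ext_diff[rotated])
  then show ?thesis
    using False by (simp add: set_var_def algebra_simps)
qed

text \<open>Every set in the first factor contains \<open>G\<close> and misses \<open>e\<close>;
  every set in the second contains \<open>e\<close> and misses a point of \<open>G\<close>.\<close>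

lemma upper_sum_diff_mult:
  assumes "F \<subseteq> G" "e \<notin> G"
  shows "(upper_sum n G - upper_sum n (insert e G)) * (upper_sum n (insert e F) - upper_sum n (insert e G))
    \<in> chow_ext n"
proof -
  have "insert e F \<subseteq> insert e G" using assms by auto
  then show ?thesis
    unfolding upper_sum_diff_upper_sum[OF subset_insertI] upper_sum_diff_upper_sum[OF \<open>insert e F \<subseteq> insert e G\<close>]
      sum_product
    by (intro ideal_ext_sum incomparable_in_chow) auto
qed

lemma set_var_mult_upper_sum_power:
  assumes "F \<subset> G" "G \<subseteq> {1..n}"
  shows "set_var F * upper_sum n G ^ (card G - card F) \<in> chow_ext n"
  using assms
proof (induction "card G - card F" arbitrary: G)
  case 0
  have "finite G" using 0(3) by (rule finite_subset) simp
  with 0 psubset_card_mono[of G F] show ?case by simp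
next
  case (Suc k)
  have fin: "finite G" "finite F"
    using Suc.prems finite_subset[of _ "{1..n}"] by auto
  from Suc.prems obtain e where e: "e \<in> G" "e \<notin> F" by auto
  define H where "H = G - {e}"
  have G: "G = insert e H" "e \<notin> H" "F \<subseteq> H" "finite H"
    using e Suc.prems fin by (auto simp: H_def)
  let ?x = "set_var F" and ?h = "upper_sum n"
  have lin: "?x * ?h (insert e F) \<in> chow_ext n"
    using e Suc.prems by (intro set_var_mult_upper_sum_insert) auto
  show ?case
  proof (cases "F = H")
    case True
    then show ?thesis using lin G fin by simp
  next
    case False
    have card: "card G = Suc (card H)" using G by simp
    have "?x * ?h H ^ (card H - card F) \<in> chow_ext n"
      using False Suc.hyps(2) G Suc.prems card by (intro Suc.hyps(1)) auto
    moreover have "card H - card F = k"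
      using Suc.hyps(2) card by simp
    ultimately have IH: "?x * ?h H ^ k \<in> chow_ext n" by simp
    \<comment> \<open>When the product of \<open>upper_sum_diff_mult\<close> is multiplied out, the
      terms with \<open>?h (insert e F)\<close> vanish by \<open>lin\<close>. What is left says that
      next to \<open>?x\<close> one factor of \<open>?h G ^ 2\<close> may be exchanged for
      \<open>?h H\<close>.\<close>
    have step: "?x * ?h G ^ 2 - ?x * ?h G * ?h H \<in> chow_ext n"
    proof -
      have "?x * ((?h H - ?h G) * (?h (insert e F) - ?h G)) - ?x * ?h (insert e F) * (?h H - ?h G) \<in> chow_ext n"
        unfolding G(1)
        by (rule ideal_ext_diff[OF ideal_ext.mult[OF upper_sum_diff_mult[OF G(3,2)]] ideal_ext_mult'[OF lin]])
      then show ?thesis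
        by (simp add: algebra_simps power2_eq_square)
    qed
    \<comment> \<open>Exchanging factor after factor keeps one copy of \<open>?h G\<close>; for
      \<open>j = k\<close> the others become \<open>?h H ^ k\<close>, which \<open>IH\<close>
      kills.\<close>
    have "?x * ?h G ^ Suc j - ?x * ?h G * ?h H ^ j \<in> chow_ext n" for j
    proof (induction j)
      case 0
      then show ?case by (simp add: ideal_ext.zero)
    next
      case (Suc j)
      have "?h G * (?x * ?h G ^ Suc j - ?x * ?h G * ?h H ^ j)
          + ?h H ^ j * (?x * ?h G ^ 2 - ?x * ?h G * ?h H) \<in> chow_ext n"
        by (rule ideal_ext.add[OF ideal_ext.mult[OF Suc] ideal_ext.mult[OF step]])
      then show ?case
        by (simp add: algebra_simps power2_eq_square)
    qed
    then have "(?x * ?h G ^ Suc k - ?x * ?h G * ?h H ^ k) + ?h G * (?x * ?h H ^ k) \<in> chow_ext n"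
      by (rule ideal_ext.add[OF _ ideal_ext.mult[OF IH]])
    then show ?thesis
      using Suc.hyps(2) by (simp add: algebra_simps)
  qed
qed

text \<open>Modulo the products of incomparable variables, \<open>min_part n k S\<close> is the part of a \<open>k\<close>-th power of a
  sum of variables that consists of the monomials with smallest set \<open>S\<close>.\<close>

definition min_part :: "nat \<Rightarrow> nat \<Rightarrow> nat set \<Rightarrow> nat set mpoly" where
  "min_part n k S = upper_sum n S ^ k - (upper_sum n S - mvar S) ^ k"

lemma diff_dvd_power_diff: "(x - y) dvd (x ^ k - y ^ k :: 'r::comm_ring_1)"
  by (metis dvd_triv_left power_diff_sumr2)

lemma mvar_dvd_min_part: "mvar S dvd min_part n k S"
  using diff_dvd_power_diff[of "upper_sum n S" "upper_sum n S - mvar S" k] by (simp add: min_part_def)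

lemma mult_min_part_in_chow:
  assumes "F \<in> faces n" "S \<in> faces n" "\<not> F \<subseteq> S" "\<not> S \<subseteq> F"
  shows "mvar F * min_part n k S \<in> chow_ext n"
proof -
  obtain q where "min_part n k S = mvar S * q"
    using mvar_dvd_min_part by (rule dvdE)
  then show ?thesis
    using ideal_ext_mult'[OF incomparable_in_chow[OF assms], of q] by (simp add: mult.assoc)
qed

text \<open>Inclusion-exclusion: since \<open>x * w\<close> vanishes, no surviving monomial of the
  expansion contains both \<open>x\<close> and \<open>w\<close>. Those without \<open>x\<close> form
  \<open>(y + w) ^ k\<close>, those without \<open>w\<close> form \<open>(x + y) ^ k\<close>, and
  \<open>y ^ k\<close> is counted twice.\<close>

lemma ideal_ext_power_diff:
  assumes "x * w \<in> ideal_ext V G"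
  shows "(x + y + w) ^ k - (y + w) ^ k - (x + y) ^ k + y ^ k \<in> ideal_ext V G"
proof (induction k)
  case 0
  then show ?case by (simp add: ideal_ext.zero)
next
  case (Suc k)
  obtain q where q: "(y + w) ^ k - y ^ k = w * q"
    using diff_dvd_power_diff[of "y + w" y k] by (auto elim: dvdE)
  obtain q' where q': "(x + y) ^ k - y ^ k = x * q'"
    using diff_dvd_power_diff[of "x + y" y k] by (auto elim: dvdE)
  have "(x + y + w) * ((x + y + w) ^ k - (y + w) ^ k - (x + y) ^ k + y ^ k) + x * w * (q + q') \<in> ideal_ext V G"
    by (rule ideal_ext.add[OF ideal_ext.mult[OF Suc] ideal_ext_mult'[OF assms]])
  also have "x * w * (q + q') = x * ((y + w) ^ k - y ^ k) + w * ((x + y) ^ k - y ^ k)"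
    unfolding q q' by (simp add: algebra_simps)
  finally show ?case
    by (simp add: algebra_simps)
qed

text \<open>Peel off a minimal member \<open>S\<close>. By minimality every other member is above
  \<open>S\<close> or incomparable with it, and the latter are killed by the variable of
  \<open>S\<close>. So the power splits into the monomials with smallest set \<open>S\<close> and
  the power over the remaining family, which is again upward closed. The empty family is where
  \<open>k > 0\<close> enters.\<close>

lemma power_sum_min_part:
  assumes "A \<subseteq> faces n" "\<And>S T. S \<in> A \<Longrightarrow> T \<in> faces n \<Longrightarrow> S \<subseteq> T \<Longrightarrow> T \<in> A" "k > 0"
  shows "(\<Sum>S\<in>A. mvar S) ^ k - (\<Sum>S\<in>A. min_part n k S) \<in> chow_ext n"
proof -
  have "finite A" using assms(1) finite_faces by (rule finite_subset)
  then show ?thesis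
    using assms(1,2)
  proof (induction A rule: finite_psubset_induct)
    case (psubset A)
    show ?case
    proof (cases "A = {}")
      case True
      then show ?thesis using assms(3) by (simp add: zero_power ideal_ext.zero)
    next
      case False
      with psubset.hyps obtain S where S: "S \<in> A" "\<And>T. T \<in> A \<Longrightarrow> T \<subseteq> S \<Longrightarrow> S = T"
        using finite_has_minimal[of A] by blast
      define B where "B = A - {S}"
      have B: "A = insert S B" "S \<notin> B" "finite B"
        using S psubset.hyps by (auto simp: B_def)
      have IH: "(\<Sum>S\<in>B. mvar S) ^ k - (\<Sum>S\<in>B. min_part n k S) \<in> chow_ext n"
        using psubset.prems S by (intro psubset.IH) (auto simp: B_def)
      define y where "y = upper_sum n S - mvar S"
      define w where "w = (\<Sum>T | T \<in> B \<and> \<not> S \<subseteq> T. mvar T)"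
      have "y = (\<Sum>T | T \<in> B \<and> S \<subseteq> T. mvar T)"
      proof -
        have "{T \<in> faces n. S \<subseteq> T} = insert S {T. T \<in> B \<and> S \<subseteq> T}"
          using psubset.prems B S by auto
        then show ?thesis
          using B by (simp add: y_def upper_sum_def)
      qed
      moreover have "(\<Sum>T\<in>B. mvar T) = (\<Sum>T\<in>{T. T \<in> B \<and> S \<subseteq> T} \<union> {T. T \<in> B \<and> \<not> S \<subseteq> T}. mvar T)"
        by (rule sum.cong) auto
      moreover have "\<dots> = (\<Sum>T | T \<in> B \<and> S \<subseteq> T. mvar T) + (\<Sum>T | T \<in> B \<and> \<not> S \<subseteq> T. mvar T)"
        using B by (intro sum.union_disjoint) auto
      ultimately have sumB: "(\<Sum>T\<in>B. mvar T) = y + w"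
        by (simp add: w_def)
      have "mvar S * w \<in> chow_ext n"
        unfolding w_def sum_distrib_left
        using psubset.prems S B by (intro ideal_ext_sum incomparable_in_chow) auto
      from ideal_ext_power_diff[OF this, of y k]
      have "(mvar S + (y + w)) ^ k - (y + w) ^ k - min_part n k S \<in> chow_ext n"
        by (simp add: min_part_def y_def algebra_simps)
      with IH have "((\<Sum>S\<in>B. mvar S) ^ k - (\<Sum>S\<in>B. min_part n k S)) +
          ((mvar S + (y + w)) ^ k - (y + w) ^ k - min_part n k S) \<in> chow_ext n"
        by (rule ideal_ext.add)
      then show ?thesis
        using B by (simp add: sumB algebra_simps)
    qed
  qed
qed

text \<open>A shifted hockey-stick identity, and the origin of the binomial coefficients in the
  relations: a set of size \<open>s\<close> occurs only in the sums with \<open>i \<le> s\<close>,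
  and the weights of these must add up to the number of \<open>b\<close>-sets between a given
  \<open>a\<close>-set and it.\<close>

lemma sum_choose_shifted:
  assumes "a < b" "b \<le> s"
  shows "(\<Sum>i = b..s. (i - a - 1) choose (b - a - 1)) = (s - a) choose (b - a)"
  using assms(2)
proof (induction rule: dec_induct)
  case base
  then show ?case by simp
next
  case (step m)
  obtain c where "b - a = Suc c" using assms by (metis Suc_diff_Suc)
  moreover have "Suc m - a = Suc (m - a)" using step assms by simp
  ultimately show ?case
    using step by simp
qed

lemma card_between:
  assumes "finite S" "F \<subseteq> S" "card F \<le> b"
  shows "card {G. F \<subseteq> G \<and> G \<subseteq> S \<and> card G = b} = (card S - card F) choose (b - card F)"
proof -
  have fin: "finite F" using assms finite_subset by auto
  have "bij_betw (\<lambda>B. F \<union> B) {B. B \<subseteq> S - F \<and> card B = b - card F} {G. F \<subseteq> G \<and> G \<subseteq> S \<and> card G = b}"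
  proof (rule bij_betw_byWitness[where f' = "\<lambda>G. G - F"])
    show "(\<lambda>B. F \<union> B) ` {B. B \<subseteq> S - F \<and> card B = b - card F} \<subseteq> {G. F \<subseteq> G \<and> G \<subseteq> S \<and> card G = b}"
    proof safe
      fix B assume "B \<subseteq> S - F" "card B = b - card F"
      then show "card (F \<union> B) = b"
        using assms fin by (subst card_Un_disjoint) (auto intro: finite_subset)
    qed (use assms in auto)
    show "(\<lambda>G. G - F) ` {G. F \<subseteq> G \<and> G \<subseteq> S \<and> card G = b} \<subseteq> {B. B \<subseteq> S - F \<and> card B = b - card F}"
      using fin by (auto simp: card_Diff_subset)
  qed auto
  then have "card {G. F \<subseteq> G \<and> G \<subseteq> S \<and> card G = b} = card {B. B \<subseteq> S - F \<and> card B = b - card F}"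
    by (rule bij_betw_same_card[symmetric])
  also have "\<dots> = card (S - F) choose (b - card F)"
    using assms by (intro n_subsets) auto
  also have "card (S - F) = card S - card F"
    using assms fin by (simp add: card_Diff_subset)
  finally show ?thesis .
qed

definition level_sum :: "nat \<Rightarrow> nat \<Rightarrow> nat set mpoly" where
  "level_sum n l = (\<Sum>S | S \<in> faces n \<and> card S = l. mvar S)"

lemma card_le_of_face: "S \<in> faces n \<Longrightarrow> card S \<le> n"
  using card_mono[of "{1..n}" S] by (auto simp: faces_def)

lemma sum_level_sum: "(\<Sum>k = i..n. level_sum n k) = (\<Sum>S | S \<in> faces n \<and> i \<le> card S. mvar S)"
proof -
  have "(\<Sum>k = i..n. level_sum n k) =
      (\<Sum>k = i..n. \<Sum>S | S \<in> {S. S \<in> faces n \<and> i \<le> card S} \<and> card S = k. mvar S)"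
    unfolding level_sum_def by (intro sum.cong) auto
  also have "\<dots> = (\<Sum>S | S \<in> faces n \<and> i \<le> card S. mvar S)"
    by (rule sum.group) (auto intro: card_le_of_face)
  finally show ?thesis .
qed

text \<open>The weighted powers of level sums and the powers of \<open>upper_sum n G\<close>, for
  the \<open>b\<close>-sets \<open>G\<close> above \<open>F\<close>, are both expanded by smallest
  set. Next to the variable of \<open>F\<close> the two expansions agree, and each
  \<open>upper_sum n G ^ (b - a)\<close> is killed by it.\<close>

lemma set_var_mult_relation:
  assumes ab: "a < b" "b \<le> n" and F: "F \<subseteq> {1..n}" "card F = a"
  shows "set_var F * (\<Sum>i = b..n. of_nat ((i - a - 1) choose (b - a - 1)) *
    (\<Sum>k = i..n. level_sum n k) ^ (b - a)) \<in> chow_ext n"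
proof -
  define c where "c i = (of_nat ((i - a - 1) choose (b - a - 1)) :: nat set mpoly)" for i
  define N where "N S = (of_nat ((card S - a) choose (b - a)) :: nat set mpoly)" for S :: "nat set"
  define D where "D = min_part n (b - a)"
  define L where "L = {S. S \<in> faces n \<and> b \<le> card S}"
  define Gs where "Gs = {G. F \<subseteq> G \<and> G \<subseteq> {1..n} \<and> card G = b}"
  let ?x = "set_var F"
  have pos: "b - a > 0" using ab by simp
  have finF: "finite F" using F finite_subset by auto
  have 1: "(\<Sum>i = b..n. c i * (\<Sum>k = i..n. level_sum n k) ^ (b - a)) - (\<Sum>S\<in>L. N S * D S) \<in> chow_ext n"
  proof -
    have "(\<Sum>i = b..n. c i * (\<Sum>S | S \<in> faces n \<and> i \<le> card S. D S)) =
        (\<Sum>i = b..n. \<Sum>S | S \<in> L \<and> i \<le> card S. c i * D S)"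
      unfolding sum_distrib_left L_def by (intro sum.cong) auto
    \<comment> \<open>Exchanging the sums collects, for each smallest set \<open>S\<close>, the
      weights with \<open>i \<le> card S\<close>; their total is \<open>N S\<close>.\<close>
    also have "\<dots> = (\<Sum>S\<in>L. \<Sum>i | i \<in> {b..n} \<and> i \<le> card S. c i * D S)"
      by (rule sum.swap_restrict) (auto simp: L_def)
    also have "\<dots> = (\<Sum>S\<in>L. N S * D S)"
    proof (rule sum.cong)
      fix S assume S: "S \<in> L"
      then have "{i. i \<in> {b..n} \<and> i \<le> card S} = {b..card S}"
        using card_le_of_face by (force simp: L_def)
      then have "(\<Sum>i | i \<in> {b..n} \<and> i \<le> card S. c i * D S) = (\<Sum>i = b..card S. c i) * D S"
        by (simp add: sum_distrib_right)
      also have "(\<Sum>i = b..card S. c i) = N S"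
        unfolding c_def N_def of_nat_sum[symmetric] using S ab
        by (subst sum_choose_shifted) (auto simp: L_def)
      finally show "(\<Sum>i | i \<in> {b..n} \<and> i \<le> card S. c i * D S) = N S * D S" .
    qed simp
    finally have *: "(\<Sum>S\<in>L. N S * D S) = (\<Sum>i = b..n. c i * (\<Sum>S | S \<in> faces n \<and> i \<le> card S. D S))"
      by simp
    have "(\<Sum>i = b..n. c i * ((\<Sum>k = i..n. level_sum n k) ^ (b - a) - (\<Sum>S | S \<in> faces n \<and> i \<le> card S. D S)))
        \<in> chow_ext n"
      unfolding sum_level_sum D_def
    proof (intro ideal_ext_sum ideal_ext.mult power_sum_min_part pos)
      fix i S T assume "S \<in> {S \<in> faces n. i \<le> card S}" "T \<in> faces n" "S \<subseteq> T"
      moreover from this have "card S \<le> card T"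
        by (intro card_mono) (auto simp: faces_def intro: finite_subset)
      ultimately show "T \<in> {S \<in> faces n. i \<le> card S}" by auto
    qed auto
    then show ?thesis
      by (simp add: * right_diff_distrib sum_subtractf)
  qed
  \<comment> \<open>A set in \<open>L\<close> has at least \<open>b > a\<close> elements, so it is
    not inside \<open>F\<close>; if it does not contain \<open>F\<close> either, its part is killed
    by the variable of \<open>F\<close>.\<close>
  have 2: "?x * (\<Sum>S\<in>L. N S * D S) - ?x * (\<Sum>S | S \<in> L \<and> F \<subseteq> S. N S * D S) \<in> chow_ext n"
  proof -
    have "finite L" by (simp add: L_def)
    then have "(\<Sum>S\<in>L. N S * D S) - (\<Sum>S | S \<in> L \<and> F \<subseteq> S. N S * D S) = (\<Sum>S\<in>L - {S. S \<in> L \<and> F \<subseteq> S}. N S * D S)"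
      by (intro sum_diff[symmetric]) auto
    moreover have "?x * (\<Sum>S\<in>L - {S. S \<in> L \<and> F \<subseteq> S}. N S * D S) \<in> chow_ext n"
      unfolding sum_distrib_left
    proof (intro ideal_ext_sum)
      fix S assume S: "S \<in> L - {S. S \<in> L \<and> F \<subseteq> S}"
      then have "\<not> S \<subseteq> F"
        using card_mono[OF finF, of S] ab F by (auto simp: L_def)
      moreover have "F \<in> faces n" "S \<in> faces n" "\<not> F \<subseteq> S"
        using S F by (auto simp: L_def faces_def)
      ultimately have "mvar F * D S \<in> chow_ext n"
        unfolding D_def by (intro mult_min_part_in_chow)
      then have "N S * (mvar F * D S) \<in> chow_ext n"
        by (rule ideal_ext.mult)
      then show "?x * (N S * D S) \<in> chow_ext n"
        using \<open>F \<in> faces n\<close> by (simp add: set_var_def faces_def mult_ac)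
    qed
    ultimately show ?thesis
      by (simp add: right_diff_distrib[symmetric])
  qed
  \<comment> \<open>Here \<open>S\<close> is counted once for each \<open>b\<close>-set between
    \<open>F\<close> and \<open>S\<close>, which is again \<open>N S\<close> times.\<close>
  have 3: "(\<Sum>G\<in>Gs. upper_sum n G ^ (b - a)) - (\<Sum>S | S \<in> L \<and> F \<subseteq> S. N S * D S) \<in> chow_ext n"
  proof -
    have finGs: "finite Gs" by (simp add: Gs_def)
    have "(\<Sum>G\<in>Gs. \<Sum>S | S \<in> faces n \<and> G \<subseteq> S. D S) =
        (\<Sum>G\<in>Gs. \<Sum>S | S \<in> {S. S \<in> L \<and> F \<subseteq> S} \<and> G \<subseteq> S. D S)"
    proof (intro sum.cong refl Collect_cong)
      fix G S assume G: "G \<in> Gs"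
      have "b \<le> card S" if "S \<in> faces n" "G \<subseteq> S"
        using that G card_mono[of S G] finite_subset[of S "{1..n}"] by (auto simp: Gs_def faces_def)
      then show "(S \<in> faces n \<and> G \<subseteq> S) = (S \<in> {S \<in> L. F \<subseteq> S} \<and> G \<subseteq> S)"
        using G by (auto simp: L_def Gs_def)
    qed
    also have "\<dots> = (\<Sum>S | S \<in> L \<and> F \<subseteq> S. \<Sum>G | G \<in> Gs \<and> G \<subseteq> S. D S)"
      by (rule sum.swap_restrict) (auto simp: L_def finGs)
    also have "\<dots> = (\<Sum>S | S \<in> L \<and> F \<subseteq> S. N S * D S)"
    proof (rule sum.cong)
      fix S assume S: "S \<in> {S. S \<in> L \<and> F \<subseteq> S}"
      have "{G. G \<in> Gs \<and> G \<subseteq> S} = {G. F \<subseteq> G \<and> G \<subseteq> S \<and> card G = b}"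
        using S by (auto simp: Gs_def L_def faces_def)
      moreover have "card \<dots> = (card S - card F) choose (b - card F)"
        using S F ab by (intro card_between) (auto simp: L_def faces_def intro: finite_subset)
      ultimately show "(\<Sum>G | G \<in> Gs \<and> G \<subseteq> S. D S) = N S * D S"
        by (simp add: N_def F)
    qed simp
    finally have *: "(\<Sum>S | S \<in> L \<and> F \<subseteq> S. N S * D S) = (\<Sum>G\<in>Gs. \<Sum>S | S \<in> faces n \<and> G \<subseteq> S. D S)"
      by simp
    have "(\<Sum>G\<in>Gs. upper_sum n G ^ (b - a) - (\<Sum>S | S \<in> faces n \<and> G \<subseteq> S. D S)) \<in> chow_ext n"
      unfolding upper_sum_def D_def
      by (intro ideal_ext_sum power_sum_min_part pos) auto
    then show ?thesis by (simp add: * sum_subtractf)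
  qed
  have 4: "?x * (\<Sum>G\<in>Gs. upper_sum n G ^ (b - a)) \<in> chow_ext n"
    unfolding sum_distrib_left
  proof (intro ideal_ext_sum)
    fix G assume G: "G \<in> Gs"
    then have "F \<subset> G" using ab F by (auto simp: Gs_def)
    with set_var_mult_upper_sum_power[OF this, of n] G F
    show "?x * upper_sum n G ^ (b - a) \<in> chow_ext n" by (simp add: Gs_def)
  qed
  have "?x * ((\<Sum>i = b..n. c i * (\<Sum>k = i..n. level_sum n k) ^ (b - a)) - (\<Sum>S\<in>L. N S * D S))
     + (?x * (\<Sum>S\<in>L. N S * D S) - ?x * (\<Sum>S | S \<in> L \<and> F \<subseteq> S. N S * D S))
     - ?x * ((\<Sum>G\<in>Gs. upper_sum n G ^ (b - a)) - (\<Sum>S | S \<in> L \<and> F \<subseteq> S. N S * D S))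
     + ?x * (\<Sum>G\<in>Gs. upper_sum n G ^ (b - a)) \<in> chow_ext n"
    by (rule ideal_ext.add[OF ideal_ext_diff[OF ideal_ext.add[OF ideal_ext.mult[OF 1] 2]
            ideal_ext.mult[OF 3]] 4])
  then show ?thesis
    by (simp add: algebra_simps c_def)
qed

lemma meval_rel_poly_in_chow:
  assumes "a < b" "b \<le> n"
  shows "meval (level_sum n) (rel_poly n a b) \<in> chow_ext n"
proof (cases "a = 0")
  case True
  then show ?thesis
    using set_var_mult_relation[of 0 b n "{}"] assms by (simp add: rel_poly_def set_var_def)
next
  case False
  have "level_sum n a * X \<in> chow_ext n"
    if "\<And>F. F \<subseteq> {1..n} \<Longrightarrow> card F = a \<Longrightarrow> set_var F * X \<in> chow_ext n" for X
    unfolding level_sum_def sum_distrib_right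
  proof (intro ideal_ext_sum)
    fix F assume "F \<in> {S \<in> faces n. card S = a}"
    then show "mvar F * X \<in> chow_ext n"
      using that[of F] by (simp add: faces_def set_var_def)
  qed
  then show ?thesis
    using set_var_mult_relation[OF assms] False by (simp add: rel_poly_def)
qed

section \<open>Reduction to standard monomials\<close>

definition mon_weight :: "('v \<Rightarrow> nat) \<Rightarrow> 'v mon \<Rightarrow> nat" where
  "mon_weight g m = (\<Sum>v\<in>keys m. lookup m v * g v)"

lemma mon_weight_superset:
  "finite A \<Longrightarrow> keys m \<subseteq> A \<Longrightarrow> mon_weight g m = (\<Sum>v\<in>A. lookup m v * g v)"
  unfolding mon_weight_def by (rule sum.mono_neutral_left) (auto simp: in_keys_iff)

lemma mon_weight_0 [simp]: "mon_weight g 0 = 0"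
  by (simp add: mon_weight_def)

lemma mon_weight_single [simp]: "mon_weight g (single v k) = k * g v"
  by (cases "k = 0") (simp_all add: mon_weight_def)

lemma mon_weight_add [simp]: "mon_weight g (a + b) = mon_weight g a + mon_weight g b"
proof -
  have "mon_weight g m = (\<Sum>v\<in>keys a \<union> keys b. lookup m v * g v)" if "m \<in> {a, b, a + b}" for m
    using that by (intro mon_weight_superset) (auto simp: keys_add_nat)
  then show ?thesis
    by (simp add: distrib_right sum.distrib)
qed

lemma keys_of_int_mult: "keys (of_int c * (p :: 'v mpoly)) \<subseteq> keys p"
proof -
  have "keys (single 0 c * p) \<subseteq> {a + b | a b. a \<in> keys (single (0 :: 'v mon) c) \<and> b \<in> keys p}"
    by (rule keys_mult)
  also have "\<dots> \<subseteq> keys p" by (auto split: if_splits)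
  finally show ?thesis by (simp flip: single_of_int)
qed

lemma single_eq_of_int_mult: "single m c = of_int c * single m (1 :: int)"
  by (simp add: mult_single flip: single_of_int)

lemma reduce_sum:
  assumes "\<And>k. k \<in> keys p \<Longrightarrow> \<exists>q. keys q \<subseteq> X k \<and> single k 1 - q \<in> ideal_ext V G"
  shows "\<exists>q. keys q \<subseteq> (\<Union>k\<in>keys p. X k) \<and> p - q \<in> ideal_ext V G"
proof -
  from assms obtain q where q: "\<And>k. k \<in> keys p \<Longrightarrow> keys (q k) \<subseteq> X k"
    "\<And>k. k \<in> keys p \<Longrightarrow> single k 1 - q k \<in> ideal_ext V G" by metis
  define r where "r = (\<Sum>k\<in>keys p. of_int (lookup p k) * q k)"
  have "keys r \<subseteq> (\<Union>k\<in>keys p. keys (of_int (lookup p k) * q k))"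
    unfolding r_def by (rule keys_sum)
  also have "\<dots> \<subseteq> (\<Union>k\<in>keys p. X k)"
    using keys_of_int_mult q(1) by blast
  finally have "keys r \<subseteq> (\<Union>k\<in>keys p. X k)" .
  moreover have "p - r \<in> ideal_ext V G"
  proof -
    have "(\<Sum>k\<in>keys p. of_int (lookup p k) * (single k 1 - q k)) \<in> ideal_ext V G"
      by (intro ideal_ext_sum ideal_ext.mult q)
    also have "(\<Sum>k\<in>keys p. of_int (lookup p k) * (single k 1 - q k)) =
        (\<Sum>k\<in>keys p. single k (lookup p k)) - r"
      by (simp add: r_def right_diff_distrib sum_subtractf single_eq_of_int_mult[of _ "lookup p _"])
    finally show ?thesis by (simp add: sum_singles)
  qed
  ultimately show ?thesis by blast
qed

text \<open>Well-founded rewriting. The record that all monomials of the result are \<open>m\<close>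
  itself or below it is what later prevents the reduction of smaller terms from cancelling a leading
  monomial.\<close>

lemma reduce_wf:
  assumes wf: "wf R" and trans: "trans R"
    and step: "\<And>m. \<not> std m \<Longrightarrow> \<exists>q. keys q \<subseteq> {k. (k, m) \<in> R} \<and> single m 1 - q \<in> ideal_ext V G"
  shows "\<exists>q. keys q \<subseteq> {k. std k \<and> (k = m \<or> (k, m) \<in> R)} \<and> single m 1 - q \<in> ideal_ext V G"
  using wf
proof (induction m rule: wf_induct_rule)
  case (less m)
  show ?case
  proof (cases "std m")
    case True
    then show ?thesis by (intro exI[of _ "single m 1"]) (simp add: ideal_ext.zero)
  next
    case False
    with step obtain q where q: "keys q \<subseteq> {k. (k, m) \<in> R}" "single m 1 - q \<in> ideal_ext V G"
      by blast
    then obtain r where r: "keys r \<subseteq> (\<Union>k\<in>keys q. {l. std l \<and> (l = k \<or> (l, k) \<in> R)})"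
      "q - r \<in> ideal_ext V G"
      using reduce_sum[of q "\<lambda>k. {l. std l \<and> (l = k \<or> (l, k) \<in> R)}" V G] less by blast
    have "keys r \<subseteq> {k. std k \<and> (k = m \<or> (k, m) \<in> R)}"
      using r(1) q(1) trans by (blast dest: transD)
    moreover have "single m 1 - r \<in> ideal_ext V G"
      using ideal_ext.add[OF q(2) r(2)] by simp
    ultimately show ?thesis by blast
  qed
qed

text \<open>A strict order compatible with products, with totality and well-foundedness left open,
  so that it covers the comparison of weights as well as the strict part of a monomial
  order.\<close>

locale mon_rel =
  fixes V :: "'v set" and R :: "'v mon rel"
  assumes dom: "(a, b) \<in> R \<Longrightarrow> a \<in> monomials V \<and> b \<in> monomials V"
    and trans_rel: "(a, b) \<in> R \<Longrightarrow> (b, c) \<in> R \<Longrightarrow> (a, c) \<in> R"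
    and add_rel: "(a, b) \<in> R \<Longrightarrow> c \<in> monomials V \<Longrightarrow> (a + c, b + c) \<in> R"
begin

definition lower :: "'v mon \<Rightarrow> 'v mon set" where "lower m = {k. (k, m) \<in> R}"

lemma lower_add:
  assumes "a \<in> lower m" "b \<in> insert m' (lower m')" "m' \<in> monomials V"
  shows "a + b \<in> lower (m + m')"
proof -
  have am: "(a + m', m + m') \<in> R" using assms by (auto simp: lower_def intro: add_rel)
  show ?thesis
  proof (cases "b = m'")
    case True
    then show ?thesis using am by (simp add: lower_def)
  next
    case False
    then have "(b + a, m' + a) \<in> R"
      using assms dom by (intro add_rel) (auto simp: lower_def)
    then show ?thesis
      using trans_rel[OF _ am] by (simp add: lower_def add.commute)
  qed
qed

lemma keys_mult_lower:
  assumes "keys p \<subseteq> lower m" "keys q \<subseteq> insert m' (lower m')" "m' \<in> monomials V"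
  shows "keys (p * q) \<subseteq> lower (m + m')"
  using keys_mult[of p q] assms lower_add by blast

lemma keys_mult_lower':
  fixes p q :: "'v mpoly"
  assumes "keys p \<subseteq> insert m (lower m)" "keys q \<subseteq> lower m'" "m \<in> monomials V"
  shows "keys (p * q) \<subseteq> lower (m + m')"
  unfolding mult.commute[of p q] add.commute[of m m'] by (rule keys_mult_lower[OF assms(2,1,3)])

lemma keys_mult_insert_lower:
  assumes "keys p \<subseteq> insert m (lower m)" "keys q \<subseteq> insert m' (lower m')" "m \<in> monomials V" "m' \<in> monomials V"
  shows "keys (p * q) \<subseteq> insert (m + m') (lower (m + m'))"
proof -
  have "a + b \<in> insert (m + m') (lower (m + m'))"
    if "a \<in> insert m (lower m)" "b \<in> insert m' (lower m')" for a b
    using that lower_add[of a m b m'] lower_add[of b m' a m] assms(3,4) by (auto simp: add.commute)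
  then show ?thesis
    using keys_mult[of p q] assms(1,2) by blast
qed

lemma single_in_monomials: "v \<in> V \<Longrightarrow> single v k \<in> monomials V"
  by (auto simp: monomials_def)

lemma keys_power_insert_lower:
  assumes "v \<in> V" "keys p \<subseteq> insert (single v 1) (lower (single v 1))"
  shows "keys (p ^ k) \<subseteq> insert (single v k) (lower (single v k))"
proof (induction k)
  case 0
  then show ?case by simp
next
  case (Suc k)
  have "single v (Suc k) = single v 1 + single v k"
    by (simp add: single_add[symmetric])
  then show ?case
    using keys_mult_insert_lower[OF assms(2) Suc single_in_monomials single_in_monomials] assms(1) by simp
qed

lemma keys_power_diff_lower:
  assumes "v \<in> V" "keys (p - mvar v) \<subseteq> lower (single v 1)"
  shows "keys (p ^ k - mvar v ^ k) \<subseteq> lower (single v k)"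
proof (induction k)
  case 0
  then show ?case by simp
next
  case (Suc k)
  have eq: "single v (Suc k) = single v 1 + single v k"
    by (simp add: single_add[symmetric])
  have "keys p \<subseteq> keys (p - mvar v) \<union> keys (mvar v)"
    using keys_add[of "p - mvar v" "mvar v"] by simp
  then have p: "keys p \<subseteq> insert (single v 1) (lower (single v 1))"
    using assms(2) by (auto simp: mvar_def var_mon_def)
  have "keys (p * (p ^ k - mvar v ^ k)) \<subseteq> lower (single v (Suc k))"
    unfolding eq using assms p Suc by (intro keys_mult_lower' single_in_monomials)
  moreover have "keys ((p - mvar v) * mvar v ^ k) \<subseteq> lower (single v (Suc k))"
    unfolding eq using assms by (intro keys_mult_lower single_in_monomials) (auto simp: mvar_power)
  moreover have "p ^ Suc k - mvar v ^ Suc k = p * (p ^ k - mvar v ^ k) + (p - mvar v) * mvar v ^ k"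
    by (simp add: algebra_simps)
  ultimately show ?case
    using keys_add[of "p * (p ^ k - mvar v ^ k)" "(p - mvar v) * mvar v ^ k"] by auto
qed

lemma keys_power_lower:
  assumes "v \<in> V" "keys p \<subseteq> lower (single v 1)" "k > 0"
  shows "keys (p ^ k) \<subseteq> lower (single v k)"
proof -
  obtain j where k: "k = Suc j" using assms by (cases k) auto
  have "keys (p * p ^ j) \<subseteq> lower (single v 1 + single v j)"
    using assms by (intro keys_mult_lower keys_power_insert_lower single_in_monomials) auto
  then show ?thesis
    by (simp add: k single_add[symmetric])
qed

end

lemma mon_rel_weight:
  "mon_rel V {(a, b). a \<in> monomials V \<and> b \<in> monomials V \<and> mon_weight g a < mon_weight g b}"
  by unfold_locales (auto intro: monomials_add)

lemma wf_weight: "wf {(a, b). a \<in> A \<and> b \<in> A \<and> mon_weight g a < mon_weight g b}"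
  by (rule wf_subset[OF wf_measure[of "mon_weight g"]]) auto

text \<open>For \<open>F = {}\<close> these are the exponents of the Feichtner--Yuzvinsky monomials; the parameter \<open>F\<close>
  serves the induction in the proof of linear independence.\<close>

definition fy_mon :: "nat \<Rightarrow> nat set \<Rightarrow> nat set mon \<Rightarrow> bool" where
  "fy_mon n F m \<longleftrightarrow> keys m \<subseteq> {S. F \<subset> S \<and> S \<subseteq> {1..n}} \<and>
     (\<forall>S\<in>keys m. \<forall>T\<in>keys m. S \<subseteq> T \<or> T \<subseteq> S) \<and>
     (\<forall>S\<in>keys m. \<forall>T\<in>insert F (keys m). T \<subset> S \<longrightarrow> lookup m S < card S - card T)"

lemma single_le_decomp: "k \<le> lookup m v \<Longrightarrow> (m - single v k) + single v k = (m :: 'v mon)"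
  by (rule poly_mapping_eqI) (auto simp: lookup_minus lookup_single when_def)

lemma set_var_eq: "set_var T = single (if T = {} then 0 else single T 1) 1"
  by (simp add: set_var_def mvar_def var_mon_def)

text \<open>Weighting a set by its codimension makes the passage to larger sets a descent. In the
  power relation for \<open>T \<subset> S\<close> the term with \<open>S\<close> to the power
  \<open>card S - card T\<close> is then the leading one, since all other terms of the power of
  \<open>upper_sum n S\<close> involve a strictly larger set.\<close>

lemma fy_span:
  "\<exists>q. keys q \<subseteq> {k. fy_mon n {} k} \<and> p - q \<in> chow_ext n"
proof -
  define g where "g S = n - card S" for S :: "nat set"
  define R where "R = {(a, b). a \<in> monomials (faces n) \<and> b \<in> monomials (faces n) \<and> mon_weight g a < mon_weight g b}"
  interpret mon_rel "faces n" R
    unfolding R_def by (rule mon_rel_weight)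
  have step: "\<exists>q. keys q \<subseteq> {k. (k, m) \<in> R} \<and> single m 1 - q \<in> chow_ext n" if "\<not> fy_mon n {} m" for m
  proof -
    \<comment> \<open>The three ways to violate \<open>fy_mon\<close>: a foreign variable, an
      incomparable pair, an exponent that is too large. The first two put the monomial into the
      ideal.\<close>
    consider S where "S \<in> keys m" "S \<notin> faces n"
      | S T where "keys m \<subseteq> faces n" "S \<in> keys m" "T \<in> keys m" "\<not> S \<subseteq> T" "\<not> T \<subseteq> S"
      | S T where "keys m \<subseteq> faces n" "S \<in> keys m" "T \<in> insert {} (keys m)" "T \<subset> S" "lookup m S \<ge> card S - card T"
    proof (cases "keys m \<subseteq> faces n")
      case False
      then show ?thesis using that(1) by blast
    next
      case True
      then have k: "keys m \<subseteq> {S. {} \<subset> S \<and> S \<subseteq> {1..n}}" by (auto simp: faces_def)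
      show ?thesis
      proof (cases "\<forall>S\<in>keys m. \<forall>T\<in>keys m. S \<subseteq> T \<or> T \<subseteq> S")
        case False
        then show ?thesis using that(2)[OF True] by blast
      next
        case chain: True
        with k \<open>\<not> fy_mon n {} m\<close>
        have "\<exists>S\<in>keys m. \<exists>T\<in>insert {} (keys m). T \<subset> S \<and> \<not> lookup m S < card S - card T"
          unfolding fy_mon_def by blast
        then show ?thesis using that(3)[OF True] not_less by blast
      qed
    qed
    then show ?thesis
    proof cases
      case 1
      then have "m = (m - single S 1) + single S 1"
        by (subst single_le_decomp) (auto simp: in_keys_iff)
      then have "single m 1 = single (m - single S 1) 1 * mvar S"
        unfolding mvar_def var_mon_def mult_single by simp
      then have "single m 1 \<in> chow_ext n"
        using 1 by (simp add: ideal_ext.mult ideal_ext.out)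
      then show ?thesis by (intro exI[of _ 0]) auto
    next
      case 2
      then have "m = (m - single S 1) + single S 1"
        by (subst single_le_decomp) (auto simp: in_keys_iff)
      moreover have "m - single S 1 = (m - single S 1 - single T 1) + single T 1"
        using 2 by (subst single_le_decomp) (auto simp: in_keys_iff lookup_minus lookup_single when_def)
      ultimately obtain k where "m = k + single T 1 + single S 1"
        by metis
      then have "single m 1 = single k 1 * (mvar S * mvar T)"
        by (simp add: mvar_def var_mon_def mult_single add_ac)
      moreover have "mvar S * mvar T \<in> chow_ext n"
        using 2 by (intro incomparable_in_chow) auto
      ultimately have "single m 1 \<in> chow_ext n"
        by (simp add: ideal_ext.mult)
      then show ?thesis by (intro exI[of _ 0]) auto
    next
      case 3
      define k where "k = card S - card T"
      define t where "t = (if T = {} then 0 else single T 1 :: nat set mon)"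
      define m' where "m' = m - single S k - t"
      have S: "S \<in> faces n" using 3 by auto
      have m: "m = m' + t + single S k"
      proof (cases "T = {}")
        case True
        then show ?thesis
          using 3 unfolding m'_def t_def k_def by (simp add: single_le_decomp)
      next
        case False
        then have "(m - single S k - single T 1) + single T 1 = m - single S k"
          using 3 by (intro single_le_decomp) (auto simp: in_keys_iff lookup_minus lookup_single when_def)
        then show ?thesis
          using 3 False unfolding m'_def t_def k_def by (simp add: single_le_decomp)
      qed
      have mon: "m \<in> monomials (faces n)" using 3 by (simp add: monomials_def)
      then have mt: "m' + t \<in> monomials (faces n)"
        unfolding monomials_def using m by (auto simp: keys_add_nat)
      \<comment> \<open>The relation for \<open>T\<close> and \<open>S\<close>, multiplied by the
        cofactor \<open>m'\<close> and solved for its leading monomial \<open>m\<close>.\<close>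
      define q where "q = - (single (m' + t) 1 * (upper_sum n S ^ k - mvar S ^ k))"
      have "upper_sum n S - mvar S = (\<Sum>U | U \<in> faces n \<and> S \<subset> U. mvar U)"
      proof -
        have "{U \<in> faces n. S \<subseteq> U} = insert S {U \<in> faces n. S \<subset> U}" using S by auto
        then show ?thesis by (simp add: upper_sum_def)
      qed
      then have "keys (upper_sum n S - mvar S) \<subseteq> (\<Union>U\<in>{U \<in> faces n. S \<subset> U}. keys (mvar U))"
        using keys_sum[of mvar "{U \<in> faces n. S \<subset> U}"] by simp
      moreover have "single U 1 \<in> lower (single S 1)" if "U \<in> faces n" "S \<subset> U" for U
      proof -
        have "card S < card U"
          using that by (intro psubset_card_mono) (auto simp: faces_def intro: finite_subset)
        with card_le_of_face[OF that(1)] have "g U < g S" by (simp add: g_def)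
        then show ?thesis
          using that S single_in_monomials unfolding lower_def unfolding R_def by simp
      qed
      ultimately have "keys (upper_sum n S - mvar S) \<subseteq> lower (single S 1)"
        by (auto simp: mvar_def var_mon_def)
      then have "keys (upper_sum n S ^ k - mvar S ^ k) \<subseteq> lower (single S k)"
        using S by (intro keys_power_diff_lower)
      then have "keys (single (m' + t) 1 * (upper_sum n S ^ k - mvar S ^ k)) \<subseteq> lower (m' + t + single S k)"
        using mt by (intro keys_mult_lower') auto
      then have "keys q \<subseteq> {k. (k, m) \<in> R}"
        by (simp add: q_def m lower_def)
      moreover have "single m 1 - q \<in> chow_ext n"
      proof -
        have "set_var T * upper_sum n S ^ k \<in> chow_ext n"
          unfolding k_def using 3 S by (intro set_var_mult_upper_sum_power) (auto simp: faces_def)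
        then have "single m' 1 * (set_var T * upper_sum n S ^ k) \<in> chow_ext n"
          by (rule ideal_ext.mult)
        moreover have "single m 1 = single (m' + t) 1 * mvar S ^ k"
          by (simp add: m mvar_power mult_single)
        moreover have "single (m' + t) 1 = single m' 1 * set_var T"
          by (simp add: set_var_eq t_def mult_single)
        ultimately show ?thesis
          by (simp add: q_def algebra_simps)
      qed
      ultimately show ?thesis by blast
    qed
  qed
  have "\<exists>q. keys q \<subseteq> {k. fy_mon n {} k \<and> (k = m \<or> (k, m) \<in> R)} \<and> single m 1 - q \<in> chow_ext n" for m
    using step by (intro reduce_wf) (auto simp: R_def wf_weight trans_def)
  then have *: "\<exists>q. keys q \<subseteq> {k. fy_mon n {} k} \<and> single m 1 - q \<in> chow_ext n" for m
    by (rule ex_forward) auto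
  obtain q where "keys q \<subseteq> (\<Union>k\<in>keys p. {k. fy_mon n {} k})" "p - q \<in> chow_ext n"
    using reduce_sum[of p "\<lambda>_. {k. fy_mon n {} k}", OF *] by auto
  then show ?thesis
    by (intro exI[of _ q]) (auto split: if_splits)
qed

text \<open>Some \<open>e\<close> lies outside the largest proper member of the chain, hence outside
  all proper members; it is put last, and the rest is ordered by induction.\<close>

lemma bij_betw_through_chain:
  assumes "finite E" "C \<subseteq> Pow E" "\<And>S T. S \<in> C \<Longrightarrow> T \<in> C \<Longrightarrow> S \<subseteq> T \<or> T \<subseteq> S"
  shows "\<exists>w. bij_betw w {1..card E} E \<and> (\<forall>T\<in>C. w ` {1..card T} = T)"
  using assms
proof (induction "card E" arbitrary: E C)
  case 0
  then show ?case by (auto simp: bij_betw_def intro!: exI[of _ "\<lambda>_. undefined"])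
next
  case (Suc k)
  define D where "D = C - {E}"
  obtain e where e: "e \<in> E" "\<And>T. T \<in> D \<Longrightarrow> e \<notin> T"
  proof (cases "D = {}")
    case True
    with Suc.hyps(2) show ?thesis using that by fastforce
  next
    case False
    have "finite D"
      using Suc.prems unfolding D_def by (meson finite_Diff finite_Pow_iff finite_subset)
    with False obtain M where M: "M \<in> D" "\<And>T. T \<in> D \<Longrightarrow> M \<subseteq> T \<Longrightarrow> M = T"
      using finite_has_maximal[of D] by blast
    then have "T \<subseteq> M" if "T \<in> D" for T
      using that Suc.prems(3)[of T M] by (auto simp: D_def)
    moreover obtain e where "e \<in> E" "e \<notin> M"
      using M(1) Suc.prems(2) by (auto simp: D_def)
    ultimately show ?thesis using that by blast
  qed
  have "k = card (E - {e})" using e Suc.hyps(2) by simp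
  moreover have "D \<subseteq> Pow (E - {e})" using e Suc.prems(2) by (auto simp: D_def)
  ultimately obtain w where w: "bij_betw w {1..k} (E - {e})" "\<forall>T\<in>D. w ` {1..card T} = T"
    using Suc.hyps(1)[of "E - {e}" D] Suc.prems by (auto simp: D_def)
  define v where "v = w(Suc k := e)"
  have "v ` {1..k} = w ` {1..k}" by (auto simp: v_def)
  have "bij_betw v {1..k} (E - {e})"
    using w(1) by (subst bij_betw_cong[of _ _ w]) (auto simp: v_def)
  then have "bij_betw v ({1..k} \<union> {Suc k}) ((E - {e}) \<union> {e})"
    by (rule bij_betw_combine) (auto simp: v_def bij_betw_def)
  moreover have "{1..k} \<union> {Suc k} = {1..card E}" using Suc.hyps(2) by auto
  moreover have "(E - {e}) \<union> {e} = E" using e by auto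
  ultimately have v: "bij_betw v {1..card E} E" by simp
  moreover have "v ` {1..card T} = T" if "T \<in> C" for T
  proof (cases "T = E")
    case True
    then show ?thesis using v by (simp add: bij_betw_def)
  next
    case False
    with that have T: "T \<in> D" by (simp add: D_def)
    then have "T \<subseteq> E - {e}" using \<open>D \<subseteq> Pow (E - {e})\<close> by auto
    then have "card T \<le> k"
      using card_mono[of "E - {e}" T] Suc.prems(1) \<open>k = card (E - {e})\<close> by simp
    then have "v ` {1..card T} = w ` {1..card T}"
      by (intro image_cong) (auto simp: v_def)
    then show ?thesis using w(2) T by simp
  qed
  ultimately show ?case by blast
qed

lemma permutes_through_chain:
  assumes "C \<subseteq> Pow {1..n}" "\<And>S T. S \<in> C \<Longrightarrow> T \<in> C \<Longrightarrow> S \<subseteq> T \<or> T \<subseteq> S"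
  shows "\<exists>w. w permutes {1..n} \<and> (\<forall>T\<in>C. w ` {1..card T} = T)"
proof -
  obtain v where v: "bij_betw v {1..n} {1..n}" "\<forall>T\<in>C. v ` {1..card T} = T"
    using bij_betw_through_chain[of "{1..n}" C] assms by auto
  define w where "w i = (if i \<in> {1..n} then v i else i)" for i
  have "bij_betw w {1..n} {1..n}"
    using v(1) by (subst bij_betw_cong[of _ _ v]) (auto simp: w_def)
  then have "w permutes {1..n}"
    by (rule bij_imp_permutes) (auto simp: w_def)
  moreover have "w ` {1..card T} = T" if "T \<in> C" for T
  proof -
    have "card T \<le> n" using assms(1) that card_mono[of "{1..n}" T] by auto
    then have "w ` {1..card T} = v ` {1..card T}"
      by (intro image_cong) (auto simp: w_def)
    then show ?thesis using v(2) that by simp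
  qed
  ultimately show ?thesis by blast
qed

section \<open>Linear independence of the Feichtner--Yuzvinsky monomials\<close>

text \<open>Modulo the products of incomparable variables the polynomials are the piecewise polynomial
  functions on the fan of flags of subsets, with the sum of the variables containing \<open>e\<close> as \<open>e\<close>-th
  coordinate. \<open>flag_val n w\<close> evaluates the variables on the chamber of \<open>w\<close> at the point with
  coordinates \<open>e - (n + 1)\<close>.\<close>

definition flag_val :: "nat \<Rightarrow> (nat \<Rightarrow> nat) \<Rightarrow> nat set \<Rightarrow> int" where
  "flag_val n w S =
     (if S \<in> faces n \<and> w ` {1..card S} = S then int (w (card S)) - int (w (Suc (card S))) else 0)"

text \<open>The smallest set of the chain lies inside all others, so it can take over the role of
  the base: the exponent bounds against \<open>G\<close> as a member become the bounds against the
  new base.\<close>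

lemma fy_mon_minus_least:
  assumes m: "fy_mon n F m" and G: "G \<in> keys m" "\<And>S. S \<in> keys m \<Longrightarrow> card G \<le> card S"
  shows "fy_mon n G (m - single G (lookup m G))"
proof -
  have keys: "keys (m - single G (lookup m G)) = keys m - {G}"
    by (auto simp: in_keys_iff lookup_minus lookup_single when_def split: if_splits)
  have "G \<subset> S" if "S \<in> keys m - {G}" for S
  proof -
    have "finite G" using m G(1) by (auto simp: fy_mon_def intro: finite_subset)
    then have "S \<subseteq> G \<Longrightarrow> S = G"
      using that G(2)[of S] by (intro card_seteq) auto
    then show ?thesis
      using m that G(1) by (auto simp: fy_mon_def)
  qed
  moreover have "lookup (m - single G (lookup m G)) S = lookup m S" if "S \<noteq> G" for S
    using that by (simp add: lookup_minus lookup_single when_def)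
  moreover have "insert G (keys m - {G}) = keys m" using G by auto
  ultimately show ?thesis
    using m unfolding fy_mon_def keys by auto
qed

lemma ex_key: "m \<noteq> 0 \<Longrightarrow> \<exists>v. v \<in> keys (m :: 'v mon)"
  by (rule ccontr) (auto simp: in_keys_iff intro: poly_mapping_eqI)

lemma image_comp_transpose:
  fixes i s c :: nat
  assumes "1 \<le> i" "i \<le> s" "s \<le> c"
  shows "(w \<circ> transpose i s) ` {1..c} = w ` {1..c}"
proof -
  have "transpose i s ` {1..c} = {1..c}"
    using assms by (intro permutes_image permutes_swap_id) simp_all
  then show ?thesis by (simp only: image_comp[symmetric])
qed

text \<open>Swapping the entries at places \<open>i \<le> s\<close> changes at most the initial
  segments of length below \<open>s\<close>, while the value of a set depends on its own segment and
  on the places \<open>card S\<close> and \<open>card S + 1\<close>. For \<open>card S = s\<close>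
  the last entry may change, hence the segment of length \<open>s\<close> itself is excluded; the
  other sets of this size have value 0.\<close>

lemma flag_val_transpose:
  assumes i: "1 \<le> i" "i \<le> s" and S: "s < card S \<or> card S = s \<and> S \<noteq> w ` {1..s}"
  shows "flag_val n (w \<circ> transpose i s) S = flag_val n w S"
proof -
  have img: "(w \<circ> transpose i s) ` {1..c} = w ` {1..c}" if "s \<le> c" for c
    using i that by (rule image_comp_transpose)
  show ?thesis
  proof (cases "card S = s")
    case True
    then show ?thesis using S img[of s] by (auto simp: flag_val_def)
  next
    case False
    with S i img[of "card S"] show ?thesis by (simp add: flag_val_def)
  qed
qed

text \<open>Changing which element of \<open>G\<close> comes last among the first \<open>card G\<close> places of a flag through \<open>F\<close> and \<open>G\<close>
  gives \<open>card G - card F\<close> distinct values of the variable \<open>G\<close>, which exceeds its exponents, and leaves the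
  values of all larger sets unchanged.\<close>

lemma fy_mon_independent:
  assumes "F \<subseteq> {1..n}" "F \<in> C" "C \<subseteq> Pow F" "\<And>S T. S \<in> C \<Longrightarrow> T \<in> C \<Longrightarrow> S \<subseteq> T \<or> T \<subseteq> S"
    and "finite A" "\<And>m. m \<in> A \<Longrightarrow> fy_mon n F m"
    and "\<And>w. w permutes {1..n} \<Longrightarrow> (\<And>T. T \<in> C \<Longrightarrow> w ` {1..card T} = T) \<Longrightarrow>
      (\<Sum>m\<in>A. c m * mon_eval (flag_val n w) m) = 0"
    and "m \<in> A"
  shows "c m = 0"
  using assms
proof (induction "n - card F" arbitrary: F C A c m rule: less_induct)
  case less
  note F = \<open>F \<subseteq> {1..n}\<close> and C = \<open>F \<in> C\<close> \<open>C \<subseteq> Pow F\<close>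
    and chain = less.prems(4) and finA = \<open>finite A\<close> and fy = less.prems(6) and vanish = less.prems(7)
  have finF: "finite F" using F finite_subset by blast
  \<comment> \<open>A second induction, over the sizes of the sets in a monomial: monomials with a
    set smaller than \<open>s\<close> have already lost their coefficients, so that \<open>G\<close>
    is a smallest set in what remains.\<close>
  have key: "\<forall>m\<in>A. \<forall>G\<in>keys m. card G = s \<longrightarrow> c m = 0" for s
  proof (induction s rule: less_induct)
    case (less s)
    note small = less.IH
    show ?case
    proof (intro ballI impI)
      fix m0 G assume m0: "m0 \<in> A" "G \<in> keys m0" "card G = s"
      define B where "B = {m\<in>A. \<forall>S\<in>keys m. s \<le> card S}"
      define k where "k = lookup m0 G"
      define Bk where "Bk = {m\<in>B. lookup m G = k}"
      have k: "k > 0" using m0 by (simp add: k_def in_keys_iff)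
      have G: "F \<subset> G" "G \<subseteq> {1..n}" using fy[OF m0(1)] m0(2) by (auto simp: fy_mon_def)
      then have finG: "finite G" using finite_subset by blast
      have cards: "card F < s" "s \<le> n"
        using psubset_card_mono[OF finG G(1)] card_mono[OF _ G(2)] m0(3) by auto
      have outside: "c m = 0" if "m \<in> A - B" for m
        using that small unfolding B_def by (auto simp: not_le)
      show "c m0 = 0"
      proof (cases "m0 \<in> B")
        case False
        then show ?thesis using outside m0 by simp
      next
        case True
        define \<psi> where "\<psi> m = m - single G k" for m :: "nat set mon"
        have Bk: "m \<in> A" "lookup m G = k" "G \<in> keys m" "\<And>S. S \<in> keys m \<Longrightarrow> card G \<le> card S" if "m \<in> Bk" for m
          using that k m0(3) by (auto simp: Bk_def B_def in_keys_iff)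
        have \<psi>: "\<psi> m + single G k = m" if "m \<in> Bk" for m
          unfolding \<psi>_def using Bk(2)[OF that] by (intro single_le_decomp) simp
        have inj: "inj_on \<psi> Bk" by (rule inj_on_inverseI[of _ "\<lambda>m. m + single G k"]) (rule \<psi>)
        \<comment> \<open>The monomials with exponent exactly \<open>k\<close> at \<open>G\<close>,
          stripped of this power, fall under the outer induction with base \<open>G\<close>. It
          remains to see that their sum vanishes at each flag through \<open>C\<close> and
          \<open>G\<close>.\<close>
        have "c (\<psi> m0 + single G k) = 0"
        proof (rule less.hyps[where F = G and C = "insert G C" and A = "\<psi> ` Bk" and m = "\<psi> m0"
              and c = "\<lambda>m. c (m + single G k)"])
          show "n - card G < n - card F" using cards m0(3) by simp
          show "G \<subseteq> {1..n}" "G \<in> insert G C" "insert G C \<subseteq> Pow G" using G C by auto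
          show "S \<subseteq> T \<or> T \<subseteq> S" if "S \<in> insert G C" "T \<in> insert G C" for S T
            using that chain[of S T] C(2) G(1) by auto
          show "finite (\<psi> ` Bk)" using finA by (simp add: Bk_def B_def)
          show "fy_mon n G m" if m: "m \<in> \<psi> ` Bk" for m
          proof -
            obtain l where l: "l \<in> Bk" "m = \<psi> l" using m by auto
            have "fy_mon n G (l - single G (lookup l G))"
              using fy[OF Bk(1)[OF l(1)]] Bk(3,4)[OF l(1)] by (rule fy_mon_minus_least)
            then show ?thesis using l Bk(2)[OF l(1)] by (simp add: \<psi>_def)
          qed
          show "\<psi> m0 \<in> \<psi> ` Bk" using True by (auto simp: Bk_def k_def)
          fix w assume w: "w permutes {1..n}" "\<And>T. T \<in> insert G C \<Longrightarrow> w ` {1..card T} = T"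
          \<comment> \<open>The sum over \<open>B\<close> becomes a polynomial in the value of the
            variable \<open>G\<close>; all other values are the same at the flags used below and go
            into the coefficients. \<open>X i\<close> is the value of \<open>G\<close> once the
            entry at place \<open>i\<close> has been moved to place \<open>s\<close>.\<close>
          define g where "g m = c m * mon_eval (flag_val n w) (m - single G (lookup m G))" for m
          define P where "P = (\<Sum>m\<in>B. monom (g m) (lookup m G))"
          define X where "X i = int (w i) - int (w (Suc s))" for i
          have degP: "degree P \<le> s - card F - 1"
            unfolding P_def
          proof (rule degree_sum_le)
            show "finite B" using finA by (simp add: B_def)
            fix m assume "m \<in> B"
            then have m: "fy_mon n F m" using fy by (simp add: B_def)
            have "lookup m G < s - card F"
            proof (cases "G \<in> keys m")
              case True
              then show ?thesis
                using m G(1) m0(3) unfolding fy_mon_def by blast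
            next
              case False
              then show ?thesis using cards(1) by (simp add: in_keys_iff)
            qed
            then show "degree (monom (g m) (lookup m G)) \<le> s - card F - 1"
              using degree_monom_le[of "g m" "lookup m G"] by simp
          qed
          \<comment> \<open>The places \<open>i\<close> and \<open>s\<close> both lie beyond
            \<open>card F\<close>, so swapping them keeps the flag passing through all of
            \<open>C\<close>.\<close>
          have root: "poly P (X i) = 0" if i: "i \<in> {card F + 1..s}" for i
          proof -
            let ?v = "w \<circ> transpose i s"
            have "?v permutes {1..n}"
              using w(1) i cards by (intro permutes_compose permutes_swap_id) auto
            moreover have "?v ` {1..card T} = T" if "T \<in> C" for T
            proof -
              have "card T \<le> card F" using that C finF by (intro card_mono) auto
              then have "?v ` {1..card T} = w ` {1..card T}"
                using i by (intro image_cong) (auto simp: transpose_def)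
              then show ?thesis using w(2) that by simp
            qed
            ultimately have "0 = (\<Sum>m\<in>A. c m * mon_eval (flag_val n ?v) m)"
              using vanish by simp
            also have "\<dots> = (\<Sum>m\<in>B. c m * mon_eval (flag_val n ?v) m)"
              using finA outside by (intro sum.mono_neutral_right) (auto simp: B_def)
            also have "\<dots> = (\<Sum>m\<in>B. g m * X i ^ lookup m G)"
            proof (rule sum.cong)
              fix m assume m: "m \<in> B"
              let ?l = "m - single G (lookup m G)"
              have wG: "w ` {1..s} = G" using w(2)[of G] m0(3) by simp
              have "flag_val n ?v S = flag_val n w S" if "S \<in> keys ?l" for S
              proof (rule flag_val_transpose)
                from that have "S \<noteq> G" "S \<in> keys m"
                  by (auto simp: in_keys_iff lookup_minus lookup_single when_def split: if_splits)
                then show "s < card S \<or> card S = s \<and> S \<noteq> w ` {1..s}"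
                  using m wG by (auto simp: B_def le_less)
              qed (use i in auto)
              then have "mon_eval (flag_val n ?v) ?l = mon_eval (flag_val n w) ?l"
                by (rule mon_eval_cong)
              moreover have "flag_val n ?v G = X i"
              proof -
                have "?v ` {1..s} = w ` {1..s}"
                  using i by (intro image_comp_transpose) auto
                then show ?thesis
                  using G wG m0(3) i cards by (auto simp: flag_val_def faces_def X_def)
              qed
              moreover have "mon_eval (flag_val n ?v) m = mon_eval (flag_val n ?v) (?l + single G (lookup m G))"
                by (simp add: single_le_decomp)
              ultimately show "c m * mon_eval (flag_val n ?v) m = g m * X i ^ lookup m G"
                by (simp add: g_def)
            qed simp
            also have "\<dots> = poly P (X i)"
              by (simp add: P_def poly_sum poly_monom)
            finally show ?thesis by simp
          qed
          \<comment> \<open>There are \<open>s - card F\<close> distinct roots against a degree of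
            at most \<open>s - card F - 1\<close>. The coefficient of \<open>P\<close> at
            \<open>k\<close> is the sum over \<open>Bk\<close>.\<close>
          have "P = 0"
          proof (rule ccontr)
            assume "P \<noteq> 0"
            have "inj_on X {card F + 1..s}"
              using permutes_inj[OF w(1)] by (auto simp: X_def inj_on_def)
            then have "s - card F = card (X ` {card F + 1..s})"
              by (simp add: card_image)
            also have "\<dots> \<le> card {x. poly P x = 0}"
              using root \<open>P \<noteq> 0\<close> by (intro card_mono poly_roots_finite) auto
            also have "\<dots> \<le> degree P"
              using \<open>P \<noteq> 0\<close> by (rule card_poly_roots_bound)
            finally show False using degP cards by simp
          qed
          then have "0 = coeff P k" by simp
          also have "\<dots> = (\<Sum>m\<in>Bk. g m)"
            unfolding P_def coeff_sum Bk_def using finA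
            by (subst sum.inter_filter) (auto simp: B_def intro: sum.cong)
          also have "\<dots> = (\<Sum>m\<in>\<psi> ` Bk. c (m + single G k) * mon_eval (flag_val n w) m)"
            by (subst sum.reindex[OF inj]) (auto simp: g_def \<psi> \<psi>_def[symmetric] Bk(2) intro!: sum.cong)
          finally show "(\<Sum>m\<in>\<psi> ` Bk. c (m + single G k) * mon_eval (flag_val n w) m) = 0" by simp
        qed
        then show ?thesis using \<psi>[of m0] True by (simp add: Bk_def k_def)
      qed
    qed
  qed
  show ?case
  proof (cases "m = 0")
    case False
    then obtain G where "G \<in> keys m" using ex_key by blast
    then show ?thesis using key less.prems(8) by blast
  next
    case True
    \<comment> \<open>Only the constant monomial is left, and a single flag through \<open>C\<close>
      suffices.\<close>
    have "C \<subseteq> Pow {1..n}" using C(2) F by blast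
    from permutes_through_chain[OF this chain]
    obtain w where w: "w permutes {1..n}" "\<And>T. T \<in> C \<Longrightarrow> w ` {1..card T} = T"
      by metis
    have "c l * mon_eval (flag_val n w) l = 0" if "l \<in> A - {0}" for l
    proof -
      from that obtain G where "G \<in> keys l" using ex_key[of l] by auto
      then show ?thesis using key that by auto
    qed
    then have "(\<Sum>l\<in>A. c l * mon_eval (flag_val n w) l) = (\<Sum>l\<in>{0}. c l * mon_eval (flag_val n w) l)"
      using finA less.prems(8) True by (intro sum.mono_neutral_right) auto
    with vanish[OF w] True show ?thesis by simp
  qed
qed

section \<open>Homogeneous components and values at flags\<close>

abbreviation mon_deg :: "'v mon \<Rightarrow> nat" where "mon_deg \<equiv> mon_weight (\<lambda>_. 1)"

definition hcomp :: "nat \<Rightarrow> 'v mpoly \<Rightarrow> 'v mpoly" where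
  "hcomp d p = (\<Sum>m | m \<in> keys p \<and> mon_deg m = d. single m (lookup p m))"

lemma lookup_hcomp: "lookup (hcomp d p) m = (if mon_deg m = d then lookup p m else 0)"
  by (auto simp: hcomp_def lookup_sum lookup_single when_def in_keys_iff sum.delta' cong: if_cong)

lemma hcomp_add: "hcomp d (p + q) = hcomp d p + hcomp d q"
  by (rule poly_mapping_eqI) (simp add: lookup_hcomp)

lemma hcomp_diff: "hcomp d (p - q) = hcomp d p - hcomp d q"
  by (rule poly_mapping_eqI) (simp add: lookup_hcomp lookup_minus)

lemma hcomp_homogeneous:
  "(\<And>m. m \<in> keys p \<Longrightarrow> mon_deg m = e) \<Longrightarrow> hcomp d p = (if d = e then p else 0)"
  by (rule poly_mapping_eqI) (auto simp: lookup_hcomp in_keys_iff)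

lemma keys_hcomp: "m \<in> keys (hcomp d p) \<Longrightarrow> m \<in> keys p \<and> mon_deg m = d"
  by (auto simp: in_keys_iff lookup_hcomp split: if_splits)

lemma hcomp_single_mult:
  "hcomp d (single t c * p) = (if mon_deg t \<le> d then single t c * hcomp (d - mon_deg t) p else 0)"
proof (induction p rule: mpoly_induct)
  case (single m a)
  have s: "hcomp i (single k b) = (if mon_deg k = i then single k b else 0)" for i k and b :: int
    by (subst hcomp_homogeneous[of _ "mon_deg k"]) (auto split: if_splits)
  show ?case by (auto simp: mult_single s)
next
  case (add p q)
  then show ?case by (simp add: distrib_left hcomp_add)
qed

text \<open>Two sets with nonzero value are initial segments of the same \<open>w\<close>, hence
  nested.\<close>

lemma flag_eval_incomparable:
  assumes "\<not> S \<subseteq> T" "\<not> T \<subseteq> S"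
  shows "flag_val n w S * flag_val n w T = 0"
proof (rule ccontr)
  assume "flag_val n w S * flag_val n w T \<noteq> 0"
  then have "w ` {1..card S} = S" "w ` {1..card T} = T"
    by (auto simp: flag_val_def split: if_splits)
  moreover have "w ` {1..card S} \<subseteq> w ` {1..card T} \<or> w ` {1..card T} \<subseteq> w ` {1..card S}"
    using image_mono[of "{1..card S}" "{1..card T}" w] image_mono[of "{1..card T}" "{1..card S}" w]
    by (cases "card S \<le> card T") auto
  ultimately show False using assms by simp
qed

text \<open>Only the initial segments from the place of \<open>e\<close> on contribute, and their
  values telescope. The constant \<open>Suc n\<close> arises because \<open>w\<close> fixes
  \<open>n + 1\<close>, which serves as the entry after the last place.\<close>

lemma flag_eval_linear:
  assumes w: "w permutes {1..n}" and e: "e \<in> {1..n}"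
  shows "(\<Sum>S | S \<in> faces n \<and> e \<in> S. flag_val n w S) = int e - int (Suc n)"
proof -
  obtain i where i: "i \<in> {1..n}" "w i = e"
    using permutes_image[OF w] e by (metis imageE)
  have inj: "inj_on w A" for A
    using permutes_inj[OF w] by (rule inj_on_subset) auto
  define F where "F j = w ` {1..j}" for j
  have cardF: "card (F j) = j" for j
    unfolding F_def by (simp add: card_image[OF inj])
  have F: "F j \<in> faces n" if "j \<in> {i..n}" for j
    using that i permutes_image[OF w] image_mono[of "{1..j}" "{1..n}" w] by (auto simp: F_def faces_def)
  have "(\<Sum>S | S \<in> faces n \<and> e \<in> S. flag_val n w S) = (\<Sum>S\<in>F ` {i..n}. flag_val n w S)"
  proof (rule sum.mono_neutral_right)
    have "e \<in> F j" if "j \<in> {i..n}" for j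
      using that i by (auto simp: F_def)
    then show "F ` {i..n} \<subseteq> {S. S \<in> faces n \<and> e \<in> S}" using F by auto
    show "\<forall>S\<in>{S \<in> faces n. e \<in> S} - F ` {i..n}. flag_val n w S = 0"
    proof (intro ballI, rule ccontr)
      fix S assume S: "S \<in> {S \<in> faces n. e \<in> S} - F ` {i..n}" and "flag_val n w S \<noteq> 0"
      then have eq: "S = F (card S)" by (auto simp: flag_val_def F_def split: if_splits)
      then have "w i \<in> w ` {1..card S}" using S i by (auto simp: F_def)
      then have "i \<le> card S"
        using permutes_inj[OF w] by (auto simp: inj_image_mem_iff)
      then have "card S \<in> {i..n}" using S card_le_of_face by auto
      with eq S show False by blast
    qed
  qed simp
  also have "\<dots> = (\<Sum>j = i..n. flag_val n w (F j))"
    by (rule sum.reindex_cong[of F]) (auto intro!: inj_onI dest: arg_cong[of _ _ card] simp: cardF)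
  also have "\<dots> = (\<Sum>j = i..n. int (w j) - int (w (j + 1)))"
    using F by (intro sum.cong) (auto simp: flag_val_def cardF, auto simp: F_def)
  also have "\<dots> = int (w i) - int (w (n + 1))"
    using i sum_natinterval_diff[of "\<lambda>j. int (w j)" i n] by simp
  also have "w (n + 1) = n + 1" using w by (auto simp: permutes_def)
  finally show ?thesis using i by simp
qed

text \<open>At the flags the products of incomparable variables vanish and the linear generators are
  constant, so that membership in the Chow ideal lowers the degree.\<close>

lemma chow_ext_hcomp_eval:
  assumes "p \<in> chow_ext n"
  shows "\<exists>g. (\<forall>k\<in>keys g. mon_deg k < d) \<and>
    (\<forall>w. w permutes {1..n} \<longrightarrow> meval (flag_val n w) (hcomp d p) = meval (flag_val n w) g)"
proof -
  \<comment> \<open>All degrees are treated at once, since the component of degree \<open>d\<close>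
    of a multiple by a monomial \<open>t\<close> comes from the component of degree
    \<open>d - mon_deg t\<close>.\<close>
  define D where "D = {p :: nat set mpoly. \<forall>d. \<exists>g. (\<forall>k\<in>keys g. mon_deg k < d) \<and>
    (\<forall>w. w permutes {1..n} \<longrightarrow> meval (flag_val n w) (hcomp d p) = meval (flag_val n w) g)}"
  have D_I: "p \<in> D" if "\<And>d. \<exists>g. (\<forall>k\<in>keys g. mon_deg k < d) \<and>
    (\<forall>w. w permutes {1..n} \<longrightarrow> meval (flag_val n w) (hcomp d p) = meval (flag_val n w) g)" for p
    using that unfolding D_def by blast
  have D_E: "\<exists>g. (\<forall>k\<in>keys g. mon_deg k < d) \<and>
    (\<forall>w. w permutes {1..n} \<longrightarrow> meval (flag_val n w) (hcomp d p) = meval (flag_val n w) g)" if "p \<in> D" for p d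
    using that unfolding D_def by blast
  \<comment> \<open>Each component of a homogeneous polynomial is the polynomial itself or 0, so the
    witness 0 serves in every degree.\<close>
  have D_null: "p \<in> D" if "\<And>m. m \<in> keys p \<Longrightarrow> mon_deg m = e" "\<And>w. meval (flag_val n w) p = 0" for p e
    using that hcomp_homogeneous[of p e] by (intro D_I exI[of _ 0]) simp
  have D_add: "p + q \<in> D" if "p \<in> D" "q \<in> D" for p q
  proof (rule D_I)
    fix d
    obtain g where g: "\<forall>k\<in>keys g. mon_deg k < d" "\<And>w. w permutes {1..n} \<Longrightarrow> meval (flag_val n w) (hcomp d p) = meval (flag_val n w) g"
      using D_E[OF \<open>p \<in> D\<close>] by metis
    obtain h where h: "\<forall>k\<in>keys h. mon_deg k < d" "\<And>w. w permutes {1..n} \<Longrightarrow> meval (flag_val n w) (hcomp d q) = meval (flag_val n w) h"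
      using D_E[OF \<open>q \<in> D\<close>] by metis
    have "\<forall>k\<in>keys (g + h). mon_deg k < d" using g(1) h(1) keys_add[of g h] by auto
    then show "\<exists>g. (\<forall>k\<in>keys g. mon_deg k < d) \<and>
      (\<forall>w. w permutes {1..n} \<longrightarrow> meval (flag_val n w) (hcomp d (p + q)) = meval (flag_val n w) g)"
      using g(2) h(2) by (intro exI[of _ "g + h"]) (simp add: hcomp_add)
  qed
  have D_single: "single t c * p \<in> D" if "p \<in> D" for p t c
  proof (rule D_I)
    fix d
    obtain g where g: "\<forall>k\<in>keys g. mon_deg k < d - mon_deg t"
      "\<And>w. w permutes {1..n} \<Longrightarrow> meval (flag_val n w) (hcomp (d - mon_deg t) p) = meval (flag_val n w) g"
      using D_E[OF \<open>p \<in> D\<close>] by metis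
    show "\<exists>g. (\<forall>k\<in>keys g. mon_deg k < d) \<and>
      (\<forall>w. w permutes {1..n} \<longrightarrow> meval (flag_val n w) (hcomp d (single t c * p)) = meval (flag_val n w) g)"
    proof (cases "mon_deg t \<le> d")
      case True
      have "mon_deg k < d" if "k \<in> keys (single t c * g)" for k
      proof -
        have "k \<in> {a + b | a b. a \<in> keys (single t c) \<and> b \<in> keys g}"
          using that keys_mult[of "single t c" g] by blast
        then obtain b where "b \<in> keys g" "k = t + b" by (auto split: if_splits)
        then show ?thesis using g(1) by fastforce
      qed
      then show ?thesis
        using True g(2) by (intro exI[of _ "single t c * g"]) (simp add: hcomp_single_mult)
    next
      case False
      then show ?thesis by (intro exI[of _ 0]) (simp add: hcomp_single_mult)
    qed
  qed
  have D_mult: "q * p \<in> D" if "p \<in> D" for p q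
    using that by (induction q rule: mpoly_induct) (simp_all add: D_single D_add distrib_right)
  from assms have "p \<in> D"
  proof induction
    case zero
    show ?case by (rule D_null) auto
  next
    case (gen g)
    then consider S T where "\<not> S \<subseteq> T" "\<not> T \<subseteq> S" "g = mvar S * mvar T"
      | e where "e \<in> {1..n}" "g = (\<Sum>S | S \<in> faces n \<and> e \<in> S. mvar S)"
      unfolding chow_gens_def by blast
    then show ?case
    proof cases
      case 1
      show ?thesis
      proof (rule D_null)
        show "mon_deg m = 2" if "m \<in> keys g" for m
          using that by (simp add: 1 mvar_def var_mon_def mult_single)
        show "meval (flag_val n w) g = 0" for w
          using flag_eval_incomparable[OF 1(1,2)] by (simp add: 1)
      qed
    next
      case 2
      have "keys g \<subseteq> (\<Union>S\<in>{S. S \<in> faces n \<and> e \<in> S}. keys (mvar S))"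
        unfolding 2 by (rule keys_sum)
      then have deg: "mon_deg m = 1" if "m \<in> keys g" for m
        using that by (auto simp: mvar_def var_mon_def)
      have "meval (flag_val n w) g = meval (flag_val n w) (of_int (int e - int (Suc n)))" if "w permutes {1..n}" for w
        unfolding meval_of_int using flag_eval_linear[OF that 2(1)] by (simp add: 2)
      moreover have "k = 0" if "k \<in> keys (of_int (int e - int (Suc n)) :: nat set mpoly)" for k
      proof -
        have "(of_int c :: nat set mpoly) = single 0 c" for c
          by (simp flip: single_of_int)
        from that[unfolded this] show ?thesis by (simp split: if_splits)
      qed
      ultimately have const: "\<exists>h. (\<forall>k\<in>keys h. mon_deg k < 1) \<and>
          (\<forall>w. w permutes {1..n} \<longrightarrow> meval (flag_val n w) g = meval (flag_val n w) h)"
        by (intro exI[of _ "of_int (int e - int (Suc n))"]) fastforce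
      show ?thesis
      proof (rule D_I)
        fix d
        have "hcomp d g = (if d = 1 then g else 0)"
          using deg by (rule hcomp_homogeneous)
        then show "\<exists>h. (\<forall>k\<in>keys h. mon_deg k < d) \<and>
            (\<forall>w. w permutes {1..n} \<longrightarrow> meval (flag_val n w) (hcomp d g) = meval (flag_val n w) h)"
          using const by (cases "d = 1") (auto intro: exI[of _ 0])
      qed
    qed
  next
    case (out v)
    show ?case
    proof (rule D_null)
      show "mon_deg m = 1" if "m \<in> keys (mvar v)" for m
        using that by (simp add: mvar_def var_mon_def)
      show "meval (flag_val n w) (mvar v) = 0" for w
        using out by (simp add: flag_val_def)
    qed
  qed (auto intro: D_add D_mult)
  then show ?thesis by (rule D_E)
qed

text \<open>The combination \<open>q\<close> from \<open>fy_span\<close> may have components of any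
  degree; only that of degree \<open>d\<close> is used. The rest, namely \<open>p\<close> without
  its top component together with the lower-degree substitute for the top component of
  \<open>p - q\<close>, falls under the induction hypothesis.\<close>

lemma fy_span_eval:
  assumes "\<And>m. m \<in> keys p \<Longrightarrow> mon_deg m < d"
  shows "\<exists>q. (\<forall>m\<in>keys q. fy_mon n {} m \<and> mon_deg m < d) \<and>
    (\<forall>w. w permutes {1..n} \<longrightarrow> meval (flag_val n w) p = meval (flag_val n w) q)"
  using assms
proof (induction d arbitrary: p)
  case 0
  then have "p = 0" by (metis keys_eq_empty not_less_zero ex_in_conv)
  then show ?case by (intro exI[of _ 0]) auto
next
  case (Suc d)
  obtain q where q: "keys q \<subseteq> {k. fy_mon n {} k}" "p - q \<in> chow_ext n"
    using fy_span by blast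
  obtain g where g: "\<forall>k\<in>keys g. mon_deg k < d"
    "\<And>w. w permutes {1..n} \<Longrightarrow> meval (flag_val n w) (hcomp d (p - q)) = meval (flag_val n w) g"
    using chow_ext_hcomp_eval[OF q(2)] by metis
  define h where "h = (p - hcomp d p) + g"
  have "mon_deg m < d" if "m \<in> keys h" for m
  proof -
    have "m \<in> keys (p - hcomp d p) \<or> m \<in> keys g"
      using that keys_add[of "p - hcomp d p" g] by (auto simp: h_def)
    then show ?thesis
    proof
      assume "m \<in> keys (p - hcomp d p)"
      then have "m \<in> keys p" "mon_deg m \<noteq> d"
        by (auto simp: in_keys_iff lookup_minus lookup_hcomp split: if_splits)
      then show ?thesis using Suc.prems[of m] by simp
    qed (use g(1) in auto)
  qed
  then obtain r where r: "\<forall>m\<in>keys r. fy_mon n {} m \<and> mon_deg m < d"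
    "\<And>w. w permutes {1..n} \<Longrightarrow> meval (flag_val n w) h = meval (flag_val n w) r"
    using Suc.IH by metis
  have "fy_mon n {} m \<and> mon_deg m < Suc d" if m: "m \<in> keys (hcomp d q + r)" for m
  proof -
    have "m \<in> keys (hcomp d q) \<or> m \<in> keys r"
      using m keys_add[of "hcomp d q" r] by auto
    then show ?thesis
    proof
      assume "m \<in> keys (hcomp d q)"
      then show ?thesis using keys_hcomp[of m d q] q(1) by auto
    qed (use r(1) in auto)
  qed
  moreover have "meval (flag_val n w) p = meval (flag_val n w) (hcomp d q + r)" if "w permutes {1..n}" for w
    using r(2)[OF that] g(2)[OF that] by (simp add: h_def hcomp_diff)
  ultimately show ?case by blast
qed

lemma fy_independent_mod_chow:
  assumes "r \<in> chow_ext n" "keys r \<subseteq> {m. fy_mon n {} m}"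
  shows "r = 0"
proof -
  have hom: "hcomp d r = 0" for d
  proof -
    obtain g where g: "\<forall>k\<in>keys g. mon_deg k < d"
      "\<And>w. w permutes {1..n} \<Longrightarrow> meval (flag_val n w) (hcomp d r) = meval (flag_val n w) g"
      using chow_ext_hcomp_eval[OF assms(1)] by metis
    obtain q where q: "\<forall>m\<in>keys q. fy_mon n {} m \<and> mon_deg m < d"
      "\<And>w. w permutes {1..n} \<Longrightarrow> meval (flag_val n w) g = meval (flag_val n w) q"
      using fy_span_eval[of g d n] g(1) by metis
    \<comment> \<open>A combination of Feichtner-Yuzvinsky monomials that vanishes at all flags.
      With the base and the chain reduced to the empty set, \<open>fy_mon_independent\<close> admits
      every permutation.\<close>
    define s where "s = hcomp d r - q"
    have "lookup s m = 0" if m: "m \<in> keys s" for m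
    proof (rule fy_mon_independent[of "{}" n "{{}}" "keys s"])
      show "fy_mon n {} k" if "k \<in> keys s" for k
      proof -
        have "k \<in> keys (hcomp d r) \<or> k \<in> keys q"
          using that by (auto simp: s_def in_keys_iff lookup_minus)
        then show ?thesis using keys_hcomp[of k d r] assms(2) q(1) by auto
      qed
      show "(\<Sum>m\<in>keys s. lookup s m * mon_eval (flag_val n w) m) = 0" if "w permutes {1..n}" for w
        using g(2)[OF that] q(2)[OF that] meval_def[of "flag_val n w" s] by (simp add: s_def)
    qed (use m in auto)
    then have "lookup s m = 0" for m by (metis in_keys_iff)
    then have "s = 0" by (auto intro: poly_mapping_eqI)
    \<comment> \<open>One side is homogeneous of degree \<open>d\<close>, the other has only smaller
      degrees, so both are 0.\<close>
    then have "hcomp d r = q" by (simp add: s_def)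
    then have "m \<notin> keys q" for m
      using q(1) keys_hcomp[of m d r] by auto
    then have "lookup q m = 0" for m by (simp add: in_keys_iff)
    then show ?thesis
      using \<open>hcomp d r = q\<close> by (auto intro: poly_mapping_eqI)
  qed
  have "lookup r m = 0" for m
    using hom[of "mon_deg m"] lookup_hcomp[of "mon_deg m" r m] by simp
  then show ?thesis by (auto intro: poly_mapping_eqI)
qed

section \<open>Polynomials in the level sums\<close>

definition chain_mon :: "nat mon \<Rightarrow> (nat \<Rightarrow> nat set) \<Rightarrow> nat set mon" where
  "chain_mon \<tau> f = (\<Sum>l\<in>keys \<tau>. single (f l) (lookup \<tau> l))"

text \<open>The functions are extensional, so that a choice is determined by its monomial and sums
  over choices have no repetitions.\<close>

definition level_choices :: "nat \<Rightarrow> nat mon \<Rightarrow> (nat \<Rightarrow> nat set) set" where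
  "level_choices n \<tau> = (\<Pi>\<^sub>E l\<in>keys \<tau>. {S. S \<in> faces n \<and> card S = l})"

definition level_chains :: "nat \<Rightarrow> nat mon \<Rightarrow> (nat \<Rightarrow> nat set) set" where
  "level_chains n \<tau> = {f \<in> level_choices n \<tau>. \<forall>k\<in>keys \<tau>. \<forall>l\<in>keys \<tau>. f k \<subseteq> f l \<or> f l \<subseteq> f k}"

definition std_mon :: "nat \<Rightarrow> nat mon \<Rightarrow> bool" where
  "std_mon n \<tau> \<longleftrightarrow> keys \<tau> \<subseteq> {1..n} \<and>
     (\<forall>b\<in>keys \<tau>. \<forall>a\<in>insert 0 (keys \<tau>). a < b \<longrightarrow> lookup \<tau> b < b - a)"

definition chain_expansion :: "nat \<Rightarrow> (nat mon \<Rightarrow> int) \<Rightarrow> nat mon set \<Rightarrow> nat set mpoly" where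
  "chain_expansion n c A = (\<Sum>\<tau>\<in>A. \<Sum>f\<in>level_chains n \<tau>. single (chain_mon \<tau> f) (c \<tau>))"

lemma finite_level_choices: "finite (level_choices n \<tau>)"
  unfolding level_choices_def by (rule finite_PiE) auto

lemma finite_level_chains: "finite (level_chains n \<tau>)"
  using finite_level_choices[of n \<tau>] by (simp add: level_chains_def)

lemma level_choicesD:
  assumes "f \<in> level_choices n \<tau>" "l \<in> keys \<tau>"
  shows "f l \<in> faces n" "card (f l) = l"
  using assms by (auto simp: level_choices_def PiE_def Pi_def)

lemma level_chains_choices: "f \<in> level_chains n \<tau> \<Longrightarrow> f \<in> level_choices n \<tau>"
  by (simp add: level_chains_def)

lemma lookup_chain_mon:
  assumes "f \<in> level_choices n \<tau>"
  shows "lookup (chain_mon \<tau> f) S = (if card S \<in> keys \<tau> \<and> f (card S) = S then lookup \<tau> (card S) else 0)"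
proof -
  have "lookup (chain_mon \<tau> f) S = (\<Sum>l\<in>keys \<tau>. if l = card S then (if f (card S) = S then lookup \<tau> (card S) else 0) else 0)"
    unfolding chain_mon_def lookup_sum
    using level_choicesD(2)[OF assms] by (intro sum.cong) (auto simp: lookup_single when_def)
  then show ?thesis by (simp add: sum.delta')
qed

lemma keys_chain_mon:
  assumes "f \<in> level_choices n \<tau>"
  shows "keys (chain_mon \<tau> f) = f ` keys \<tau>"
proof (intro Set.set_eqI iffI)
  fix S assume "S \<in> keys (chain_mon \<tau> f)"
  then have "card S \<in> keys \<tau>" "f (card S) = S"
    by (auto simp: in_keys_iff lookup_chain_mon[OF assms] split: if_splits)
  then show "S \<in> f ` keys \<tau>" by (metis imageI)
next
  fix S assume "S \<in> f ` keys \<tau>"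
  then show "S \<in> keys (chain_mon \<tau> f)"
    using level_choicesD(2)[OF assms] by (auto simp: in_keys_iff lookup_chain_mon[OF assms])
qed

text \<open>The set chosen at level \<open>l\<close> is the only set of size \<open>l\<close> in the
  monomial, so the type and the choice can be read off.\<close>

lemma chain_mon_inject:
  assumes f: "f \<in> level_choices n \<tau>" and g: "g \<in> level_choices n \<upsilon>" and eq: "chain_mon \<tau> f = chain_mon \<upsilon> g"
  shows "\<tau> = \<upsilon> \<and> f = g"
proof -
  have *: "l \<in> keys \<upsilon> \<and> g l = f l \<and> lookup \<upsilon> l = lookup \<tau> l"
    if "f \<in> level_choices n \<tau>" "g \<in> level_choices n \<upsilon>" "chain_mon \<tau> f = chain_mon \<upsilon> g" "l \<in> keys \<tau>" for f g \<tau> \<upsilon> l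
  proof -
    have "card (f l) = l" using that level_choicesD by blast
    then have "lookup (chain_mon \<upsilon> g) (f l) = lookup \<tau> l"
      using lookup_chain_mon[OF that(1), of "f l"] that by simp
    then show ?thesis
      using lookup_chain_mon[OF that(2), of "f l"] \<open>card (f l) = l\<close> that(4)
      by (auto simp: in_keys_iff split: if_splits)
  qed
  have keys: "keys \<tau> = keys \<upsilon>" using *[OF f g eq] *[OF g f eq[symmetric]] by blast
  have "\<tau> = \<upsilon>"
  proof (rule poly_mapping_eqI)
    fix l show "lookup \<tau> l = lookup \<upsilon> l"
      using *[OF f g eq, of l] keys by (cases "l \<in> keys \<tau>") (auto simp: in_keys_iff)
  qed
  moreover have "f = g"
    using f g keys *[OF f g eq] unfolding level_choices_def by (intro PiE_ext[of f "keys \<tau>" _ g]) auto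
  ultimately show ?thesis by simp
qed

lemma fy_chain_mon:
  assumes "std_mon n \<tau>" "f \<in> level_chains n \<tau>"
  shows "fy_mon n {} (chain_mon \<tau> f)"
proof -
  note f = level_chains_choices[OF assms(2)]
  have "lookup (chain_mon \<tau> f) (f l) < card (f l) - card T"
    if l: "l \<in> keys \<tau>" and T: "T \<in> insert {} (f ` keys \<tau>)" "T \<subset> f l" for l T
  proof -
    have "finite (f l)" using level_choicesD(1)[OF f l] by (auto simp: faces_def intro: finite_subset)
    then have "card T < l"
      using psubset_card_mono[OF _ T(2)] level_choicesD(2)[OF f l] by simp
    moreover have "card T \<in> insert 0 (keys \<tau>)"
      using T(1) level_choicesD(2)[OF f] by auto
    ultimately have "lookup \<tau> l < l - card T"
      using assms(1) l unfolding std_mon_def by blast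
    then show ?thesis
      using l level_choicesD(2)[OF f l] by (simp add: lookup_chain_mon[OF f])
  qed
  then have "\<forall>S\<in>f ` keys \<tau>. \<forall>T\<in>insert {} (f ` keys \<tau>). T \<subset> S \<longrightarrow> lookup (chain_mon \<tau> f) S < card S - card T"
    by blast
  moreover have "f ` keys \<tau> \<subseteq> {S. {} \<subset> S \<and> S \<subseteq> {1..n}}"
    using level_choicesD(1)[OF f] by (force simp: faces_def)
  moreover have "\<forall>S\<in>f ` keys \<tau>. \<forall>T\<in>f ` keys \<tau>. S \<subseteq> T \<or> T \<subseteq> S"
    using assms(2) by (auto simp: level_chains_def)
  ultimately show ?thesis
    unfolding fy_mon_def keys_chain_mon[OF f] by blast
qed

text \<open>Distinct sets of a chain have distinct sizes, so the type can record each exponent at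
  the size of its set, and the sets themselves form the choice. The exponent bounds translate
  because inclusion in a chain is the order of sizes.\<close>

lemma fy_mon_as_chain_mon:
  assumes "fy_mon n {} m"
  obtains \<tau> f where "std_mon n \<tau>" "f \<in> level_chains n \<tau>" "m = chain_mon \<tau> f"
proof -
  have faces: "keys m \<subseteq> faces n" using assms by (auto simp: fy_mon_def faces_def)
  have fin: "finite S" if "S \<in> keys m" for S
    using that faces by (auto simp: faces_def intro: finite_subset)
  have inj: "S = T" if "S \<in> keys m" "T \<in> keys m" "card S = card T" for S T
  proof -
    have "S \<subseteq> T \<or> T \<subseteq> S" using that assms by (simp add: fy_mon_def)
    then show ?thesis using that fin card_subset_eq[of T S] card_subset_eq[of S T] by auto
  qed
  define \<tau> where "\<tau> = (\<Sum>S\<in>keys m. single (card S) (lookup m S))"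
  have \<tau>1: "lookup \<tau> (card S) = lookup m S" if "S \<in> keys m" for S
  proof -
    have "lookup \<tau> (card S) = (\<Sum>T\<in>keys m. if T = S then lookup m S else 0)"
      unfolding \<tau>_def lookup_sum using inj that by (intro sum.cong) (auto simp: lookup_single when_def)
    then show ?thesis using that by (simp add: sum.delta')
  qed
  have \<tau>0: "lookup \<tau> l = 0" if "l \<notin> card ` keys m" for l
    unfolding \<tau>_def lookup_sum using that by (intro sum.neutral) (auto simp: lookup_single when_def)
  have keys: "keys \<tau> = card ` keys m"
    using \<tau>0 \<tau>1 by (auto simp: in_keys_iff)
  define f where "f = (\<lambda>l\<in>keys \<tau>. THE S. S \<in> keys m \<and> card S = l)"
  have f: "f (card S) = S" if "S \<in> keys m" for S
    using that inj by (auto simp: f_def keys intro!: the_equality)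
  have fch: "f \<in> level_choices n \<tau>"
    unfolding level_choices_def
  proof (intro PiE_I)
    show "f l = undefined" if "l \<notin> keys \<tau>" for l using that by (simp add: f_def)
    show "f l \<in> {S. S \<in> faces n \<and> card S = l}" if "l \<in> keys \<tau>" for l
      using that faces f by (auto simp: keys)
  qed
  have "std_mon n \<tau>"
  proof -
    have "card S \<in> {1..n}" if "S \<in> keys m" for S
    proof -
      have "S \<in> faces n" using that faces by auto
      moreover from this have "card S \<noteq> 0" using fin[OF that] by (auto simp: faces_def)
      ultimately show ?thesis using card_le_of_face[of S n] by simp
    qed
    moreover have "lookup \<tau> b < b - a" if ab: "b \<in> keys \<tau>" "a \<in> insert 0 (keys \<tau>)" "a < b" for a b
    proof -
      obtain S where S: "S \<in> keys m" "b = card S" using ab(1) by (auto simp: keys)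
      obtain T where T: "T \<in> insert {} (keys m)" "a = card T"
      proof (cases "a = 0")
        case True
        then show ?thesis using that[of "{}"] by simp
      next
        case False
        then show ?thesis using that ab(2) by (auto simp: keys)
      qed
      have "T \<subset> S"
      proof (cases "T = {}")
        case True
        then show ?thesis using S ab T by auto
      next
        case False
        then have "T \<subseteq> S \<or> S \<subseteq> T" using T S assms by (auto simp: fy_mon_def)
        moreover have "\<not> S \<subseteq> T"
          using card_mono[of T S] fin[of T] T S ab False by auto
        ultimately show ?thesis by auto
      qed
      then show ?thesis using assms S T \<tau>1 unfolding fy_mon_def by auto
    qed
    ultimately show ?thesis unfolding std_mon_def keys by auto
  qed
  moreover have "f \<in> level_chains n \<tau>"
    using fch f assms by (auto simp: level_chains_def keys fy_mon_def)
  moreover have "m = chain_mon \<tau> f"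
  proof (rule poly_mapping_eqI)
    fix S show "lookup m S = lookup (chain_mon \<tau> f) S"
    proof (cases "S \<in> keys m")
      case True
      then show ?thesis using f \<tau>1 by (simp add: lookup_chain_mon[OF fch] keys)
    next
      case False
      have "f (card S) \<noteq> S" if "card S \<in> keys \<tau>"
        using that f False by (auto simp: keys)
      with False show ?thesis by (auto simp: lookup_chain_mon[OF fch] in_keys_iff)
    qed
  qed
  ultimately show ?thesis using that by blast
qed

lemma lookup_chain_expansion:
  assumes "finite A" "f \<in> level_chains n \<tau>"
  shows "lookup (chain_expansion n c A) (chain_mon \<tau> f) = (if \<tau> \<in> A then c \<tau> else 0)"
proof -
  have "lookup (chain_expansion n c A) (chain_mon \<tau> f)
      = (\<Sum>\<upsilon>\<in>A. \<Sum>g\<in>level_chains n \<upsilon>. if g = f \<and> \<upsilon> = \<tau> then c \<tau> else 0)"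
    unfolding chain_expansion_def lookup_sum
  proof (intro sum.cong refl)
    fix \<upsilon> g assume "g \<in> level_chains n \<upsilon>"
    then have "chain_mon \<upsilon> g = chain_mon \<tau> f \<longleftrightarrow> g = f \<and> \<upsilon> = \<tau>"
      using chain_mon_inject[OF level_chains_choices level_chains_choices[OF assms(2)]] by blast
    then show "lookup (single (chain_mon \<upsilon> g) (c \<upsilon>)) (chain_mon \<tau> f) = (if g = f \<and> \<upsilon> = \<tau> then c \<tau> else 0)"
      by (auto simp: lookup_single when_def)
  qed
  also have "\<dots> = (\<Sum>\<upsilon>\<in>A. if \<upsilon> = \<tau> then c \<tau> else 0)"
    using assms(2) finite_level_chains by (intro sum.cong) (auto simp: sum.delta')
  also have "\<dots> = (if \<tau> \<in> A then c \<tau> else 0)"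
    using assms(1) by (simp add: sum.delta')
  finally show ?thesis .
qed

lemma keys_chain_expansion:
  assumes "k \<in> keys (chain_expansion n c A)"
  obtains \<tau> f where "\<tau> \<in> A" "f \<in> level_chains n \<tau>" "k = chain_mon \<tau> f"
proof -
  have "\<exists>\<tau>\<in>A. k \<in> keys (\<Sum>f\<in>level_chains n \<tau>. single (chain_mon \<tau> f) (c \<tau>))"
    using assms keys_sum[of "\<lambda>\<tau>. \<Sum>f\<in>level_chains n \<tau>. single (chain_mon \<tau> f) (c \<tau>)" A]
    unfolding chain_expansion_def by blast
  then obtain \<tau> where \<tau>: "\<tau> \<in> A" "k \<in> keys (\<Sum>f\<in>level_chains n \<tau>. single (chain_mon \<tau> f) (c \<tau>))" by blast
  then obtain f where "f \<in> level_chains n \<tau>" "k \<in> keys (single (chain_mon \<tau> f) (c \<tau>))"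
    using keys_sum[of "\<lambda>f. single (chain_mon \<tau> f) (c \<tau>)" "level_chains n \<tau>"] by blast
  then show ?thesis using that \<tau>(1) by (auto split: if_splits)
qed

lemma ideal_ext_prod_diff:
  assumes "\<And>i. i \<in> A \<Longrightarrow> a i - b i \<in> ideal_ext V G"
  shows "(\<Prod>i\<in>A. a i) - (\<Prod>i\<in>A. b i) \<in> ideal_ext V G"
  using assms
proof (induction A rule: infinite_finite_induct)
  case (insert i A)
  have "a i * (prod a A - prod b A) + (a i - b i) * prod b A \<in> ideal_ext V G"
    using insert by (intro ideal_ext.add ideal_ext.mult[of "prod a A - prod b A"] ideal_ext_mult') auto
  then show ?case using insert by (simp add: algebra_simps)
qed (simp_all add: ideal_ext.zero)

lemma level_sum_power:
  assumes "k > 0"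
  shows "level_sum n l ^ k - (\<Sum>S | S \<in> faces n \<and> card S = l. mvar S ^ k) \<in> chow_ext n"
proof -
  define L where "L = {S. S \<in> faces n \<and> card S = l}"
  have finL: "finite L" by (simp add: L_def)
  have "level_sum n l ^ Suc j - (\<Sum>S\<in>L. mvar S ^ Suc j) \<in> chow_ext n" for j
  proof (induction j)
    case 0
    then show ?case by (simp add: level_sum_def L_def ideal_ext.zero)
  next
    case (Suc j)
    have "level_sum n l * (\<Sum>S\<in>L. mvar S ^ Suc j) - (\<Sum>S\<in>L. mvar S ^ Suc (Suc j))
        = (\<Sum>S\<in>L. (\<Sum>T\<in>L. mvar T * mvar S ^ Suc j) - mvar S * mvar S ^ Suc j)"
      unfolding level_sum_def L_def[symmetric] sum_product sum_subtractf power_Suc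
      by (subst sum.swap) simp
    also have "\<dots> = (\<Sum>S\<in>L. \<Sum>T\<in>L - {S}. mvar T * mvar S ^ Suc j)"
      using finL by (intro sum.cong) (auto simp: sum_diff1)
    also have "\<dots> \<in> chow_ext n"
    proof (intro ideal_ext_sum)
      fix S T assume ST: "S \<in> L" "T \<in> L - {S}"
      then have "\<not> S \<subseteq> T" "\<not> T \<subseteq> S"
        using card_subset_eq[of S T] card_subset_eq[of T S] finite_subset[of _ "{1..n}"]
        by (auto simp: L_def faces_def)
      then have "mvar T * mvar S \<in> chow_ext n"
        using ST by (intro incomparable_in_chow) (auto simp: L_def)
      then have "mvar T * mvar S * mvar S ^ j \<in> chow_ext n" by (rule ideal_ext_mult')
      then show "mvar T * mvar S ^ Suc j \<in> chow_ext n" by (simp add: mult.assoc)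
    qed
    finally have "level_sum n l * (level_sum n l ^ Suc j - (\<Sum>S\<in>L. mvar S ^ Suc j)) +
        (level_sum n l * (\<Sum>S\<in>L. mvar S ^ Suc j) - (\<Sum>S\<in>L. mvar S ^ Suc (Suc j))) \<in> chow_ext n"
      by (rule ideal_ext.add[OF ideal_ext.mult[OF Suc]])
    then show ?case by (simp add: right_diff_distrib)
  qed
  then show ?thesis
    using assms by (cases k) (auto simp: L_def)
qed

lemma mon_eval_level_sum:
  "mon_eval (level_sum n) \<tau> - (\<Sum>f\<in>level_chains n \<tau>. single (chain_mon \<tau> f) 1) \<in> chow_ext n"
proof -
  define L where "L l = {S. S \<in> faces n \<and> card S = l}" for l
  have 1: "mon_eval (level_sum n) \<tau> - (\<Prod>l\<in>keys \<tau>. \<Sum>S\<in>L l. mvar S ^ lookup \<tau> l) \<in> chow_ext n"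
    unfolding mon_eval_def L_def by (intro ideal_ext_prod_diff level_sum_power) (simp add: in_keys_iff)
  have "(\<Prod>l\<in>keys \<tau>. \<Sum>S\<in>L l. mvar S ^ lookup \<tau> l) = (\<Sum>f\<in>level_choices n \<tau>. \<Prod>l\<in>keys \<tau>. mvar (f l) ^ lookup \<tau> l)"
    unfolding level_choices_def L_def by (rule prod_sum_PiE) auto
  also have "\<dots> = (\<Sum>f\<in>level_choices n \<tau>. single (chain_mon \<tau> f) 1)"
  proof (rule sum.cong)
    fix f
    have "(\<Prod>l\<in>keys \<tau>. mvar (f l) ^ lookup \<tau> l) = mon_eval mvar (chain_mon \<tau> f)"
      by (simp add: chain_mon_def mon_eval_sum)
    then show "(\<Prod>l\<in>keys \<tau>. mvar (f l) ^ lookup \<tau> l) = single (chain_mon \<tau> f) 1"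
      by (simp add: mon_eval_mvar)
  qed simp
  \<comment> \<open>The choices that are not chains contain an incomparable pair and drop out modulo
    the ideal.\<close>
  also have "\<dots> = (\<Sum>f\<in>level_choices n \<tau> - level_chains n \<tau>. single (chain_mon \<tau> f) 1)
      + (\<Sum>f\<in>level_chains n \<tau>. single (chain_mon \<tau> f) 1)"
    using finite_level_choices by (intro sum.subset_diff) (auto simp: level_chains_def)
  finally have 2: "(\<Prod>l\<in>keys \<tau>. \<Sum>S\<in>L l. mvar S ^ lookup \<tau> l) - (\<Sum>f\<in>level_chains n \<tau>. single (chain_mon \<tau> f) 1)
      = (\<Sum>f\<in>level_choices n \<tau> - level_chains n \<tau>. single (chain_mon \<tau> f) 1)" by simp
  have "(\<Sum>f\<in>level_choices n \<tau> - level_chains n \<tau>. single (chain_mon \<tau> f) 1) \<in> chow_ext n"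
  proof (intro ideal_ext_sum)
    fix f assume f: "f \<in> level_choices n \<tau> - level_chains n \<tau>"
    then obtain k l where kl: "k \<in> keys \<tau>" "l \<in> keys \<tau>" "\<not> f k \<subseteq> f l" "\<not> f l \<subseteq> f k"
      by (auto simp: level_chains_def)
    have fch: "f \<in> level_choices n \<tau>" using f by simp
    have faces: "f k \<in> faces n" "f l \<in> faces n" using level_choicesD(1)[OF fch] kl by auto
    define m where "m = chain_mon \<tau> f"
    have "f k \<in> keys m" "f l \<in> keys m"
      using kl by (auto simp: m_def keys_chain_mon[OF fch])
    then have "m = (m - single (f k) 1) + single (f k) 1"
      by (subst single_le_decomp) (auto simp: in_keys_iff)
    moreover have "m - single (f k) 1 = (m - single (f k) 1 - single (f l) 1) + single (f l) 1"
      using kl \<open>f l \<in> keys m\<close>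
      by (subst single_le_decomp) (auto simp: in_keys_iff lookup_minus lookup_single when_def)
    ultimately obtain r where "m = r + single (f l) 1 + single (f k) 1" by metis
    then have "single m 1 = single r 1 * (mvar (f k) * mvar (f l))"
      by (simp add: mvar_def var_mon_def mult_single add_ac)
    moreover have "mvar (f k) * mvar (f l) \<in> chow_ext n"
      using kl faces by (intro incomparable_in_chow)
    ultimately show "single (chain_mon \<tau> f) 1 \<in> chow_ext n"
      unfolding m_def by (simp add: ideal_ext.mult)
  qed
  from ideal_ext.add[OF 1 this[folded 2]] show ?thesis by simp
qed

lemma meval_level_sum:
  assumes "finite A"
  shows "meval (level_sum n) (\<Sum>\<tau>\<in>A. single \<tau> (c \<tau>)) - chain_expansion n c A \<in> chow_ext n"
proof -
  have "(\<Sum>\<tau>\<in>A. of_int (c \<tau>) * (mon_eval (level_sum n) \<tau> - (\<Sum>f\<in>level_chains n \<tau>. single (chain_mon \<tau> f) 1)))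
      \<in> chow_ext n"
    by (intro ideal_ext_sum ideal_ext.mult mon_eval_level_sum)
  also have "(\<Sum>\<tau>\<in>A. of_int (c \<tau>) * (mon_eval (level_sum n) \<tau> - (\<Sum>f\<in>level_chains n \<tau>. single (chain_mon \<tau> f) 1)))
     = meval (level_sum n) (\<Sum>\<tau>\<in>A. single \<tau> (c \<tau>)) - chain_expansion n c A"
    by (simp add: chain_expansion_def right_diff_distrib sum_subtractf sum_distrib_left
        single_eq_of_int_mult[of "chain_mon _ _" "c _"])
  finally show ?thesis .
qed

text \<open>The standard representative of the orbit of chains of type \<open>\<tau>\<close>; the
  coefficient of an orbit sum is read off at its monomial.\<close>

definition initial_chain :: "nat mon \<Rightarrow> nat \<Rightarrow> nat set" where
  "initial_chain \<tau> = (\<lambda>l\<in>keys \<tau>. {1..l})"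

lemma initial_chain_in_level_chains:
  assumes "keys \<tau> \<subseteq> {1..n}"
  shows "initial_chain \<tau> \<in> level_chains n \<tau>"
proof -
  have "initial_chain \<tau> \<in> level_choices n \<tau>"
    unfolding level_choices_def initial_chain_def using assms by (intro PiE_I) (auto simp: faces_def)
  moreover have "initial_chain \<tau> k \<subseteq> initial_chain \<tau> l \<or> initial_chain \<tau> l \<subseteq> initial_chain \<tau> k"
    if "k \<in> keys \<tau>" "l \<in> keys \<tau>" for k l
    using that by (auto simp: initial_chain_def)
  ultimately show ?thesis by (auto simp: level_chains_def)
qed

lemma std_independent_mod_chow:
  assumes "keys q \<subseteq> {\<tau>. std_mon n \<tau>}" "meval (level_sum n) q \<in> chow_ext n"
  shows "q = 0"
proof -
  define r where "r = chain_expansion n (lookup q) (keys q)"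
  have "meval (level_sum n) q - r \<in> chow_ext n"
    using meval_level_sum[of "keys q" n "lookup q"] by (simp add: r_def sum_singles)
  from ideal_ext_diff[OF assms(2) this] have "r \<in> chow_ext n" by simp
  moreover have "keys r \<subseteq> {m. fy_mon n {} m}"
    using assms(1) unfolding r_def by (auto elim!: keys_chain_expansion intro!: fy_chain_mon)
  ultimately have "r = 0" by (rule fy_independent_mod_chow)
  have "\<tau> \<notin> keys q" for \<tau>
  proof
    assume \<tau>: "\<tau> \<in> keys q"
    then have "initial_chain \<tau> \<in> level_chains n \<tau>"
      using assms(1) by (intro initial_chain_in_level_chains) (auto simp: std_mon_def)
    then have "lookup r (chain_mon \<tau> (initial_chain \<tau>)) = lookup q \<tau>"
      using \<tau> by (simp add: r_def lookup_chain_expansion)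
    with \<open>r = 0\<close> \<tau> show False by (simp add: in_keys_iff)
  qed
  then show ?thesis by (auto simp: in_keys_iff intro: poly_mapping_eqI)
qed

section \<open>The relations as a Groebner basis\<close>

abbreviation rel_ext :: "nat \<Rightarrow> nat mpoly set" where
  "rel_ext n \<equiv> ideal_ext {1..n} (rel_polys n)"

definition rel_lead :: "nat \<Rightarrow> nat \<Rightarrow> nat mon" where
  "rel_lead a b = (if a = 0 then 0 else single a 1) + single b (b - a)"

lemma rel_poly_in_mpolys: "a < b \<Longrightarrow> b \<le> n \<Longrightarrow> rel_poly n a b \<in> mpolys {1..n}"
  unfolding rel_poly_def by (auto intro!: mpolys_intros)

lemma rel_polys_subset: "rel_polys n \<subseteq> mpolys {1..n}"
  unfolding rel_polys_def using rel_poly_in_mpolys by blast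

lemma rel_ideal_eq: "rel_ideal n = rel_ext n \<inter> mpolys {1..n}"
  unfolding rel_ideal_def by (rule genideal_mpoly_ring[OF rel_polys_subset])

text \<open>A violated bound, \<open>b - a \<le> lookup m b\<close> with \<open>a\<close> in the
  support or \<open>a = 0\<close>, says that \<open>rel_lead a b\<close> divides
  \<open>m\<close>.\<close>

lemma not_std_mon_decomp:
  assumes "\<not> std_mon n m" "keys m \<subseteq> {1..n}"
  obtains a b k where "a < b" "b \<le> n" "m = k + rel_lead a b"
proof -
  obtain a b where ab: "b \<in> keys m" "a \<in> insert 0 (keys m)" "a < b" "b - a \<le> lookup m b"
    using assms unfolding std_mon_def not_less[symmetric] by blast
  have m: "(m - single b (b - a)) + single b (b - a) = m"
    using ab by (intro single_le_decomp)
  have "b \<le> n" using ab assms(2) by auto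
  show ?thesis
  proof (cases "a = 0")
    case True
    then show ?thesis
      using that[OF ab(3) \<open>b \<le> n\<close>, of "m - single b (b - a)"] m by (simp add: rel_lead_def)
  next
    case False
    then have "(m - single b (b - a) - single a 1) + single a 1 = m - single b (b - a)"
      using ab by (intro single_le_decomp) (auto simp: in_keys_iff lookup_minus lookup_single when_def)
    then show ?thesis
      using that[OF ab(3) \<open>b \<le> n\<close>, of "m - single b (b - a) - single a 1"] m False
      by (simp add: rel_lead_def add.assoc[symmetric])
  qed
qed

text \<open>The strict part of a monomial order is one instance. The comparison of weights is
  another, which makes the reduction to standard monomials available before any monomial order is
  given.\<close>

locale level_order = mon_rel "{1..n}" R for n :: nat and R +
  assumes var_less: "1 \<le> i \<Longrightarrow> i < j \<Longrightarrow> j \<le> n \<Longrightarrow> (single j 1, single i 1) \<in> R"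
    and wf_rel: "wf R"
begin

lemma rel_lead_in_monomials: "a < b \<Longrightarrow> b \<le> n \<Longrightarrow> rel_lead a b \<in> monomials {1..n}"
  unfolding rel_lead_def by (intro monomials_add) (auto simp: monomials_def)

text \<open>In the sum, the summand \<open>i = b\<close> has coefficient 1 and largest variable
  \<open>mvar b\<close>, while the summands with \<open>i > b\<close> involve only smaller
  variables. So the leading coefficient is 1, whatever the other binomial coefficients are.\<close>

lemma keys_rel_poly:
  assumes "a < b" "b \<le> n"
  shows "keys (rel_poly n a b - single (rel_lead a b) 1) \<subseteq> lower (rel_lead a b)"
proof -
  define c where "c i = (i - a - 1) choose (b - a - 1)" for i
  define U where "U i = (\<Sum>k = i..n. mvar k :: nat mpoly)" for i
  define k where "k = b - a"
  have b: "b \<in> {1..n}" using assms by auto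
  have keysU: "keys (\<Sum>k = i..n. mvar k :: nat mpoly) \<subseteq> lower (single b 1)" if "b < i" for i
  proof -
    have "keys (\<Sum>k = i..n. mvar k :: nat mpoly) \<subseteq> (\<Union>k\<in>{i..n}. keys (mvar k :: nat mpoly))"
      by (rule keys_sum)
    also have "\<dots> \<subseteq> lower (single b 1)"
      using var_less[of b] that b by (auto simp: mvar_def var_mon_def lower_def)
    finally show ?thesis .
  qed
  have "U b - mvar b = (\<Sum>k = Suc b..n. mvar k)"
    using b by (simp add: U_def sum.atLeast_Suc_atMost)
  then have 1: "keys (U b ^ k - mvar b ^ k) \<subseteq> lower (single b k)"
    using b keysU[of "Suc b"] by (intro keys_power_diff_lower) auto
  have 2: "keys (of_nat (c i) * U i ^ k) \<subseteq> lower (single b k)" if "b < i" for i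
  proof -
    have "keys (U i ^ k) \<subseteq> lower (single b k)"
      using that b assms keysU by (intro keys_power_lower) (auto simp: k_def U_def)
    then show ?thesis
      using keys_of_int_mult[of "int (c i)" "U i ^ k"] by simp
  qed
  define X where "X = (\<Sum>i = Suc b..n. of_nat (c i) * U i ^ k)"
  have 3: "keys X \<subseteq> lower (single b k)"
    unfolding X_def by (rule subset_trans[OF keys_sum], rule UN_least, rule 2) simp
  have "(\<Sum>i = b..n. of_nat (c i) * U i ^ k) = U b ^ k + X"
    using assms by (simp add: X_def sum.atLeast_Suc_atMost c_def)
  moreover have "(if a = 0 then 1 else mvar a :: nat mpoly) = single (if a = 0 then 0 else single a 1) 1"
    by (simp add: mvar_def var_mon_def)
  ultimately have "rel_poly n a b = single (if a = 0 then 0 else single a 1) 1 * (U b ^ k + X)"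
    unfolding rel_poly_def c_def U_def k_def by simp
  moreover have "single (rel_lead a b) (1 :: int) = single (if a = 0 then 0 else single a 1) 1 * mvar b ^ k"
    by (simp add: rel_lead_def mvar_power mult_single k_def)
  ultimately have "rel_poly n a b - single (rel_lead a b) 1
      = single (if a = 0 then 0 else single a 1) 1 * ((U b ^ k - mvar b ^ k) + X)"
    by (simp add: algebra_simps)
  moreover have "keys ((U b ^ k - mvar b ^ k) + X) \<subseteq> lower (single b k)"
    using 1 3 keys_add[of "U b ^ k - mvar b ^ k" X] by blast
  moreover have "(if a = 0 then 0 else single a 1) \<in> monomials {1..n}"
    using assms by (auto simp: monomials_def)
  moreover have "keys (single t 1 * p) \<subseteq> lower (t + l)"
    if "keys p \<subseteq> lower l" "t \<in> monomials {1..n}" for p :: "nat mpoly" and t l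
    using that by (intro keys_mult_lower') auto
  ultimately show ?thesis
    unfolding rel_lead_def k_def[symmetric] by simp
qed

lemma std_span:
  "\<exists>q. keys q \<subseteq> {k. std_mon n k \<and> (k = m \<or> (k, m) \<in> R)} \<and> single m 1 - q \<in> rel_ext n"
proof (rule reduce_wf[OF wf_rel])
  show "trans R" using trans_rel by (auto simp: trans_def)
  fix m assume m: "\<not> std_mon n m"
  show "\<exists>q. keys q \<subseteq> {k. (k, m) \<in> R} \<and> single m 1 - q \<in> rel_ext n"
  proof (cases "keys m \<subseteq> {1..n}")
    case False
    then obtain v where v: "v \<in> keys m" "v \<notin> {1..n}" by blast
    then have "m = (m - single v 1) + single v 1"
      by (subst single_le_decomp) (auto simp: in_keys_iff)
    then have "single m 1 = single (m - single v 1) 1 * mvar v"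
      unfolding mvar_def var_mon_def mult_single by simp
    then have "single m 1 \<in> rel_ext n"
      using ideal_ext.mult[OF ideal_ext.out[OF v(2)]] by metis
    then show ?thesis by (intro exI[of _ 0]) auto
  next
    case True
    from not_std_mon_decomp[OF m True] obtain a b k where k: "a < b" "b \<le> n" "m = k + rel_lead a b" .
    define q where "q = - (single k 1 * (rel_poly n a b - single (rel_lead a b) 1))"
    have "k \<in> monomials {1..n}" using True k(3) by (simp add: monomials_def keys_add_nat)
    then have "keys (single k 1 * (rel_poly n a b - single (rel_lead a b) 1)) \<subseteq> lower (k + rel_lead a b)"
      using k by (intro keys_mult_lower' keys_rel_poly) auto
    then have "keys q \<subseteq> {k. (k, m) \<in> R}" by (simp add: q_def k(3) lower_def)
    moreover have "single m 1 - q = single k 1 * rel_poly n a b"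
      by (simp add: q_def k(3) algebra_simps mult_single)
    moreover have "rel_poly n a b \<in> rel_ext n"
      using k by (intro ideal_ext.gen) (auto simp: rel_polys_def)
    ultimately show ?thesis by (metis ideal_ext.mult)
  qed
qed

end

lemma level_order_weight:
  "level_order n {(a, b). a \<in> monomials {1..n} \<and> b \<in> monomials {1..n} \<and>
     mon_weight (\<lambda>v. n - v) a < mon_weight (\<lambda>v. n - v) b}"
proof (intro level_order.intro mon_rel_weight level_order_axioms.intro wf_weight)
qed (auto simp: monomials_def)

lemma std_span_poly: "\<exists>q. keys q \<subseteq> {k. std_mon n k} \<and> p - q \<in> rel_ext n"
proof -
  have *: "\<exists>q. keys q \<subseteq> {k. std_mon n k} \<and> single m 1 - q \<in> rel_ext n" for m
    using level_order.std_span[OF level_order_weight, of n m] by (rule ex_forward) auto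
  obtain q where "keys q \<subseteq> (\<Union>k\<in>keys p. {k. std_mon n k})" "p - q \<in> rel_ext n"
    using reduce_sum[of p "\<lambda>_. {k. std_mon n k}", OF *] by auto
  then show ?thesis
    by (intro exI[of _ q]) (auto split: if_splits)
qed

text \<open>This makes the substitution of level sums compatible with the foreign variables in
  \<open>rel_ext n\<close>.\<close>

lemma level_sum_out: "l \<notin> {1..n} \<Longrightarrow> level_sum n l = 0"
proof -
  assume l: "l \<notin> {1..n}"
  have "card S \<in> {1..n}" if "S \<in> faces n" for S
    using card_le_of_face[OF that] that finite_subset[of S "{1..n}"]
    by (auto simp: faces_def Suc_le_eq card_gt_0_iff)
  with l have "{S. S \<in> faces n \<and> card S = l} = {}" by blast
  then show ?thesis by (simp only: level_sum_def sum.empty)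
qed

lemma meval_level_sum_rel_ext: "p \<in> rel_ext n \<Longrightarrow> meval (level_sum n) p \<in> chow_ext n"
proof (induction rule: ideal_ext.induct)
  case (gen g)
  then show ?case by (auto simp: rel_polys_def meval_rel_poly_in_chow)
next
  case (out v)
  then show ?case by (simp add: level_sum_out ideal_ext.zero)
qed (auto intro: ideal_ext.zero ideal_ext.add ideal_ext.mult)

lemma meval_level_sum_in_chow_iff: "meval (level_sum n) p \<in> chow_ext n \<longleftrightarrow> p \<in> rel_ext n"
proof
  assume p: "meval (level_sum n) p \<in> chow_ext n"
  obtain q where q: "keys q \<subseteq> {k. std_mon n k}" "p - q \<in> rel_ext n"
    using std_span_poly by blast
  have "meval (level_sum n) p - meval (level_sum n) (p - q) \<in> chow_ext n"
    using p meval_level_sum_rel_ext[OF q(2)] by (rule ideal_ext_diff)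
  then have "q = 0" using q(1) by (intro std_independent_mod_chow) auto
  with q(2) show "p \<in> rel_ext n" by simp
qed (rule meval_level_sum_rel_ext)

lemma rel_ext_std_eq_0: "q \<in> rel_ext n \<Longrightarrow> keys q \<subseteq> {k. std_mon n k} \<Longrightarrow> q = 0"
  by (intro std_independent_mod_chow meval_level_sum_rel_ext)

lemma ex_max_well_order:
  assumes "well_order_on M r" "finite A" "A \<noteq> {}" "A \<subseteq> M"
  shows "\<exists>m\<in>A. \<forall>k\<in>A. (k, m) \<in> r"
  using assms(2,3,4)
proof (induction A rule: finite_ne_induct)
  case (singleton x)
  then show ?case
    using assms(1) by (auto simp: well_order_on_def linear_order_on_def partial_order_on_def preorder_on_def refl_on_def)
next
  case (insert x A)
  then obtain m where m: "m \<in> A" "\<forall>k\<in>A. (k, m) \<in> r" by auto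
  have r: "refl_on M r" "trans r" "total_on M r"
    using assms(1) by (auto simp: well_order_on_def linear_order_on_def partial_order_on_def preorder_on_def)
  have xm: "x \<in> M" "m \<in> M" using insert.prems m by auto
  show ?case
  proof (cases "(x, m) \<in> r")
    case True
    then show ?thesis using m by auto
  next
    case False
    then have "(m, x) \<in> r"
      using r xm unfolding total_on_def by (metis refl_onD)
    then show ?thesis using m r xm by (auto dest: refl_onD transD)
  qed
qed

lemma rel_polys_groebner:
  assumes ord: "monomial_order {1..n} ord"
    and var: "\<And>i j. 1 \<le> i \<Longrightarrow> i < j \<Longrightarrow> j \<le> n \<Longrightarrow> (var_mon j, var_mon i) \<in> ord \<and> var_mon j \<noteq> var_mon i"
  shows "groebner_basis {1..n} ord (rel_ideal n) (rel_polys n)"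
proof -
  interpret P: cring "mpoly_ring {1..n}" by (rule cring_mpoly_ring)
  have wo: "well_order_on (monomials {1..n}) ord"
    and add: "\<And>a b c. c \<in> monomials {1..n} \<Longrightarrow> (a, b) \<in> ord \<Longrightarrow> (a + c, b + c) \<in> ord"
    using ord by (auto simp: monomial_order_def)
  have ord_dom: "a \<in> monomials {1..n} \<and> b \<in> monomials {1..n}" if "(a, b) \<in> ord" for a b
    using well_order_on_domain[OF wo that] .
  have refl: "refl_on (monomials {1..n}) ord" and tr: "trans ord" and antisym: "antisym ord"
    and wf: "wf (ord - Id)"
    using wo by (auto simp: well_order_on_def linear_order_on_def partial_order_on_def preorder_on_def)
  define R where "R = ord - Id"
  interpret level_order n R
  proof unfold_locales
    show "a \<in> monomials {1..n} \<and> b \<in> monomials {1..n}" if "(a, b) \<in> R" for a b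
      using that ord_dom by (auto simp: R_def)
    show "(a, c) \<in> R" if "(a, b) \<in> R" "(b, c) \<in> R" for a b c
      using that tr antisym unfolding R_def by (auto dest: transD antisymD)
    \<comment> \<open>Strictness survives because exponents cancel.\<close>
    show "(a + c, b + c) \<in> R" if "(a, b) \<in> R" "c \<in> monomials {1..n}" for a b c
      using that add by (auto simp: R_def)
    show "(single j 1, single i 1) \<in> R" if "1 \<le> i" "i < j" "j \<le> n" for i j
      using var[OF that] by (auto simp: R_def var_mon_def)
    show "wf R" using wf by (simp add: R_def)
  qed
  have lower_iff: "k \<in> lower m \<longleftrightarrow> (k, m) \<in> ord \<and> k \<noteq> m" for k m
    unfolding lower_def unfolding R_def by simp
  have lead: "lead_mon ord p = m" if "m \<in> keys p" "\<forall>k\<in>keys p. (k, m) \<in> ord" for p :: "nat mpoly" and m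
    unfolding lead_mon_def using that antisym by (intro the_equality) (auto dest: antisymD)
  have lead_rel: "lead_term ord (rel_poly n a b) = single (rel_lead a b) 1" if ab: "a < b" "b \<le> n" for a b
  proof -
    define q where "q = rel_poly n a b - single (rel_lead a b) 1"
    have p: "rel_poly n a b = q + single (rel_lead a b) 1" by (simp add: q_def)
    have q: "keys q \<subseteq> lower (rel_lead a b)" unfolding q_def using ab by (rule keys_rel_poly)
    then have notin: "rel_lead a b \<notin> keys q" by (auto simp: lower_iff)
    then have coef: "lookup (rel_poly n a b) (rel_lead a b) = 1"
      by (simp add: p in_keys_iff)
    have "(k, rel_lead a b) \<in> ord" if "k \<in> keys (rel_poly n a b)" for k
    proof -
      have "k \<in> keys q \<or> k = rel_lead a b"
        using that keys_add[of q "single (rel_lead a b) 1"] by (auto simp: p)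
      then show ?thesis
        using q refl rel_lead_in_monomials[OF ab] by (auto simp: lower_iff dest: refl_onD)
    qed
    then have "lead_mon ord (rel_poly n a b) = rel_lead a b"
      using coef by (intro lead) (auto simp: in_keys_iff)
    then show ?thesis by (simp add: lead_term_def coef)
  qed
  have sub: "rel_polys n \<subseteq> rel_ideal n"
    unfolding rel_ideal_def using P.genideal_self rel_polys_subset by (simp only: mpoly_ring_simps)
  have LG: "lead_term ord ` rel_polys n \<subseteq> mpolys {1..n}"
    using lead_rel rel_lead_in_monomials by (auto simp: rel_polys_def intro!: mpolys_single)
  have main: "lead_term ord f \<in> mpolys {1..n} \<and>
      lead_term ord f \<in> Idl\<^bsub>mpoly_ring {1..n}\<^esub> (lead_term ord ` rel_polys n)" if f: "f \<in> rel_ideal n" for f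
  proof (cases "f = 0")
    case True
    then have "lead_term ord f = 0" by (simp add: lead_term_def)
    then show ?thesis
      unfolding genideal_mpoly_ring[OF LG] by (metis IntI ideal_ext.zero mpolys_0)
  next
    case False
    have fext: "f \<in> rel_ext n" and fpol: "keys f \<subseteq> monomials {1..n}"
      using f by (auto simp: rel_ideal_eq mpolys_def)
    have "keys f \<noteq> {}" using False by simp
    then obtain m where m: "m \<in> keys f" "\<forall>k\<in>keys f. (k, m) \<in> ord"
      using ex_max_well_order[OF wo _ _ fpol] by auto
    define c where "c = lookup f m"
    have c: "c \<noteq> 0" using m by (simp add: c_def in_keys_iff)
    have lt: "lead_term ord f = single m c"
      using lead[OF m] by (simp add: lead_term_def c_def)
    have mV: "m \<in> monomials {1..n}" using m fpol by auto
    \<comment> \<open>If the leading monomial were standard, reducing the smaller terms would leave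
      it untouched, and \<open>single m c + q\<close> would be a nonzero standard combination in the
      ideal.\<close>
    have "\<not> std_mon n m"
    proof
      assume std: "std_mon n m"
      define g where "g = f - single m c"
      have g: "(k, m) \<in> R" if "k \<in> keys g" for k
      proof -
        have "k \<noteq> m" using that by (auto simp: g_def c_def in_keys_iff lookup_minus)
        moreover from this have "k \<in> keys f" using that by (auto simp: g_def in_keys_iff lookup_minus lookup_single when_def)
        ultimately show ?thesis using m by (simp add: R_def)
      qed
      obtain q where q: "keys q \<subseteq> (\<Union>k\<in>keys g. {l. std_mon n l \<and> (l = k \<or> (l, k) \<in> R)})" "g - q \<in> rel_ext n"
        using reduce_sum[of g "\<lambda>k. {l. std_mon n l \<and> (l = k \<or> (l, k) \<in> R)}", OF std_span] by blast
      have ql: "std_mon n l \<and> (l, m) \<in> R" if "l \<in> keys q" for l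
        using that q(1) g trans_rel by blast
      then have notin: "m \<notin> keys q" by (auto simp: R_def)
      have "f - (g - q) \<in> rel_ext n" using fext q(2) by (rule ideal_ext_diff)
      then have "single m c + q \<in> rel_ext n" by (simp add: g_def)
      moreover have "keys (single m c + q) \<subseteq> {k. std_mon n k}"
        using keys_add[of "single m c" q] ql std by (auto split: if_splits)
      ultimately have "single m c + q = 0" by (rule rel_ext_std_eq_0)
      then have "lookup (single m c + q) m = 0" by simp
      then show False using notin c by (simp add: in_keys_iff)
    qed
    moreover have "keys m \<subseteq> {1..n}" using mV by (simp add: monomials_def)
    ultimately obtain a b k where k: "a < b" "b \<le> n" "m = k + rel_lead a b"
      using not_std_mon_decomp by blast
    \<comment> \<open>The leading coefficient of the relation is 1, so every integer
      \<open>c\<close> is reached.\<close>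
    have "single m c = single k c * lead_term ord (rel_poly n a b)"
      by (simp add: lead_rel[OF k(1,2)] k(3) mult_single)
    moreover have "lead_term ord (rel_poly n a b) \<in> ideal_ext {1..n} (lead_term ord ` rel_polys n)"
      using k by (intro ideal_ext.gen) (auto simp: rel_polys_def)
    ultimately have "single m c \<in> ideal_ext {1..n} (lead_term ord ` rel_polys n)"
      by (simp add: ideal_ext.mult)
    moreover have "single m c \<in> mpolys {1..n}" using mV by (rule mpolys_single)
    ultimately show ?thesis
      unfolding lt genideal_mpoly_ring[OF LG] by blast
  qed
  have "rel_polys n = (\<lambda>(a, b). rel_poly n a b) ` {(a, b). a < b \<and> b \<le> n}"
    by (auto simp: rel_polys_def)
  moreover have "finite {(a, b :: nat). a < b \<and> b \<le> n}"
    by (rule finite_subset[of _ "{..n} \<times> {..n}"]) auto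
  ultimately have "finite (rel_polys n)" by simp
  moreover have "Idl\<^bsub>mpoly_ring {1..n}\<^esub> (lead_term ord ` rel_polys n) = Idl\<^bsub>mpoly_ring {1..n}\<^esub> (lead_term ord ` rel_ideal n)"
  proof (rule subset_antisym)
    have LI: "lead_term ord ` rel_ideal n \<subseteq> carrier (mpoly_ring {1..n})" using main by auto
    then show "Idl\<^bsub>mpoly_ring {1..n}\<^esub> (lead_term ord ` rel_polys n) \<subseteq> Idl\<^bsub>mpoly_ring {1..n}\<^esub> (lead_term ord ` rel_ideal n)"
      using subset_trans[OF image_mono[OF sub] P.genideal_self[OF LI]]
      by (intro P.genideal_minimal P.genideal_ideal)
    show "Idl\<^bsub>mpoly_ring {1..n}\<^esub> (lead_term ord ` rel_ideal n) \<subseteq> Idl\<^bsub>mpoly_ring {1..n}\<^esub> (lead_term ord ` rel_polys n)"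
      using main LG by (intro P.genideal_minimal P.genideal_ideal) auto
  qed
  ultimately show ?thesis
    using sub by (simp add: groebner_basis_def)
qed

section \<open>The action of the symmetric group\<close>

definition mon_image :: "(nat \<Rightarrow> nat) \<Rightarrow> nat set mon \<Rightarrow> nat set mon" where
  "mon_image \<sigma> m = (\<Sum>S\<in>keys m. single (\<sigma> ` S) (lookup m S))"

lemma mon_eval_image: "mon_eval (\<lambda>S. mvar (\<sigma> ` S)) m = single (mon_image \<sigma> m) 1"
proof -
  have "mon_eval (\<lambda>S. mvar (\<sigma> ` S)) m = (\<Prod>S\<in>keys m. mon_eval mvar (single (\<sigma> ` S) (lookup m S)))"
    by (simp add: mon_eval_def[of "\<lambda>S. mvar (\<sigma> ` S)"])
  also have "\<dots> = mon_eval mvar (mon_image \<sigma> m)"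
    by (simp only: mon_image_def mon_eval_sum)
  finally show ?thesis by (simp only: mon_eval_mvar)
qed

lemma lookup_mon_image:
  assumes "inj \<sigma>"
  shows "lookup (mon_image \<sigma> m) (\<sigma> ` S) = lookup m S"
proof -
  have "lookup (mon_image \<sigma> m) (\<sigma> ` S) = (\<Sum>T\<in>keys m. if T = S then lookup m S else 0)"
    unfolding mon_image_def lookup_sum
    using assms by (intro sum.cong) (auto simp: lookup_single when_def inj_image_eq_iff)
  then show ?thesis by (simp add: sum.delta' in_keys_iff)
qed

lemma inj_mon_image: "inj \<sigma> \<Longrightarrow> inj (mon_image \<sigma>)"
  by (rule injI, rule poly_mapping_eqI) (metis lookup_mon_image)

lemma perm_act_eq: "perm_act \<sigma> p = (\<Sum>m\<in>keys p. single (mon_image \<sigma> m) (lookup p m))"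
  by (simp add: perm_act_def mpoly_subst_eq_meval meval_def mon_eval_image single_eq_of_int_mult[of _ "lookup p _"])

lemma lookup_perm_act:
  assumes "inj \<sigma>"
  shows "lookup (perm_act \<sigma> p) (mon_image \<sigma> m) = lookup p m"
proof -
  have "lookup (perm_act \<sigma> p) (mon_image \<sigma> m) = (\<Sum>k\<in>keys p. if k = m then lookup p m else 0)"
    unfolding perm_act_eq lookup_sum using inj_mon_image[OF assms]
    by (intro sum.cong) (auto simp: lookup_single when_def inj_eq)
  then show ?thesis by (simp add: sum.delta' in_keys_iff)
qed

lemma perm_act_meval: "perm_act \<sigma> = meval (\<lambda>S. mvar (\<sigma> ` S))"
  by (simp add: perm_act_def mpoly_subst_eq_meval)

lemma perm_act_inverse:
  assumes "\<sigma> permutes A"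
  shows "perm_act \<sigma> (perm_act (inv_into UNIV \<sigma>) p) = p"
  using permutes_surj[OF assms] by (simp add: perm_act_meval meval_compose image_comp surj_iff)

lemma permutes_image_faces:
  assumes "\<sigma> permutes {1..n}"
  shows "\<sigma> ` S \<in> faces n \<longleftrightarrow> S \<in> faces n"
proof -
  have "\<sigma> ` S \<subseteq> \<sigma> ` {1..n} \<longleftrightarrow> S \<subseteq> {1..n}"
    using permutes_inj[OF assms] by (rule inj_image_subset_iff)
  then show ?thesis using permutes_image[OF assms] by (simp add: faces_def)
qed

lemma perm_act_face_sum:
  assumes \<sigma>: "\<sigma> permutes {1..n}"
    and P: "\<And>S. S \<in> faces n \<Longrightarrow> Q (\<sigma> ` S) \<longleftrightarrow> P S"
  shows "perm_act \<sigma> (\<Sum>S | S \<in> faces n \<and> P S. mvar S) = (\<Sum>S | S \<in> faces n \<and> Q S. mvar S)"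
proof -
  have "bij_betw ((`) \<sigma>) {S. S \<in> faces n \<and> P S} {S. S \<in> faces n \<and> Q S}"
  proof (rule bij_betw_imageI)
    show "inj_on ((`) \<sigma>) {S. S \<in> faces n \<and> P S}"
      using permutes_inj[OF \<sigma>] by (intro inj_onI) (simp add: inj_image_eq_iff)
    have "S \<in> (`) \<sigma> ` {S. S \<in> faces n \<and> P S}" if "S \<in> faces n" "Q S" for S
    proof -
      have S: "S = \<sigma> ` (inv_into UNIV \<sigma> ` S)"
        using permutes_surj[OF \<sigma>] by (simp add: image_comp surj_iff)
      then have "inv_into UNIV \<sigma> ` S \<in> faces n"
        using permutes_image_faces[OF \<sigma>, of "inv_into UNIV \<sigma> ` S"] that by simp
      then show ?thesis using S P[of "inv_into UNIV \<sigma> ` S"] that by auto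
    qed
    then show "(`) \<sigma> ` {S. S \<in> faces n \<and> P S} = {S. S \<in> faces n \<and> Q S}"
      using P permutes_image_faces[OF \<sigma>] by auto
  qed
  from sum.reindex_bij_betw[OF this, of mvar]
  show ?thesis by (simp add: perm_act_meval)
qed

lemma perm_act_chow_ext:
  assumes \<sigma>: "\<sigma> permutes {1..n}" and p: "p \<in> chow_ext n"
  shows "perm_act \<sigma> p \<in> chow_ext n"
  using p
proof induction
  case (gen g)
  then consider S T where "S \<in> faces n" "T \<in> faces n" "\<not> S \<subseteq> T" "\<not> T \<subseteq> S" "g = mvar S * mvar T"
    | e where "e \<in> {1..n}" "g = (\<Sum>S | S \<in> faces n \<and> e \<in> S. mvar S)"
    unfolding chow_gens_def by blast
  then show ?case
  proof cases
    case 1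
    then show ?thesis
      using permutes_image_faces[OF \<sigma>] inj_image_subset_iff[OF permutes_inj[OF \<sigma>]]
      by (simp add: perm_act_meval incomparable_in_chow)
  next
    case 2
    have "perm_act \<sigma> g = (\<Sum>S | S \<in> faces n \<and> \<sigma> e \<in> S. mvar S)"
      unfolding 2 using \<sigma> permutes_inj[OF \<sigma>] by (intro perm_act_face_sum) (auto simp: inj_image_mem_iff)
    moreover have "\<sigma> e \<in> {1..n}" using permutes_in_image[OF \<sigma>] 2 by blast
    ultimately show ?thesis
      using upper_sum_singleton_in_chow[of "\<sigma> e" n] by (simp add: upper_sum_def)
  qed
next
  case (out v)
  then show ?case
    using permutes_image_faces[OF \<sigma>, of v] by (simp add: perm_act_meval ideal_ext.out)
qed (auto simp: perm_act_meval intro: ideal_ext.zero ideal_ext.add ideal_ext.mult)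

lemma perm_act_mpolys:
  "\<sigma> permutes {1..n} \<Longrightarrow> p \<in> mpolys (faces n) \<Longrightarrow> perm_act \<sigma> p \<in> mpolys (faces n)"
  unfolding perm_act_meval by (rule mpolys_meval) (auto simp: permutes_image_faces intro: mpolys_mvar)

lemma perm_act_level_sum:
  assumes "\<sigma> permutes {1..n}"
  shows "perm_act \<sigma> (level_sum n l) = level_sum n l"
  unfolding level_sum_def using assms permutes_inj[OF assms]
  by (intro perm_act_face_sum) (auto simp: card_image inj_on_subset)

lemma perm_act_meval_level_sum:
  "\<sigma> permutes {1..n} \<Longrightarrow> perm_act \<sigma> (meval (level_sum n) p) = meval (level_sum n) p"
  using perm_act_level_sum by (simp add: perm_act_meval meval_compose)

lemma mon_image_chain_mon: "mon_image \<sigma> (chain_mon \<tau> f) = chain_mon \<tau> (\<lambda>l\<in>keys \<tau>. \<sigma> ` f l)"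
proof -
  have "single (mon_image \<sigma> (chain_mon \<tau> f)) (1 :: int) = mon_eval (\<lambda>S. mvar (\<sigma> ` S)) (chain_mon \<tau> f)"
    by (simp add: mon_eval_image)
  also have "\<dots> = (\<Prod>l\<in>keys \<tau>. mon_eval mvar (single (\<sigma> ` f l) (lookup \<tau> l)))"
    by (simp add: chain_mon_def mon_eval_sum)
  also have "\<dots> = mon_eval mvar (\<Sum>l\<in>keys \<tau>. single (\<sigma> ` f l) (lookup \<tau> l))"
    by (simp only: mon_eval_sum)
  also have "(\<Sum>l\<in>keys \<tau>. single (\<sigma> ` f l) (lookup \<tau> l)) = chain_mon \<tau> (\<lambda>l\<in>keys \<tau>. \<sigma> ` f l)"
    by (simp add: chain_mon_def)
  finally have "keys (single (mon_image \<sigma> (chain_mon \<tau> f)) (1 :: int))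
      = keys (single (chain_mon \<tau> (\<lambda>l\<in>keys \<tau>. \<sigma> ` f l)) (1 :: int))"
    by (simp only: mon_eval_mvar)
  then show ?thesis by simp
qed

lemma permute_level_chain:
  assumes \<sigma>: "\<sigma> permutes {1..n}" and f: "f \<in> level_chains n \<tau>"
  shows "(\<lambda>l\<in>keys \<tau>. \<sigma> ` f l) \<in> level_chains n \<tau>"
proof -
  note fc = level_chains_choices[OF f]
  have "\<sigma> ` f l \<in> faces n \<and> card (\<sigma> ` f l) = l" if "l \<in> keys \<tau>" for l
    using level_choicesD[OF fc that] permutes_image_faces[OF \<sigma>] card_image[OF inj_on_subset[OF permutes_inj[OF \<sigma>]]]
    by simp
  then have "(\<lambda>l\<in>keys \<tau>. \<sigma> ` f l) \<in> level_choices n \<tau>"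
    unfolding level_choices_def by (intro PiE_I) auto
  moreover have "\<sigma> ` f k \<subseteq> \<sigma> ` f l \<or> \<sigma> ` f l \<subseteq> \<sigma> ` f k" if "k \<in> keys \<tau>" "l \<in> keys \<tau>" for k l
  proof -
    have "f k \<subseteq> f l \<or> f l \<subseteq> f k" using f that by (simp add: level_chains_def)
    then show ?thesis by (metis image_mono)
  qed
  ultimately show ?thesis by (simp add: level_chains_def)
qed

lemma fy_mon_image:
  assumes "\<sigma> permutes {1..n}" "fy_mon n {} m"
  shows "fy_mon n {} (mon_image \<sigma> m)"
proof -
  from assms(2) obtain \<tau> f where "std_mon n \<tau>" "f \<in> level_chains n \<tau>" "m = chain_mon \<tau> f"
    by (rule fy_mon_as_chain_mon)
  then show ?thesis
    using permute_level_chain[OF assms(1)] by (simp add: mon_image_chain_mon fy_chain_mon)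
qed

text \<open>A permutation through the chain carries initial segments to its members. This
  transitivity on the chains of a given type lets the coefficient at the standard chain decide all
  coefficients in the orbit.\<close>

lemma level_chain_as_image:
  assumes "f \<in> level_chains n \<tau>" "keys \<tau> \<subseteq> {1..n}"
  obtains w where "w permutes {1..n}" "f = (\<lambda>l\<in>keys \<tau>. w ` initial_chain \<tau> l)"
proof -
  note f = level_chains_choices[OF assms(1)]
  have "f ` keys \<tau> \<subseteq> Pow {1..n}" using level_choicesD(1)[OF f] by (auto simp: faces_def)
  moreover have "S \<subseteq> T \<or> T \<subseteq> S" if "S \<in> f ` keys \<tau>" "T \<in> f ` keys \<tau>" for S T
    using that assms(1) by (auto simp: level_chains_def)
  ultimately obtain w where w: "w permutes {1..n}" "\<forall>T\<in>f ` keys \<tau>. w ` {1..card T} = T"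
    using permutes_through_chain[of "f ` keys \<tau>" n] by blast
  have "f = (\<lambda>l\<in>keys \<tau>. w ` initial_chain \<tau> l)"
  proof
    fix l show "f l = (\<lambda>l\<in>keys \<tau>. w ` initial_chain \<tau> l) l"
    proof (cases "l \<in> keys \<tau>")
      case True
      then have "w ` {1..card (f l)} = f l" using w(2) by blast
      then show ?thesis using True level_choicesD(2)[OF f True] by (simp add: initial_chain_def)
    next
      case False
      then show ?thesis using f by (auto simp: level_choices_def PiE_def extensional_def)
    qed
  qed
  with w(1) show ?thesis by (rule that)
qed

text \<open>By linear independence an invariant combination of Feichtner--Yuzvinsky monomials has constant
  coefficients along the orbits, and the orbit sums are the images of the standard monomials.\<close>

lemma invariant_mod_chow:
  assumes inv: "\<And>\<sigma>. \<sigma> permutes {1..n} \<Longrightarrow> perm_act \<sigma> p - p \<in> chow_ext n"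
  shows "\<exists>q\<in>mpolys {1..n}. p - meval (level_sum n) q \<in> chow_ext n"
proof -
  obtain q where q: "keys q \<subseteq> {k. fy_mon n {} k}" "p - q \<in> chow_ext n"
    using fy_span by blast
  \<comment> \<open>Both \<open>perm_act \<sigma> q\<close> and \<open>q\<close> are
    Feichtner-Yuzvinsky representatives of one class, so they agree as polynomials.\<close>
  have q_inv: "perm_act \<sigma> q = q" if \<sigma>: "\<sigma> permutes {1..n}" for \<sigma>
  proof -
    have "(perm_act \<sigma> p - p) - perm_act \<sigma> (p - q) + (p - q) \<in> chow_ext n"
      using inv[OF \<sigma>] perm_act_chow_ext[OF \<sigma> q(2)] q(2)
      by (rule ideal_ext.add[OF ideal_ext_diff])
    then have "perm_act \<sigma> q - q \<in> chow_ext n"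
      by (simp add: perm_act_meval)
    moreover have "keys (perm_act \<sigma> q) \<subseteq> {k. fy_mon n {} k}"
    proof -
      have "keys (perm_act \<sigma> q) \<subseteq> (\<Union>m\<in>keys q. keys (single (mon_image \<sigma> m) (lookup q m)))"
        unfolding perm_act_eq by (rule keys_sum)
      then show ?thesis using q(1) fy_mon_image[OF \<sigma>] by (auto split: if_splits)
    qed
    then have "keys (perm_act \<sigma> q - q) \<subseteq> {k. fy_mon n {} k}"
      using q(1) keys_diff[of "perm_act \<sigma> q" q] by blast
    ultimately have "perm_act \<sigma> q - q = 0" by (rule fy_independent_mod_chow)
    then show ?thesis by simp
  qed
  define c where "c \<tau> = lookup q (chain_mon \<tau> (initial_chain \<tau>))" for \<tau>
  have coef: "lookup q (chain_mon \<tau> f) = c \<tau>" if f: "f \<in> level_chains n \<tau>" "keys \<tau> \<subseteq> {1..n}" for \<tau> f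
  proof -
    obtain w where w: "w permutes {1..n}" "f = (\<lambda>l\<in>keys \<tau>. w ` initial_chain \<tau> l)"
      using level_chain_as_image[OF f] .
    have "c \<tau> = lookup (perm_act w q) (mon_image w (chain_mon \<tau> (initial_chain \<tau>)))"
      using lookup_perm_act[OF permutes_inj[OF w(1)]] by (simp add: c_def)
    also have "\<dots> = lookup q (chain_mon \<tau> f)"
      by (simp only: q_inv[OF w(1)] mon_image_chain_mon w(2))
    finally show ?thesis by simp
  qed
  define A where "A = {\<tau>. std_mon n \<tau> \<and> c \<tau> \<noteq> 0}"
  have A_keys: "keys \<tau> \<subseteq> {1..n}" if "\<tau> \<in> A" for \<tau>
    using that by (simp add: A_def std_mon_def)
  \<comment> \<open>Distinct types have distinct standard monomials, and these lie in the finite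
    support of \<open>q\<close>.\<close>
  have "inj_on (\<lambda>\<tau>. chain_mon \<tau> (initial_chain \<tau>)) A"
    by (rule inj_onI) (use chain_mon_inject initial_chain_in_level_chains level_chains_choices A_keys in blast)
  moreover have "(\<lambda>\<tau>. chain_mon \<tau> (initial_chain \<tau>)) ` A \<subseteq> keys q"
    by (auto simp: A_def c_def in_keys_iff)
  ultimately have finA: "finite A"
    by (metis finite_imageD finite_keys finite_subset)
  have "q = chain_expansion n c A"
  proof (rule poly_mapping_eqI)
    fix m show "lookup q m = lookup (chain_expansion n c A) m"
    proof (cases "fy_mon n {} m")
      case True
      then obtain \<tau> f where \<tau>: "std_mon n \<tau>" "f \<in> level_chains n \<tau>" "m = chain_mon \<tau> f"
        by (rule fy_mon_as_chain_mon)
      then have "lookup q m = c \<tau>" using coef by (simp add: std_mon_def)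
      then show ?thesis
        using \<tau> finA by (simp add: lookup_chain_expansion A_def)
    next
      case False
      then have "m \<notin> keys (chain_expansion n c A)"
        by (auto elim!: keys_chain_expansion simp: A_def fy_chain_mon)
      moreover have "m \<notin> keys q" using False q(1) by auto
      ultimately show ?thesis by (simp add: in_keys_iff)
    qed
  qed
  then have "(p - q) - (meval (level_sum n) (\<Sum>\<tau>\<in>A. single \<tau> (c \<tau>)) - q) \<in> chow_ext n"
    using ideal_ext_diff[OF q(2) meval_level_sum[OF finA, of n c]] by simp
  moreover have "(\<Sum>\<tau>\<in>A. single \<tau> (c \<tau>)) \<in> mpolys {1..n}"
    using A_keys by (intro mpolys_sum mpolys_single) (auto simp: monomials_def)
  ultimately show ?thesis by (intro bexI[of _ "\<Sum>\<tau>\<in>A. single \<tau> (c \<tau>)"]) simp_all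
qed

section \<open>The rank-nullity ring of a uniform matroid\<close>

lemma ideal_chow_ideal: "ideal (chow_ideal n) (mpoly_ring (faces n))"
  unfolding chow_ideal_eq by (rule ideal_ideal_ext)

lemma chow_class_eq_iff:
  assumes "p \<in> mpolys (faces n)" "q \<in> mpolys (faces n)"
  shows "chow_class n p = chow_class n q \<longleftrightarrow> p - q \<in> chow_ext n"
proof -
  interpret ring "mpoly_ring (faces n)" using cring_mpoly_ring by (rule cring.axioms)
  show ?thesis
    using quotient_eq_iff_same_a_r_cos[OF ideal_chow_ideal, of p q] assms
    by (simp add: mpoly_ring_minus chow_class_def chow_ideal_eq mpolys_diff)
qed

lemma carrier_chow_ring: "carrier (chow_ring n) = chow_class n ` mpolys (faces n)"
  by (auto simp: chow_ring_def FactRing_def A_RCOSETS_def' chow_class_def)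

lemma chow_class_ring_hom: "chow_class n \<in> ring_hom (mpoly_ring (faces n)) (chow_ring n)"
  using ideal.rcos_ring_hom[OF ideal_chow_ideal] by (simp add: chow_class_def[abs_def] chow_ring_def)

lemma chow_class_eq_image: "chow_class n p = (\<lambda>a. a + p) ` chow_ideal n"
  by (auto simp: chow_class_def a_r_coset_def')

lemma perm_act_chow_ideal:
  assumes \<sigma>: "\<sigma> permutes {1..n}"
  shows "perm_act \<sigma> ` chow_ideal n = chow_ideal n"
proof -
  have sub: "perm_act \<pi> ` chow_ideal n \<subseteq> chow_ideal n" if "\<pi> permutes {1..n}" for \<pi>
    using that by (auto simp: chow_ideal_eq perm_act_chow_ext perm_act_mpolys)
  have "p \<in> perm_act \<sigma> ` chow_ideal n" if "p \<in> chow_ideal n" for p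
    using that sub[OF permutes_inv[OF \<sigma>]] perm_act_inverse[OF \<sigma>, of p] by (metis image_eqI image_subset_iff)
  with sub[OF \<sigma>] show ?thesis by blast
qed

lemma perm_act_chow_class:
  assumes "\<sigma> permutes {1..n}"
  shows "perm_act \<sigma> ` chow_class n p = chow_class n (perm_act \<sigma> p)"
proof -
  have "perm_act \<sigma> ` chow_class n p = (\<lambda>a. a + perm_act \<sigma> p) ` perm_act \<sigma> ` chow_ideal n"
    by (simp add: chow_class_eq_image image_image perm_act_meval)
  then show ?thesis by (simp add: perm_act_chow_ideal[OF assms] chow_class_eq_image)
qed

definition level_hom :: "nat \<Rightarrow> nat mpoly \<Rightarrow> nat set mpoly set" where
  "level_hom n p = chow_class n (meval (level_sum n) p)"

lemma level_sum_in_mpolys: "level_sum n l \<in> mpolys (faces n)"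
  unfolding level_sum_def by (auto intro!: mpolys_intros)

lemma meval_level_sum_in_mpolys: "p \<in> mpolys {1..n} \<Longrightarrow> meval (level_sum n) p \<in> mpolys (faces n)"
  by (rule mpolys_meval) (auto intro: level_sum_in_mpolys)

lemma level_hom_ring_hom: "level_hom n \<in> ring_hom (mpoly_ring {1..n}) (chow_ring n)"
proof -
  have "meval (level_sum n) \<in> ring_hom (mpoly_ring {1..n}) (mpoly_ring (faces n))"
    by (rule ring_hom_memI) (auto intro: meval_level_sum_in_mpolys)
  from ring_hom_trans[OF this chow_class_ring_hom]
  show ?thesis by (simp add: level_hom_def[abs_def] comp_def)
qed

lemma ring_chow_ring: "ring (chow_ring n)"
  unfolding chow_ring_def by (rule ideal.quotient_is_ring[OF ideal_chow_ideal])

lemma level_hom_ring_hom_ring: "ring_hom_ring (mpoly_ring {1..n}) (chow_ring n) (level_hom n)"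
  using cring.axioms(1)[OF cring_mpoly_ring] ring_chow_ring level_hom_ring_hom by (rule ring_hom_ringI2)

lemma level_hom_kernel: "a_kernel (mpoly_ring {1..n}) (chow_ring n) (level_hom n) = rel_ideal n"
proof -
  have "\<zero>\<^bsub>chow_ring n\<^esub> = chow_class n 0"
    by (simp add: chow_class_eq_image chow_ring_def FactRing_def)
  then have "level_hom n p = \<zero>\<^bsub>chow_ring n\<^esub> \<longleftrightarrow> p \<in> rel_ext n" if "p \<in> mpolys {1..n}" for p
    using that chow_class_eq_iff[OF meval_level_sum_in_mpolys[OF that] mpolys_0]
    by (simp add: level_hom_def meval_level_sum_in_chow_iff)
  then show ?thesis
    by (auto simp: a_kernel_def' rel_ideal_eq simp del: One_nat_def)
qed

lemma level_hom_image_invariants: "level_hom n ` mpolys {1..n} = chow_invariants n"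
proof (rule subset_antisym)
  show "level_hom n ` mpolys {1..n} \<subseteq> chow_invariants n"
  proof (intro image_subsetI)
    fix p assume "p \<in> mpolys {1..n}"
    then have "level_hom n p \<in> carrier (chow_ring n)"
      unfolding level_hom_def carrier_chow_ring by (intro imageI meval_level_sum_in_mpolys)
    moreover have "perm_act \<sigma> ` level_hom n p = level_hom n p" if "\<sigma> permutes {1..n}" for \<sigma>
      unfolding level_hom_def perm_act_chow_class[OF that] perm_act_meval_level_sum[OF that] ..
    ultimately show "level_hom n p \<in> chow_invariants n"
      by (simp add: chow_invariants_def)
  qed
  show "chow_invariants n \<subseteq> level_hom n ` mpolys {1..n}"
  proof
    fix C assume C: "C \<in> chow_invariants n"
    then obtain p where p: "p \<in> mpolys (faces n)" "C = chow_class n p"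
      by (auto simp: chow_invariants_def carrier_chow_ring)
    have "perm_act \<sigma> p - p \<in> chow_ext n" if \<sigma>: "\<sigma> permutes {1..n}" for \<sigma>
      using C \<sigma> p perm_act_chow_class[OF \<sigma>, of p] chow_class_eq_iff[OF perm_act_mpolys[OF \<sigma> p(1)] p(1)]
      by (simp add: chow_invariants_def)
    then obtain q where q: "q \<in> mpolys {1..n}" "p - meval (level_sum n) q \<in> chow_ext n"
      using invariant_mod_chow by blast
    then have "C = level_hom n q"
      using chow_class_eq_iff[OF p(1) meval_level_sum_in_mpolys[OF q(1)]] by (simp add: p(2) level_hom_def)
    with q(1) show "C \<in> level_hom n ` mpolys {1..n}" by blast
  qed
qed

text \<open>The cases match the closure properties of a subring, for use with the generated ring.
  Zero arises as \<open>1 + (- 1)\<close>, and with it all integer coefficients.\<close>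

lemma mpolys_induct [consumes 1, case_names one uminus add mult mvar]:
  assumes p: "p \<in> mpolys V" and one: "P 1" and uminus: "\<And>p. P p \<Longrightarrow> P (- p)"
    and add: "\<And>p q. P p \<Longrightarrow> P q \<Longrightarrow> P (p + q)" and mult: "\<And>p q. P p \<Longrightarrow> P q \<Longrightarrow> P (p * q)"
    and mvar: "\<And>v. v \<in> V \<Longrightarrow> P (mvar v)"
  shows "P p"
proof -
  have zero: "P 0" using add[OF one uminus[OF one]] by simp
  have nat: "P (of_nat k)" for k by (induction k) (auto intro: zero one add)
  have int: "P (of_int k)" for k by (cases k) (auto simp del: of_nat_Suc intro: nat uminus)
  have power: "P (q ^ k)" if "P q" for q k by (induction k) (auto intro: one mult that)
  have prod: "P (\<Prod>i\<in>A. g i)" if "\<And>i. i \<in> A \<Longrightarrow> P (g i)" for g :: "'a \<Rightarrow> 'a mpoly" and A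
    using that by (induction A rule: infinite_finite_induct) (auto intro: one mult)
  have sum: "P (\<Sum>i\<in>A. g i)" if "\<And>i. i \<in> A \<Longrightarrow> P (g i)" for g :: "'a mon \<Rightarrow> 'a mpoly" and A
    using that by (induction A rule: infinite_finite_induct) (auto intro: zero add)
  have "P (meval mvar p)"
    unfolding meval_def mon_eval_def
  proof (intro sum mult int prod power mvar)
    fix m v assume "m \<in> keys p" "v \<in> keys m"
    then show "v \<in> V" using p by (auto simp: mpolys_def monomials_def)
  qed
  then show ?thesis by simp
qed

section \<open>Rank and nullity in the uniform matroid\<close>

lemma matroid_rank_uniform:
  assumes "S \<subseteq> {1..n}"
  shows "matroid_rank (uniform_indep r n) S = min r (card S)"
proof -
  have fin: "finite S" using assms finite_subset by blast
  have "{card I | I. I \<subseteq> S \<and> uniform_indep r n I} = {..min r (card S)}"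
  proof (rule subset_antisym; rule subsetI)
    fix k assume "k \<in> {card I | I. I \<subseteq> S \<and> uniform_indep r n I}"
    then show "k \<in> {..min r (card S)}"
      using fin by (auto simp: uniform_indep_def intro: card_mono)
  next
    fix k assume k: "k \<in> {..min r (card S)}"
    then obtain I where "I \<subseteq> S" "card I = k"
      using obtain_subset_with_card_n[of k S] by auto
    then show "k \<in> {card I | I. I \<subseteq> S \<and> uniform_indep r n I}"
      using k assms by (auto simp: uniform_indep_def)
  qed
  moreover have "Max {..min r (card S)} = min r (card S)"
    by (rule Max_eqI) auto
  ultimately show ?thesis by (simp add: matroid_rank_def)
qed

text \<open>Rank and nullity add up to the size, and the size determines the rank. So each class is
  the level sum for \<open>i + j\<close>, or 0 if no nonempty set has this rank and nullity.\<close>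

lemma rank_nullity_class_uniform:
  "rank_nullity_class n (uniform_indep r n) i j = level_hom n (if i = min r (i + j) \<and> i + j \<in> {1..n} then mvar (i + j) else 0)"
proof -
  have iff: "matroid_rank (uniform_indep r n) S = i \<and> nullity (uniform_indep r n) S = j \<longleftrightarrow>
      i = min r (i + j) \<and> card S = i + j" if "S \<in> faces n" for S
    using that matroid_rank_uniform[of S n r] by (auto simp: faces_def nullity_def)
  have "(\<Sum>S | S \<in> faces n \<and> matroid_rank (uniform_indep r n) S = i \<and> nullity (uniform_indep r n) S = j. mvar S)
      = (\<Sum>S | S \<in> faces n \<and> i = min r (i + j) \<and> card S = i + j. mvar S)"
    using iff by (intro sum.cong Collect_cong) auto
  also have "\<dots> = (if i = min r (i + j) then level_sum n (i + j) else 0)"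
    by (auto simp: level_sum_def)
  finally show ?thesis
    unfolding rank_nullity_class_def level_hom_def using level_sum_out[of "i + j" n] by auto
qed

lemma rank_nullity_generated:
  "generate_ring (chow_ring n) {rank_nullity_class n (uniform_indep r n) i j | i j. True} = level_hom n ` mpolys {1..n}"
    (is "generate_ring _ ?Y = _")
proof -
  interpret ring "chow_ring n" by (rule ring_chow_ring)
  interpret h: ring_hom_ring "mpoly_ring {1..n}" "chow_ring n" "level_hom n"
    by (rule level_hom_ring_hom_ring)
  have Y: "?Y \<subseteq> level_hom n ` mpolys {1..n}"
  proof clarify
    fix i j
    have "(if i = min r (i + j) \<and> i + j \<in> {1..n} then mvar (i + j) else 0) \<in> mpolys {1..n}"
      by (auto simp del: One_nat_def intro: mpolys_mvar mpolys_0)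
    then show "rank_nullity_class n (uniform_indep r n) i j \<in> level_hom n ` mpolys {1..n}"
      unfolding rank_nullity_class_uniform by (rule imageI)
  qed
  have sub: "subring (level_hom n ` mpolys {1..n}) (chow_ring n)"
    using h.img_is_subring[OF h.R.carrier_is_subring] by (simp del: One_nat_def)
  have Yc: "?Y \<subseteq> carrier (chow_ring n)"
    using Y subringE(1)[OF sub] by blast
  note Q = generate_ring_is_subring[OF Yc]
  have "p \<in> mpolys {1..n} \<and> level_hom n p \<in> generate_ring (chow_ring n) ?Y" if "p \<in> mpolys {1..n}" for p
    using that
  proof (induction rule: mpolys_induct)
    case one
    show ?case using h.hom_one subringE(3)[OF Q] mpolys_1 by simp
  next
    case (uminus p)
    have "\<ominus>\<^bsub>mpoly_ring {1..n}\<^esub> p = - p"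
      using uminus by (intro h.R.minus_equality) (auto intro: mpolys_uminus)
    then have "level_hom n (- p) = \<ominus>\<^bsub>chow_ring n\<^esub> level_hom n p"
      using h.hom_a_inv[of p] uminus by simp
    then show ?case using uminus subringE(5)[OF Q] mpolys_uminus[of p "{1..n}"] by simp
  next
    case (add p q)
    then show ?case using h.hom_add[of p q] subringE(7)[OF Q] mpolys_add[of p "{1..n}" q] by simp
  next
    case (mult p q)
    then show ?case using h.hom_mult[of p q] subringE(6)[OF Q] mpolys_mult[of p "{1..n}" q] by simp
  next
    case (mvar l)
    \<comment> \<open>The numbers \<open>min l r\<close> and \<open>l - min l r\<close> are the rank
      and the nullity of the sets of size \<open>l\<close>.\<close>
    have "level_hom n (mvar l) = rank_nullity_class n (uniform_indep r n) (min l r) (l - min l r)"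
      using mvar by (simp add: rank_nullity_class_uniform)
    then have "level_hom n (mvar l) \<in> generate_ring (chow_ring n) ?Y"
      by (intro generate_ring.incl) blast
    with mpolys_mvar[OF mvar] show ?case by (rule conjI)
  qed
  then have "level_hom n ` mpolys {1..n} \<subseteq> generate_ring (chow_ring n) ?Y"
    by (intro image_subsetI) simp
  with generate_ring_min_subring1[OF Yc sub Y] show ?thesis
    by (rule subset_antisym)
qed

theorem theorem3p13:
  fixes r n :: nat
  assumes "r \<le> n"
  shows "carrier (rank_nullity_ring n (uniform_indep r n)) = chow_invariants n \<and>
    (\<exists>\<phi> \<in> ring_iso (mpoly_ring {1..n} Quot rel_ideal n)
                   (rank_nullity_ring n (uniform_indep r n)).
       \<forall>i\<in>{1..n}. \<phi> (rel_ideal n +>\<^bsub>mpoly_ring {1..n}\<^esub> mvar i) = level_class n i) \<and>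
    (\<forall>ord. monomial_order {1..n} ord \<and>
       (\<forall>i j. 1 \<le> i \<and> i < j \<and> j \<le> n \<longrightarrow>
          (var_mon j, var_mon i) \<in> ord \<and> var_mon j \<noteq> var_mon i) \<longrightarrow>
       groebner_basis {1..n} ord (rel_ideal n) (rel_polys n))"
proof -
  interpret h: ring_hom_ring "mpoly_ring {1..n}" "chow_ring n" "level_hom n"
    by (rule level_hom_ring_hom_ring)
  have R: "rank_nullity_ring n (uniform_indep r n) = (chow_ring n)\<lparr>carrier := level_hom n ` mpolys {1..n}\<rparr>"
    unfolding rank_nullity_ring_def rank_nullity_generated ..
  \<comment> \<open>The first isomorphism theorem for \<open>level_hom n\<close>, with kernel
    \<open>rel_ideal n\<close> and image the rank-nullity ring.\<close>
  have "(\<lambda>X. the_elem (level_hom n ` X)) \<in> ring_iso (mpoly_ring {1..n} Quot rel_ideal n) (rank_nullity_ring n (uniform_indep r n))"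
    using h.FactRing_iso_set_aux unfolding level_hom_kernel R mpoly_ring_simps .
  moreover have "the_elem (level_hom n ` (rel_ideal n +>\<^bsub>mpoly_ring {1..n}\<^esub> mvar i)) = level_class n i" if "i \<in> {1..n}" for i
  proof -
    have "the_elem (level_hom n ` (rel_ideal n +>\<^bsub>mpoly_ring {1..n}\<^esub> mvar i)) = level_hom n (mvar i)"
      using h.the_elem_simp[of "mvar i"] mpolys_mvar[OF that] unfolding level_hom_kernel mpoly_ring_simps .
    also have "\<dots> = level_class n i"
      by (simp add: level_hom_def level_class_def level_sum_def)
    finally show ?thesis .
  qed
  ultimately have "\<exists>\<phi> \<in> ring_iso (mpoly_ring {1..n} Quot rel_ideal n) (rank_nullity_ring n (uniform_indep r n)).
       \<forall>i\<in>{1..n}. \<phi> (rel_ideal n +>\<^bsub>mpoly_ring {1..n}\<^esub> mvar i) = level_class n i"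
    by (intro bexI[of _ "\<lambda>X. the_elem (level_hom n ` X)"] ballI)
  moreover have "carrier (rank_nullity_ring n (uniform_indep r n)) = chow_invariants n"
    unfolding R level_hom_image_invariants by simp
  moreover have "groebner_basis {1..n} ord (rel_ideal n) (rel_polys n)"
    if "monomial_order {1..n} ord \<and> (\<forall>i j. 1 \<le> i \<and> i < j \<and> j \<le> n \<longrightarrow>
          (var_mon j, var_mon i) \<in> ord \<and> var_mon j \<noteq> var_mon i)" for ord
    using that by (intro rel_polys_groebner) simp_all
  ultimately show ?thesis
    by (intro conjI allI impI)
qed

end
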